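(* Let $\alpha>n$ and let $f$ be a non-negative, non-zero function in $L^1(\mathbb{R}^n)\cap L^\infty(\mathbb{R}^n)$. Then $$\sigma_{n,\alpha}\,\|f\|_1^{\frac{n+\alpha}{n}}\,\|f\|_\infty^{-\frac{\alpha}{n}}\ \le\ \int_{\mathbb{R}^n}\int_{\mathbb{R}^n}\frac{\min\{f(x),f(y)\}}{|x-y|^{n-\alpha}}\,dx\,dy,$$ where $$\sigma_{n,\alpha}=\frac{n\,2^{\alpha}\,\pi^{\frac{n-\alpha-1}{2}}\,\Gamma\!\left(\frac{\alpha+1}{2}\right)\Gamma\!\left(\frac n2+1\right)^{\frac{\alpha}{n}}}{|\alpha|\,\Gamma\!\left(\frac{n+\alpha}{2}+1\right)}.$$ Equality holds if and only if $f$ is a constant multiple of the characteristic function of a ball.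
   Context: $\|f\|_1=\int_{\mathbb{R}^n}|f(x)|\,dx$ and $\|f\|_\infty$ is the essential supremum of $|f|$. Functions equal almost everywhere are identified (so the equality characterization is understood up to null sets); non-zero means $\{f\neq 0\}$ has positive measure. The right-hand side takes values in $[0,\infty]$. $\Gamma$ is the gamma function and $|\cdot|$ is the Euclidean norm. *)

theory Defs
  imports "HOL-Analysis.Analysis" "HOL-Probability.Essential_Supremum"
begin

definition L1_norm :: "('a::euclidean_space \<Rightarrow> real) \<Rightarrow> real" where
  "L1_norm f = (LINT x|lebesgue. \<bar>f x\<bar>)"

text \<open>The essential supremum is taken in the extended reals, so that
  essential boundedness of \<open>f\<close> is \<open>Linf_norm f < \<infinity>\<close>.\<close>

definition Linf_norm :: "('a::euclidean_space \<Rightarrow> real) \<Rightarrow> ereal" where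
  "Linf_norm f = esssup lebesgue (\<lambda>x. ereal \<bar>f x\<bar>)"

definition sigma_const :: "nat \<Rightarrow> real \<Rightarrow> real" where
  "sigma_const n \<alpha> =
     real n * 2 powr \<alpha> * pi powr ((real n - \<alpha> - 1) / 2) * Gamma ((\<alpha> + 1) / 2)
       * Gamma (real n / 2 + 1) powr (\<alpha> / real n)
     / (\<bar>\<alpha>\<bar> * Gamma ((real n + \<alpha>) / 2 + 1))"

end

theory Submission
  imports Defs
begin

text \<open>Writing \<open>min (f x) (f y)\<close> as an integral over the levels \<open>t\<close> turns the right-hand side into
  the integral of the energies of the sets \<open>{f > t}\<close> with respect to the kernel
  \<open>norm (x - y) powr (\<alpha> - n)\<close>. As the kernel increases with the distance, among sets of given
  measure exactly the balls minimize the energy, and the minimum is homogeneous of degree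
  \<open>(n + \<alpha>) / n\<close> in the measure; Jensen's inequality over \<open>0 < t < M\<close>, with \<open>M\<close> the essential
  supremum, gives the bound, with equality only if almost all level sets are one and the same ball.

  Minimality of balls is proved by polarization. Polarizing a set with respect to a hyperplane does
  not increase the energy, and an average over all reflections shows that, as long as
  the set differs from the ball, some polarization increases its overlap with the ball by a definite
  amount. For the equality case, the set is translated so that its overlap with the ball is maximal;
  then a polarization which increases the overlap must strictly decrease the energy.\<close>

subsection \<open>Hyperplane reflections\<close>

text \<open>Reflections are indexed by the image \<open>v\<close> of the origin because the target
  ball is centred there: the side of \<open>0\<close> is the side to which polarization moves mass,
  and \<open>ball v r\<close> is the mirror image of \<open>ball 0 r\<close>, which lets reflections
  compete with translations. The gain in overlap is needed with a constant that depends only on the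
  dimension and on the radius of a large ball containing all sets. The supremum of the overlap is
  then contradicted directly, and no limit of polarized sets, hence no compactness of sets, enters.
  That argument alone says nothing about equality: a polarization that merely reflects the set, as
  can happen for a ball off the origin, leaves the energy unchanged. Comparison with translates of
  the ball rules this out, and a best translate exists because the centre ranges over a
  finite-dimensional space. The hypothesis \<alpha> > n makes the kernel strictly increasing and
  also bounded on bounded sets; the latter controls the energy by the missing overlap. The constant
  \<open>sigma_const n \<alpha>\<close> is the energy of a ball of volume one.\<close>

definition mirror :: "'a::euclidean_space \<Rightarrow> 'a \<Rightarrow> 'a" where
  "mirror v x = x - (2 * (x \<bullet> v) / (v \<bullet> v)) *\<^sub>R v"

text \<open>For \<open>v \<noteq> 0\<close> this is the reflection exchanging \<open>0\<close> and \<open>v\<close>; the junk value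
  \<open>swap0 0\<close> is the identity.\<close>

definition swap0 :: "'a::euclidean_space \<Rightarrow> 'a \<Rightarrow> 'a" where
  "swap0 v x = v + mirror v x"

lemma mirror_measurable [measurable]: "mirror v \<in> borel_measurable borel"
  unfolding mirror_def by measurable

lemma swap0_measurable [measurable]: "swap0 v \<in> borel_measurable borel"
  unfolding swap0_def by measurable

lemma mirror_add: "mirror v (x + y) = mirror v x + mirror v y"
  by (simp add: mirror_def inner_add_left algebra_simps add_divide_distrib)

lemma mirror_diff: "mirror v (x - y) = mirror v x - mirror v y"
  by (simp add: mirror_def inner_diff_left algebra_simps diff_divide_distrib)

lemma inner_mirror: "mirror v x \<bullet> v = - (x \<bullet> v)"
  by (simp add: mirror_def inner_diff_left)

lemma mirror_mirror [simp]: "mirror v (mirror v x) = x"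
proof -
  have "mirror v (mirror v x) = mirror v x - (2 * (mirror v x \<bullet> v) / (v \<bullet> v)) *\<^sub>R v"
    by (simp only: mirror_def[of v "mirror v x"])
  then show ?thesis
    unfolding inner_mirror by (simp add: mirror_def)
qed

lemma inner_mirror_mirror [simp]: "mirror v x \<bullet> mirror v y = x \<bullet> y"
proof -
  have "mirror v x \<bullet> mirror v y = mirror v x \<bullet> y - 2 * (y \<bullet> v) / (v \<bullet> v) * (mirror v x \<bullet> v)"
    by (subst (2) mirror_def) (simp add: inner_diff_right)
  also have "\<dots> = x \<bullet> y"
    unfolding inner_mirror by (simp add: mirror_def inner_diff_left) (simp add: inner_commute)
  finally show ?thesis .
qed

lemma norm_mirror [simp]: "norm (mirror v x) = norm x"
  by (simp add: norm_eq_sqrt_inner)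

text \<open>The equal norms give
  \<open>2 * (a \<bullet> (a - b)) = (a - b) \<bullet> (a - b)\<close>, so exactly
  \<open>a - b\<close> is subtracted. One reflection thus does the work of a rotation taking a
  vector to a coordinate axis.\<close>

lemma mirror_maps_diff:
  assumes "norm a = norm b"
  shows "mirror (a - b) a = b"
proof (cases "a = b")
  case False
  have eq: "b \<bullet> b = a \<bullet> a"
    using assms by (simp add: norm_eq_sqrt_inner)
  then have "2 * (a \<bullet> (a - b)) = (a - b) \<bullet> (a - b)"
    by (simp add: inner_diff_left inner_diff_right inner_commute)
  moreover have "(a - b) \<bullet> (a - b) \<noteq> 0"
    using False by simp
  ultimately show ?thesis
    by (simp add: mirror_def)
qed (simp add: mirror_def)

section \<open>Invariance of Lebesgue measure under translations, dilations and reflections\<close>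

lemma nn_integral_lborel_translate:
  fixes g :: "'a::euclidean_space \<Rightarrow> ennreal"
  assumes [measurable]: "g \<in> borel_measurable borel"
  shows "(\<integral>\<^sup>+x. g (x + a) \<partial>lborel) = (\<integral>\<^sup>+x. g x \<partial>lborel)"
proof -
  have "(\<integral>\<^sup>+x. g x \<partial>lborel) = (\<integral>\<^sup>+x. g x \<partial>distr lborel borel ((+) a))"
    by (simp only: lborel_distr_plus)
  also have "\<dots> = (\<integral>\<^sup>+x. g (x + a) \<partial>lborel)"
    by (simp add: nn_integral_distr add.commute)
  finally show ?thesis ..
qed

lemma nn_integral_lborel_scale:
  fixes g :: "'a::euclidean_space \<Rightarrow> ennreal"
  assumes [measurable]: "g \<in> borel_measurable borel" and c: "c > 0"
  shows "(\<integral>\<^sup>+x. g x \<partial>lborel) = ennreal (c ^ DIM('a)) * (\<integral>\<^sup>+x. g (c *\<^sub>R x) \<partial>lborel)"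
proof -
  have "(\<integral>\<^sup>+x. g x \<partial>lborel)
      = (\<integral>\<^sup>+x. g x \<partial>density (distr lborel borel (\<lambda>x::'a. 0 + c *\<^sub>R x)) (\<lambda>_. \<bar>c\<bar> ^ DIM('a)))"
    using lborel_affine[of c "0::'a"] c by simp
  also have "\<dots> = ennreal (c ^ DIM('a)) * (\<integral>\<^sup>+x. g (c *\<^sub>R x) \<partial>lborel)"
    using c by (simp add: nn_integral_density nn_integral_distr nn_integral_cmult)
  finally show ?thesis .
qed

text \<open>Uniqueness of Haar measure in disguise:
  \<open>indicator A (mirror v x + y) * indicator (ball 0 1) y\<close> is integrated in both orders.\<close>

lemma distr_mirror: "distr lborel borel (mirror v) = (lborel :: 'a::euclidean_space measure)"
proof (rule measure_eqI)
  fix A :: "'a set"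
  assume "A \<in> sets (distr lborel borel (mirror v))"
  then have [measurable]: "A \<in> sets borel" by simp
  let ?B = "ball 0 1 :: 'a set"
  have [measurable]: "?B \<in> sets borel" by simp
  let ?b = "emeasure lborel ?B"
  have "emeasure (distr lborel borel (mirror v)) A * ?b
      = (\<integral>\<^sup>+x. indicator A (mirror v x) \<partial>lborel) * (\<integral>\<^sup>+y. indicator ?B y \<partial>lborel)"
    by (simp add: nn_integral_distr flip: nn_integral_indicator)
  also have "\<dots> = (\<integral>\<^sup>+y. (\<integral>\<^sup>+x. indicator A (mirror v x) \<partial>lborel) * indicator ?B y \<partial>lborel)"
    by (subst nn_integral_cmult) auto
  also have "\<dots> = (\<integral>\<^sup>+y. (\<integral>\<^sup>+x. indicator A (mirror v x + y) * indicator ?B y \<partial>lborel) \<partial>lborel)"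
  proof (rule nn_integral_cong)
    fix y :: 'a
    have "(\<integral>\<^sup>+x. indicator A (mirror v x) \<partial>lborel)
        = (\<integral>\<^sup>+x. indicator A (mirror v (x + mirror v y)) \<partial>lborel :: ennreal)"
      by (rule nn_integral_lborel_translate[symmetric]) measurable
    then show "(\<integral>\<^sup>+x. indicator A (mirror v x) \<partial>lborel) * indicator ?B y
        = (\<integral>\<^sup>+x. indicator A (mirror v x + y) * indicator ?B y \<partial>lborel :: ennreal)"
      by (simp add: mirror_add nn_integral_multc)
  qed
  also have "\<dots> = (\<integral>\<^sup>+x. (\<integral>\<^sup>+y. indicator A (mirror v x + y) * indicator ?B y \<partial>lborel) \<partial>lborel)"
    by (rule lborel_pair.Fubini') measurable
  also have "\<dots> = (\<integral>\<^sup>+x. (\<integral>\<^sup>+y. indicator A y * indicator ?B (y - mirror v x) \<partial>lborel) \<partial>lborel)"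
  proof (rule nn_integral_cong)
    fix x :: 'a
    show "(\<integral>\<^sup>+y. indicator A (mirror v x + y) * indicator ?B y \<partial>lborel :: ennreal)
        = (\<integral>\<^sup>+y. indicator A y * indicator ?B (y - mirror v x) \<partial>lborel)"
      using nn_integral_lborel_translate[of "\<lambda>y. indicator A y * indicator ?B (y - mirror v x)" "mirror v x"]
      by (simp add: add.commute)
  qed
  also have "\<dots> = (\<integral>\<^sup>+y. (\<integral>\<^sup>+x. indicator A y * indicator ?B (y - mirror v x) \<partial>lborel) \<partial>lborel)"
    by (rule lborel_pair.Fubini') measurable
  also have "\<dots> = (\<integral>\<^sup>+y. indicator A y * ?b \<partial>lborel)"
  proof (rule nn_integral_cong)
    fix y :: 'a
    have "norm (y - mirror v x) = norm (x - mirror v y)" for x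
    proof -
      have "norm (x - mirror v y) = norm (mirror v (x - mirror v y))"
        by simp
      also have "\<dots> = norm (mirror v x - y)"
        by (simp only: mirror_diff mirror_mirror)
      finally show ?thesis by (simp add: norm_minus_commute)
    qed
    then have "indicator ?B (y - mirror v x) = (indicator (ball (mirror v y) 1) x :: ennreal)" for x
      by (auto simp: indicator_def dist_norm norm_minus_commute)
    then have "(\<integral>\<^sup>+x. indicator ?B (y - mirror v x) \<partial>lborel) = ?b"
      by (simp add: emeasure_ball)
    then show "(\<integral>\<^sup>+x. indicator A y * indicator ?B (y - mirror v x) \<partial>lborel) = indicator A y * ?b"
      by (subst nn_integral_cmult) auto
  qed
  also have "\<dots> = emeasure lborel A * ?b"
    by (subst nn_integral_multc) auto
  finally show "emeasure (distr lborel borel (mirror v)) A = emeasure lborel A"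
    using unit_ball_vol_pos[of "real DIM('a)"]
    by (simp add: emeasure_ball ennreal_eq_0_iff not_le mult.commute[of _ "ennreal _"]
        ennreal_mult_cancel_left del: unit_ball_vol_pos)
qed simp

lemma nn_integral_mirror:
  fixes g :: "'a::euclidean_space \<Rightarrow> ennreal"
  assumes [measurable]: "g \<in> borel_measurable borel"
  shows "(\<integral>\<^sup>+x. g (mirror v x) \<partial>lborel) = (\<integral>\<^sup>+x. g x \<partial>lborel)"
proof -
  have "(\<integral>\<^sup>+x. g x \<partial>lborel) = (\<integral>\<^sup>+x. g x \<partial>distr lborel borel (mirror v))"
    by (simp only: distr_mirror)
  also have "\<dots> = (\<integral>\<^sup>+x. g (mirror v x) \<partial>lborel)"
    by (simp add: nn_integral_distr)
  finally show ?thesis ..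
qed

lemma nn_integral_swap0:
  fixes g :: "'a::euclidean_space \<Rightarrow> ennreal"
  assumes [measurable]: "g \<in> borel_measurable borel"
  shows "(\<integral>\<^sup>+x. g (swap0 v x) \<partial>lborel) = (\<integral>\<^sup>+x. g x \<partial>lborel)"
  unfolding swap0_def
  using nn_integral_mirror[of "\<lambda>x. g (v + x)" v] nn_integral_lborel_translate[of g v]
  by (simp add: add.commute)

lemma swap0_swap0 [simp]: "swap0 v (swap0 v x) = x"
proof -
  have "mirror v v = - v"
    by (cases "v = 0") (simp_all add: mirror_def scaleR_2)
  then show ?thesis
    by (simp add: swap0_def mirror_add)
qed

lemma norm_swap0_diff: "norm (swap0 v x - swap0 v y) = norm (x - y)"
  by (simp add: swap0_def flip: mirror_diff)

definition near0 :: "'a::euclidean_space \<Rightarrow> 'a set" where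
  "near0 v = {x. 2 * (x \<bullet> v) < v \<bullet> v}"

lemma near0_measurable [measurable]: "near0 v \<in> sets borel"
  unfolding near0_def by measurable

text \<open>\<open>1 - 2 * (x \<bullet> v) / (v \<bullet> v)\<close> is, up to a positive factor, the signed distance of \<open>x\<close> to the
  hyperplane of reflection, positive on the side of \<open>0\<close>.\<close>

lemma swap0_alt: "v \<noteq> 0 \<Longrightarrow> swap0 v x = x + (1 - 2 * (x \<bullet> v) / (v \<bullet> v)) *\<^sub>R v"
  by (simp add: swap0_def mirror_def algebra_simps)

lemma near0_iff: "v \<noteq> 0 \<Longrightarrow> x \<in> near0 v \<longleftrightarrow> 0 < 1 - 2 * (x \<bullet> v) / (v \<bullet> v)"
  by (simp add: near0_def divide_simps)

text \<open>The correction term is four times the product of the signed distances of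
  \<open>x\<close> and \<open>y\<close> to the hyperplane; its sign decides whether reflecting
  \<open>y\<close> moves it away from \<open>x\<close>.\<close>

lemma dist_swap0_sq:
  assumes "v \<noteq> 0"
  shows "(norm (x - swap0 v y))\<^sup>2 = (norm (x - y))\<^sup>2
    + (1 - 2 * (x \<bullet> v) / (v \<bullet> v)) * (1 - 2 * (y \<bullet> v) / (v \<bullet> v)) * (v \<bullet> v)"
proof -
  define k where "k = (\<lambda>x. 1 - 2 * (x \<bullet> v) / (v \<bullet> v))"
  have xv: "x \<bullet> v = (1 - k x) * (v \<bullet> v) / 2" for x
    using assms by (simp add: k_def field_simps)
  have "(norm (x - swap0 v y))\<^sup>2 = ((x - y) - k y *\<^sub>R v) \<bullet> ((x - y) - k y *\<^sub>R v)"
    using assms by (simp add: swap0_alt power2_norm_eq_inner k_def diff_diff_eq)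
  also have "\<dots> = (x - y) \<bullet> (x - y) - 2 * k y * (x \<bullet> v - y \<bullet> v) + (k y)\<^sup>2 * (v \<bullet> v)"
    by (simp add: inner_diff_left inner_diff_right algebra_simps inner_commute power2_eq_square)
  also have "\<dots> = (norm (x - y))\<^sup>2 + k x * k y * (v \<bullet> v)"
    unfolding xv[of x] xv[of y] power2_norm_eq_inner by (simp add: field_simps power2_eq_square)
  finally show ?thesis by (simp add: k_def)
qed

lemma near0_swap0:
  assumes "v \<noteq> 0"
  shows "swap0 v x \<in> near0 v \<longleftrightarrow> 2 * (x \<bullet> v) > v \<bullet> v"
proof -
  have "swap0 v x \<bullet> v = v \<bullet> v - x \<bullet> v"
    by (simp add: swap0_def inner_add_left inner_mirror)
  then show ?thesis by (auto simp: near0_def)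
qed

lemma dist_less_dist_swap0:
  assumes "v \<noteq> 0" "x \<in> near0 v" "y \<in> near0 v"
  shows "norm (x - y) < norm (x - swap0 v y)"
proof -
  have "(norm (x - y))\<^sup>2 < (norm (x - swap0 v y))\<^sup>2"
    using assms by (simp add: dist_swap0_sq near0_iff)
  then show ?thesis
    by (rule power2_less_imp_less) simp
qed

lemma norm_less_norm_swap0:
  assumes "v \<noteq> 0"
  shows "norm x < norm (swap0 v x) \<longleftrightarrow> x \<in> near0 v"
proof -
  have "(norm (swap0 v x))\<^sup>2 = (norm x)\<^sup>2 + (1 - 2 * (x \<bullet> v) / (v \<bullet> v)) * (v \<bullet> v)"
    using dist_swap0_sq[of v 0 x] assms by simp
  then have "norm x ^ 2 < norm (swap0 v x) ^ 2 \<longleftrightarrow> x \<in> near0 v"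
    using assms not_less[of "v \<bullet> v" 0] by (simp add: near0_iff zero_less_mult_iff)
  then show ?thesis
    by (metis norm_ge_zero power2_less_imp_less power_strict_mono zero_less_numeral)
qed

lemma swap0_fixed: "\<lbrakk>v \<noteq> 0; x \<notin> near0 v; swap0 v x \<notin> near0 v\<rbrakk> \<Longrightarrow> swap0 v x = x"
  unfolding near0_swap0 unfolding near0_def by (simp add: swap0_alt)

subsection \<open>Polarization\<close>

text \<open>Used with \<open>p = \<alpha> - n\<close>. Values in \<open>ennreal\<close> avoid any
  integrability condition on the set.\<close>

definition energy :: "real \<Rightarrow> 'a::euclidean_space set \<Rightarrow> ennreal" where
  "energy p E = (\<integral>\<^sup>+x. (\<integral>\<^sup>+y. indicator E x * indicator E y * ennreal (norm (x - y) powr p)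
      \<partial>lborel) \<partial>lborel)"

lemma energy_mono: "A \<subseteq> B \<Longrightarrow> energy p A \<le> energy p B"
  unfolding energy_def
  by (intro nn_integral_mono mult_mono) (auto simp: indicator_def)

text \<open>Of a pair of mirror points with just one member in \<open>E\<close>, the one nearer to
  the origin is kept. For \<open>v \<noteq> 0\<close>, points of the hyperplane fall under the
  second branch, harmlessly: there \<open>swap0 v x = x\<close> and both branches say
  \<open>x \<in> E\<close>.\<close>

definition polarize :: "'a::euclidean_space \<Rightarrow> 'a set \<Rightarrow> 'a set" where
  "polarize v E = {x. if x \<in> near0 v then x \<in> E \<or> swap0 v x \<in> E else x \<in> E \<and> swap0 v x \<in> E}"

lemma polarize_measurable [measurable]:
  assumes [measurable]: "E \<in> sets borel"
  shows "polarize v E \<in> sets borel"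
  unfolding polarize_def by measurable

lemma swap0_near0_cases:
  assumes "v \<noteq> 0"
  obtains "x \<in> near0 v" "swap0 v x \<notin> near0 v" | "x \<notin> near0 v" "swap0 v x \<in> near0 v"
    | "x \<notin> near0 v" "swap0 v x = x"
  using swap0_fixed[OF assms, of x] near0_swap0[OF assms, of x] by (force simp: near0_def)

text \<open>The sum of the integrand of the energy over the four points obtained by reflecting
  \<open>x\<close> and \<open>y\<close> independently; on it the effect of polarization is a pointwise inequality.\<close>

definition fold4 :: "real \<Rightarrow> 'a::euclidean_space set \<Rightarrow> 'a \<Rightarrow> 'a \<Rightarrow> 'a \<Rightarrow> ennreal" where
  "fold4 p E v x y =
     (indicator E x * indicator E y + indicator E (swap0 v x) * indicator E (swap0 v y))
       * ennreal (norm (x - y) powr p)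
   + (indicator E (swap0 v x) * indicator E y + indicator E x * indicator E (swap0 v y))
       * ennreal (norm (x - swap0 v y) powr p)"

lemma fold4_measurable [measurable]:
  assumes [measurable]: "E \<in> sets borel"
  shows "(\<lambda>(x, y). fold4 p E v x y) \<in> borel_measurable (lborel \<Otimes>\<^sub>M lborel)"
  unfolding fold4_def by measurable

lemma norm_swap0_left: "norm (swap0 v x - y) = norm (x - swap0 v y)"
  using norm_swap0_diff[of v x "swap0 v y"] by simp

lemma fold4_swap0_left: "fold4 p E v (swap0 v x) y = fold4 p E v x y"
  by (simp add: fold4_def norm_swap0_diff norm_swap0_left algebra_simps)

lemma fold4_swap0_right: "fold4 p E v x (swap0 v y) = fold4 p E v x y"
  by (simp add: fold4_def norm_swap0_diff norm_swap0_left algebra_simps)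

text \<open>Each of the four points contributes the integrand of the energy with \<open>x\<close>,
  \<open>y\<close>, both or neither reflected, and reflections preserve Lebesgue measure.\<close>

lemma energy_eq_fold4:
  assumes [measurable]: "E \<in> sets borel"
  shows "4 * energy p E = (\<integral>\<^sup>+x. (\<integral>\<^sup>+y. fold4 p E v x y \<partial>lborel) \<partial>lborel)"
proof -
  define G where "G = (\<lambda>x y. indicator E x * indicator E y * ennreal (norm (x - y) powr p))"
  have [measurable]: "(\<lambda>(x, y). G x y) \<in> borel_measurable (borel \<Otimes>\<^sub>M borel)"
    unfolding G_def by measurable
  have Gm [measurable]: "(\<lambda>z. G (f z) (g z)) \<in> borel_measurable M"
    if [measurable]: "f \<in> borel_measurable M" "g \<in> borel_measurable M" for f g and M :: "'b measure"
    unfolding G_def by measurable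
  have x: "(\<integral>\<^sup>+x. h (swap0 v x) \<partial>lborel) = (\<integral>\<^sup>+x. h x \<partial>lborel)"
    if "h \<in> borel_measurable borel" for h :: "'a \<Rightarrow> ennreal"
    using that by (rule nn_integral_swap0)
  have hm: "(\<lambda>x. \<integral>\<^sup>+y. G x y \<partial>lborel) \<in> borel_measurable borel"
    by measurable
  have "fold4 p E v x y = G x y + G (swap0 v x) y + G x (swap0 v y) + G (swap0 v x) (swap0 v y)" for x y
    unfolding fold4_def G_def norm_swap0_diff norm_swap0_left by (simp add: algebra_simps)
  then have "(\<integral>\<^sup>+x. (\<integral>\<^sup>+y. fold4 p E v x y \<partial>lborel) \<partial>lborel)
     = (\<integral>\<^sup>+x. (\<integral>\<^sup>+y. G x y \<partial>lborel) \<partial>lborel) + (\<integral>\<^sup>+x. (\<integral>\<^sup>+y. G (swap0 v x) y \<partial>lborel) \<partial>lborel)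
     + (\<integral>\<^sup>+x. (\<integral>\<^sup>+y. G x (swap0 v y) \<partial>lborel) \<partial>lborel)
     + (\<integral>\<^sup>+x. (\<integral>\<^sup>+y. G (swap0 v x) (swap0 v y) \<partial>lborel) \<partial>lborel)"
    by (simp add: nn_integral_add)
  moreover have "(\<integral>\<^sup>+y. G a (swap0 v y) \<partial>lborel) = (\<integral>\<^sup>+y. G a y \<partial>lborel)" for a
    by (rule x) measurable
  moreover have "(\<integral>\<^sup>+x. (\<integral>\<^sup>+y. G (swap0 v x) y \<partial>lborel) \<partial>lborel) = (\<integral>\<^sup>+x. (\<integral>\<^sup>+y. G x y \<partial>lborel) \<partial>lborel)"
    by (rule x[OF hm])
  moreover have "energy p E = (\<integral>\<^sup>+x. (\<integral>\<^sup>+y. G x y \<partial>lborel) \<partial>lborel)"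
    by (simp add: energy_def G_def)
  moreover have "4 * a = a + a + a + a" for a :: ennreal
  proof -
    have "4 * a = (1 + 1 + 1 + 1) * a" by simp
    then show ?thesis by (simp only: distrib_right mult_1)
  qed
  ultimately show ?thesis
    by simp
qed

text \<open>Polarization only permutes the indicator values within a mirror pair. Preservation of
  volume, and invariance of \<open>fold4\<close> for points on the hyperplane, rest on this.\<close>

lemma indicator_polarize_sum:
  assumes "v \<noteq> 0"
  shows "indicator (polarize v E) x + indicator (polarize v E) (swap0 v x)
    = (indicator E x + indicator E (swap0 v x) :: ennreal)"
  by (rule swap0_near0_cases[OF assms, of x]) (auto simp: polarize_def indicator_def)

text \<open>The four-point sum changes only if one pair is occupied at its near point alone and the
  other at its far point alone: then a single interaction across the hyperplane, over the larger
  distance, is replaced by one within the near side.\<close>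

lemma fold4_polarize_near:
  assumes "v \<noteq> 0" "p > 0" "x \<in> near0 v" "y \<in> near0 v"
  shows "fold4 p (polarize v E) v x y \<le> fold4 p E v x y"
    and "\<lbrakk>x \<in> E; swap0 v x \<notin> E; y \<notin> E; swap0 v y \<in> E\<rbrakk> \<Longrightarrow>
      fold4 p (polarize v E) v x y < fold4 p E v x y"
proof -
  have "norm (x - y) powr p < norm (x - swap0 v y) powr p"
    using dist_less_dist_swap0[OF assms(1,3,4)] assms(2) by (simp add: powr_less_mono2)
  then have k: "ennreal (norm (x - y) powr p) < ennreal (norm (x - swap0 v y) powr p)"
    by (simp add: ennreal_less_iff)
  have "swap0 v x \<notin> near0 v" "swap0 v y \<notin> near0 v"
    using assms near0_swap0[OF assms(1)] by (auto simp: near0_def)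
  then have *: "x \<in> polarize v E \<longleftrightarrow> x \<in> E \<or> swap0 v x \<in> E" "swap0 v x \<in> polarize v E \<longleftrightarrow> x \<in> E \<and> swap0 v x \<in> E"
     "y \<in> polarize v E \<longleftrightarrow> y \<in> E \<or> swap0 v y \<in> E" "swap0 v y \<in> polarize v E \<longleftrightarrow> y \<in> E \<and> swap0 v y \<in> E"
    using assms by (auto simp: polarize_def)
  show "fold4 p (polarize v E) v x y \<le> fold4 p E v x y"
    unfolding fold4_def indicator_def * using less_imp_le[OF k]
    by (cases "x \<in> E"; cases "y \<in> E"; cases "swap0 v x \<in> E"; cases "swap0 v y \<in> E") (simp_all add: add.commute)
  show "fold4 p (polarize v E) v x y < fold4 p E v x y"
    if "x \<in> E" "swap0 v x \<notin> E" "y \<notin> E" "swap0 v y \<in> E"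
    unfolding fold4_def indicator_def * using that k by simp
qed

text \<open>A point of the hyperplane is equidistant from \<open>y\<close> and
  \<open>swap0 v y\<close>, so only the sum of their indicators enters.\<close>

lemma fold4_polarize_fixed:
  assumes "v \<noteq> 0" "swap0 v x = x"
  shows "fold4 p (polarize v E) v x y = fold4 p E v x y"
proof -
  have "norm (x - swap0 v y) = norm (x - y)"
    using norm_swap0_left[of v x y] assms(2) by simp
  then have "fold4 p E v x y =
      2 * indicator E x * (indicator E y + indicator E (swap0 v y)) * ennreal (norm (x - y) powr p)" for E
    unfolding fold4_def assms(2) by (simp add: algebra_simps mult_2)
  moreover have "x \<in> polarize v E \<longleftrightarrow> x \<in> E"
    using assms(2) by (simp add: polarize_def)
  then have "indicator (polarize v E) x = (indicator E x :: ennreal)"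
    by (simp add: indicator_def)
  ultimately show ?thesis
    using indicator_polarize_sum[OF assms(1)] by simp
qed

lemma fold4_commute: "fold4 p E v x y = fold4 p E v y x"
  unfolding fold4_def norm_minus_commute[of x] norm_swap0_left by (simp add: algebra_simps)

lemma fold4_polarize_le:
  assumes "v \<noteq> 0" "p > 0"
  shows "fold4 p (polarize v E) v x y \<le> fold4 p E v x y"
proof (cases "swap0 v x = x \<or> swap0 v y = y")
  case True
  then show ?thesis
    using fold4_polarize_fixed[OF assms(1)] fold4_commute by (metis order_refl)
next
  case False
  \<comment> \<open>\<open>fold4\<close> depends only on the two mirror pairs, so each point off the
    hyperplane may be replaced by its near representative.\<close>
  obtain a where a: "a \<in> near0 v" "a = x \<or> a = swap0 v x"
    using False by (rule_tac swap0_near0_cases[OF assms(1), of x]) auto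
  obtain b where b: "b \<in> near0 v" "b = y \<or> b = swap0 v y"
    using False by (rule_tac swap0_near0_cases[OF assms(1), of y]) auto
  have "fold4 p F v x y = fold4 p F v a b" for F
    using a b by (auto simp: fold4_swap0_left fold4_swap0_right)
  then show ?thesis
    using fold4_polarize_near(1)[OF assms a(1) b(1)] by simp
qed

lemma energy_polarize_le:
  assumes [measurable]: "E \<in> sets borel" and v: "v \<noteq> 0" "p > 0"
  shows "energy p (polarize v E) \<le> energy p E"
proof -
  have "4 * energy p (polarize v E) \<le> 4 * energy p E"
    unfolding energy_eq_fold4[OF assms(1), of p v]
      energy_eq_fold4[OF polarize_measurable[OF assms(1)], of p v v]
    by (intro nn_integral_mono fold4_polarize_le v)
  then show ?thesis
    by (simp add: ennreal_mult_le_mult_iff)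
qed

text \<open>On the product of the two sets the four-point inequality is strict, and the product has
  positive measure because both factors do. Finite energy turns this into a strict inequality of
  integrals.\<close>

lemma energy_polarize_less:
  fixes E :: "'a::euclidean_space set"
  assumes [measurable]: "E \<in> sets borel" and v: "v \<noteq> 0" "p > 0" and fin: "energy p E < \<infinity>"
    and S: "emeasure lborel {x\<in>near0 v. x \<in> E \<and> swap0 v x \<notin> E} \<noteq> 0"
    and T: "emeasure lborel {x\<in>near0 v. x \<notin> E \<and> swap0 v x \<in> E} \<noteq> 0"
  shows "energy p (polarize v E) < energy p E"
proof -
  let ?L = "lborel \<Otimes>\<^sub>M lborel :: ('a \<times> 'a) measure"
  let ?S = "{x\<in>near0 v. x \<in> E \<and> swap0 v x \<notin> E}" and ?T = "{x\<in>near0 v. x \<notin> E \<and> swap0 v x \<in> E}"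
  have eq: "(\<integral>\<^sup>+z. (case z of (x, y) \<Rightarrow> fold4 p F v x y) \<partial>?L) = 4 * energy p F" if [measurable]: "F \<in> sets borel" for F
    unfolding energy_eq_fold4[OF that, of p v]
    by (subst lborel.nn_integral_fst[symmetric]) auto
  have [measurable]: "?S \<in> sets borel" "?T \<in> sets borel"
    by measurable
  have "(\<integral>\<^sup>+z. (case z of (x, y) \<Rightarrow> fold4 p (polarize v E) v x y) \<partial>?L) < (\<integral>\<^sup>+z. (case z of (x, y) \<Rightarrow> fold4 p E v x y) \<partial>?L)"
  proof (rule nn_integral_less)
    have "4 * energy p (polarize v E) < \<infinity>"
      using le_less_trans[OF energy_polarize_le[OF assms(1) v] fin] by (simp add: ennreal_mult_less_top)
    then show "(\<integral>\<^sup>+z. (case z of (x, y) \<Rightarrow> fold4 p (polarize v E) v x y) \<partial>?L) \<noteq> \<infinity>"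
      by (subst eq) auto
    show "\<not> (AE z in ?L. (case z of (x, y) \<Rightarrow> fold4 p E v x y) \<le> (case z of (x, y) \<Rightarrow> fold4 p (polarize v E) v x y))"
    proof
      assume "AE z in ?L. (case z of (x, y) \<Rightarrow> fold4 p E v x y) \<le> (case z of (x, y) \<Rightarrow> fold4 p (polarize v E) v x y)"
      then have "AE z in ?L. z \<notin> ?S \<times> ?T"
        by eventually_elim (use fold4_polarize_near(2)[OF v] in \<open>auto simp: not_le[symmetric]\<close>)
      then have "emeasure ?L (?S \<times> ?T) = 0"
        by (subst (asm) AE_iff_measurable[OF _ refl]) (auto simp: space_pair_measure)
      then show False
        using S T by (subst (asm) lborel.emeasure_pair_measure_Times) auto
    qed
  qed (auto simp: fold4_polarize_le[OF v])
  then have "4 * energy p (polarize v E) < 4 * energy p E"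
    by (simp only: eq assms(1) polarize_measurable)
  then show ?thesis
    by (meson mult_left_mono not_le zero_le)
qed

lemma emeasure_polarize:
  assumes [measurable]: "E \<in> sets borel" and v: "v \<noteq> 0"
  shows "emeasure lborel (polarize v E) = emeasure lborel E"
proof -
  have *: "(\<integral>\<^sup>+x. indicator F x + indicator F (swap0 v x) \<partial>lborel) = 2 * emeasure lborel F"
    if [measurable]: "F \<in> sets borel" for F
    by (subst nn_integral_add) (auto simp: nn_integral_swap0 mult_2)
  have "2 * emeasure lborel (polarize v E) = 2 * emeasure lborel E"
    unfolding *[symmetric, OF assms(1)] *[symmetric, OF polarize_measurable[OF assms(1)]]
    by (simp add: indicator_polarize_sum[OF v])
  then show ?thesis
    by (simp add: ennreal_mult_cancel_left)
qed

text \<open>A point is added only in exchange for a mirror image of larger norm. All polarizations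
  thus stay in one ball, on which the averaging constant is uniform.\<close>

lemma polarize_subset_cball:
  assumes "v \<noteq> 0" "E \<subseteq> cball 0 R"
  shows "polarize v E \<subseteq> cball 0 R"
proof
  fix x assume x: "x \<in> polarize v E"
  show "x \<in> cball 0 R"
  proof (cases "x \<in> E")
    case False
    then have "norm x < norm (swap0 v x)" "norm (swap0 v x) \<le> R"
      using x assms norm_less_norm_swap0[of v x] by (auto simp: polarize_def split: if_splits)
    then show ?thesis by simp
  qed (use assms in auto)
qed

text \<open>Together with a point the ball contains the nearer point of its mirror pair, so no
  overlap is lost. A point of the second set is in the ball while its mirror image is not, hence on
  the near side, and polarization fills it from outside the ball.\<close>

lemma emeasure_polarize_Int_ball:
  fixes E :: "'a::euclidean_space set"
  assumes [measurable]: "E \<in> sets borel" and v: "v \<noteq> 0"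
  shows "emeasure lborel (E \<inter> ball 0 r) + emeasure lborel {x \<in> ball 0 r - E. swap0 v x \<in> E - ball 0 r}
    \<le> emeasure lborel (polarize v E \<inter> ball 0 r)"
proof -
  let ?B = "ball 0 r :: 'a set"
  let ?T = "{x \<in> ?B - E. swap0 v x \<in> E - ?B}"
  have [measurable]: "?B \<in> sets borel"
    by simp
  have [measurable]: "?T \<in> sets borel"
    by measurable
  have *: "(\<integral>\<^sup>+x. indicator F x + indicator F (swap0 v x) \<partial>lborel) = 2 * emeasure lborel F"
    if [measurable]: "F \<in> sets borel" for F
    by (subst nn_integral_add) (auto simp: nn_integral_swap0 mult_2)
  have pw: "indicator (E \<inter> ?B) x + indicator (E \<inter> ?B) (swap0 v x) + (indicator ?T x + indicator ?T (swap0 v x))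
     \<le> (indicator (polarize v E \<inter> ?B) x + indicator (polarize v E \<inter> ?B) (swap0 v x) :: ennreal)" for x
  proof (rule swap0_near0_cases[OF v, of x])
    assume "x \<in> near0 v" "swap0 v x \<notin> near0 v"
    moreover from this have "norm x < norm (swap0 v x)"
      using norm_less_norm_swap0[OF v] by simp
    ultimately show ?thesis
      by (auto simp: polarize_def indicator_def)
  next
    assume "x \<notin> near0 v" "swap0 v x \<in> near0 v"
    moreover from this have "norm (swap0 v x) < norm x"
      using norm_less_norm_swap0[OF v, of "swap0 v x"] by simp
    ultimately show ?thesis
      by (auto simp: polarize_def indicator_def)
  next
    assume "x \<notin> near0 v" "swap0 v x = x"
    then show ?thesis
      by (auto simp: polarize_def indicator_def)
  qed
  have "2 * emeasure lborel (E \<inter> ?B) + 2 * emeasure lborel ?T \<le> 2 * emeasure lborel (polarize v E \<inter> ?B)"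
    by (simp only: *[symmetric, OF \<open>?T \<in> sets borel\<close>] *[symmetric, of "E \<inter> ?B"] *[symmetric, of "polarize v E \<inter> ?B"] assms(1) sets.Int \<open>?B \<in> sets borel\<close> polarize_measurable, subst nn_integral_add[symmetric])
      (measurable, intro nn_integral_mono pw)
  then show ?thesis
    unfolding distrib_left[symmetric]
    by (subst (asm) ennreal_mult_le_mult_iff) simp_all
qed

subsection \<open>Averaging over reflections\<close>

lemma swap0_measurable2 [measurable (raw)]:
  assumes [measurable]: "f \<in> borel_measurable M" "g \<in> borel_measurable M"
  shows "(\<lambda>z. swap0 (f z) (g z)) \<in> borel_measurable M"
  unfolding swap0_def mirror_def by measurable

text \<open>With \<open>v = (2 * \<tau>) *\<^sub>R u\<close> the hyperplane passes through
  \<open>\<tau> *\<^sub>R u\<close> orthogonally to \<open>u\<close>. For a fixed direction the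
  image of \<open>x\<close> is affine in \<tau>, so that averaging over \<tau> is integration along
  a line through \<open>x\<close>.\<close>

lemma swap0_scaled:
  assumes "\<tau> \<noteq> 0"
  shows "swap0 ((2 * \<tau>) *\<^sub>R u) x = x + (2 * (\<tau> - (x \<bullet> u) / (u \<bullet> u))) *\<^sub>R u"
proof -
  have "2 * (x \<bullet> (2 * \<tau>) *\<^sub>R u) / (((2 * \<tau>) *\<^sub>R u) \<bullet> ((2 * \<tau>) *\<^sub>R u)) * (2 * \<tau>)
      = 2 * (x \<bullet> u) / (u \<bullet> u)"
    using assms by (simp add: divide_simps)
  then show ?thesis
    by (simp add: swap0_def mirror_def algebra_simps)
qed

text \<open>Polar coordinates with the sphere thickened to the annulus \<open>1 \<le> norm u \<le> 2\<close>,
  so that only dilations of Lebesgue measure are needed.\<close>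

lemma emeasure_le_ray_average:
  fixes C :: "'a::euclidean_space set"
  assumes [measurable]: "C \<in> sets borel"
    and C: "C \<subseteq> cball 0 R" and R: "R > 0" and x: "norm x \<le> R"
  defines "U \<equiv> {u::'a. 1 \<le> norm u \<and> norm u \<le> 2}"
  shows "ennreal (1 / (4 * (2 * R) ^ (DIM('a) - 1))) * emeasure lborel C
    \<le> (\<integral>\<^sup>+u. (\<integral>\<^sup>+\<tau>. indicator U u * indicator C (x + (2 * \<tau>) *\<^sub>R u) \<partial>lborel) \<partial>lborel)"
proof -
  let ?n = "DIM('a)"
  let ?\<kappa> = "1 / (4 * (2 * R) ^ (?n - 1))"
  have [measurable]: "U \<in> sets borel"
    unfolding U_def by measurable
  \<comment> \<open>The integrand written in the variable
    \<open>w = (2 * \<tau>) *\<^sub>R u\<close> instead of \<open>u\<close>.\<close>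
  define g where "g = (\<lambda>\<tau> w::'a. indicator U ((1 / (2 * \<tau>)) *\<^sub>R w) * indicator C (x + w) :: ennreal)"
  have [measurable]: "(\<lambda>z. g (a z) (b z)) \<in> borel_measurable M"
    if [measurable]: "a \<in> borel_measurable M" "b \<in> borel_measurable M" for a b and M :: "'b measure"
    unfolding g_def by measurable
  \<comment> \<open>Origin of the constant: \<open>w\<close> divided by \<open>2 * \<tau>\<close>
    lies in the annulus for \<tau> between \<open>norm w / 4\<close> and \<open>norm w / 2\<close>,
    an interval of length \<open>norm w / 4\<close>; the weight there is at least
    \<open>1 / norm w ^ ?n\<close>, and \<open>norm w \<le> 2 * R\<close>.\<close>
  have low: "ennreal ?\<kappa> * indicator C (x + w)
      \<le> (\<integral>\<^sup>+\<tau>. indicator {0<..} \<tau> * ennreal ((1 / (2 * \<tau>)) ^ ?n) * g \<tau> w \<partial>lborel)"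
    if "w \<noteq> 0" for w
  proof (cases "x + w \<in> C")
    case True
    have w: "norm w > 0" "norm w \<le> 2 * R"
    proof -
      have "norm w \<le> norm (x + w) + norm x"
        using norm_triangle_ineq4[of "x + w" x] by simp
      then show "norm w \<le> 2 * R" using True C x by fastforce
    qed (use that in simp)
    have "?\<kappa> \<le> norm w / 4 * (1 / norm w ^ ?n)"
    proof -
      have "norm w ^ ?n = norm w * norm w ^ (?n - 1)"
        by (metis DIM_positive power_minus_mult mult.commute)
      then have "norm w / 4 * (1 / norm w ^ ?n) = 1 / (4 * norm w ^ (?n - 1))"
        using w by simp
      moreover have "norm w ^ (?n - 1) \<le> (2 * R) ^ (?n - 1)"
        using w by (intro power_mono) auto
      ultimately show ?thesis
        using w by (simp add: frac_le)
    qed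
    then have "ennreal ?\<kappa> * indicator C (x + w) \<le> ennreal (norm w / 4 * (1 / norm w ^ ?n))"
      using True by (simp add: ennreal_leI)
    also have "\<dots> = (\<integral>\<^sup>+\<tau>. ennreal (1 / norm w ^ ?n) * indicator {norm w / 4..norm w / 2} \<tau> \<partial>lborel)"
      using w by (subst nn_integral_cmult_indicator) (auto simp: ennreal_mult'[symmetric] field_simps)
    also have "\<dots> \<le> (\<integral>\<^sup>+\<tau>. indicator {0<..} \<tau> * ennreal ((1 / (2 * \<tau>)) ^ ?n) * g \<tau> w \<partial>lborel)"
    proof (rule nn_integral_mono)
      fix \<tau> :: real
      show "ennreal (1 / norm w ^ ?n) * indicator {norm w / 4..norm w / 2} \<tau>
          \<le> indicator {0<..} \<tau> * ennreal ((1 / (2 * \<tau>)) ^ ?n) * g \<tau> w"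
      proof (cases "\<tau> \<in> {norm w / 4..norm w / 2}")
        case \<tau>: True
        then have pos: "\<tau> > 0" using w(1) unfolding atLeastAtMost_iff by linarith
        then have "g \<tau> w = 1"
          using \<tau> True pos by (auto simp: g_def U_def indicator_def divide_simps)
        moreover have "1 / norm w ^ ?n \<le> (1 / (2 * \<tau>)) ^ ?n"
          unfolding power_one_over
          by (intro frac_le power_mono zero_less_power) (use pos \<tau> w in auto)
        ultimately show ?thesis
          using pos \<tau> by (simp add: ennreal_leI)
      qed simp
    qed
    finally show ?thesis .
  qed simp
  have "ennreal ?\<kappa> * emeasure lborel C = ennreal ?\<kappa> * (\<integral>\<^sup>+w. indicator C (x + w) \<partial>lborel)"
    using nn_integral_lborel_translate[of "indicator C" x] by (simp add: add.commute)
  also have "\<dots> = (\<integral>\<^sup>+w. ennreal ?\<kappa> * indicator C (x + w) \<partial>lborel)"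
    by (rule nn_integral_cmult[symmetric]) measurable
  also have "\<dots> \<le> (\<integral>\<^sup>+w. (\<integral>\<^sup>+\<tau>. indicator {0<..} \<tau> * ennreal ((1 / (2 * \<tau>)) ^ ?n) * g \<tau> w \<partial>lborel) \<partial>lborel)"
    by (rule nn_integral_mono_AE, use AE_lborel_singleton[of 0] in eventually_elim) (rule low)
  also have "\<dots> = (\<integral>\<^sup>+\<tau>. (\<integral>\<^sup>+w. indicator {0<..} \<tau> * ennreal ((1 / (2 * \<tau>)) ^ ?n) * g \<tau> w \<partial>lborel) \<partial>lborel)"
    by (rule lborel_pair.Fubini') measurable
  also have "\<dots> \<le> (\<integral>\<^sup>+\<tau>. (\<integral>\<^sup>+u. indicator U u * indicator C (x + (2 * \<tau>) *\<^sub>R u) \<partial>lborel) \<partial>lborel)"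
  proof (rule nn_integral_mono)
    fix \<tau> :: real
    show "(\<integral>\<^sup>+w. indicator {0<..} \<tau> * ennreal ((1 / (2 * \<tau>)) ^ ?n) * g \<tau> w \<partial>lborel)
        \<le> (\<integral>\<^sup>+u. indicator U u * indicator C (x + (2 * \<tau>) *\<^sub>R u) \<partial>lborel)"
    proof (cases "\<tau> > 0")
      case True
      \<comment> \<open>The weight is the reciprocal of the Jacobian of the substitution for
        \<open>w\<close>.\<close>
      have "(1 / (2 * \<tau>)) ^ ?n * (2 * \<tau>) ^ ?n = 1"
        using True by (simp only: power_mult_distrib[symmetric]) simp
      then have inv: "ennreal ((1 / (2 * \<tau>)) ^ ?n) * ennreal ((2 * \<tau>) ^ ?n) = 1"
        using True by (subst ennreal_mult'[symmetric]) auto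
      have "(\<integral>\<^sup>+w. indicator {0<..} \<tau> * ennreal ((1 / (2 * \<tau>)) ^ ?n) * g \<tau> w \<partial>lborel)
          = ennreal ((1 / (2 * \<tau>)) ^ ?n) * (\<integral>\<^sup>+w. g \<tau> w \<partial>lborel)"
        using True by (subst nn_integral_cmult) auto
      also have "(\<integral>\<^sup>+w. g \<tau> w \<partial>lborel) = ennreal ((2 * \<tau>) ^ ?n) * (\<integral>\<^sup>+u. g \<tau> ((2 * \<tau>) *\<^sub>R u) \<partial>lborel)"
        using True by (intro nn_integral_lborel_scale) measurable
      also have "ennreal ((1 / (2 * \<tau>)) ^ ?n) * (ennreal ((2 * \<tau>) ^ ?n) * (\<integral>\<^sup>+u. g \<tau> ((2 * \<tau>) *\<^sub>R u) \<partial>lborel))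
          = (\<integral>\<^sup>+u. g \<tau> ((2 * \<tau>) *\<^sub>R u) \<partial>lborel)"
        by (simp only: mult.assoc[symmetric] inv mult_1)
      also have "\<dots> = (\<integral>\<^sup>+u. indicator U u * indicator C (x + (2 * \<tau>) *\<^sub>R u) \<partial>lborel)"
        using True by (simp add: g_def)
      finally show ?thesis by simp
    qed simp
  qed
  also have "\<dots> = (\<integral>\<^sup>+u. (\<integral>\<^sup>+\<tau>. indicator U u * indicator C (x + (2 * \<tau>) *\<^sub>R u) \<partial>lborel) \<partial>lborel)"
    by (rule lborel_pair.Fubini') measurable
  finally show ?thesis .
qed

text \<open>For fixed \<open>u\<close> the reflection parameter is the ray parameter shifted by
  \<open>(x \<bullet> u) / (u \<bullet> u)\<close>, so the ray average carries over to reflections.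
  The cut-off to \<open>{-2 * R..2 * R}\<close> loses no hits and makes the parameter space of
  finite measure.\<close>

lemma reflection_average:
  fixes A C :: "'a::euclidean_space set"
  assumes [measurable]: "A \<in> sets borel" "C \<in> sets borel"
    and A: "A \<subseteq> cball 0 R" and C: "C \<subseteq> cball 0 R" and R: "R > 0"
  defines "U \<equiv> {u::'a. 1 \<le> norm u \<and> norm u \<le> 2}"
  shows "ennreal (1 / (4 * (2 * R) ^ (DIM('a) - 1))) * emeasure lborel C * emeasure lborel A
    \<le> (\<integral>\<^sup>+u. (\<integral>\<^sup>+\<tau>. indicator U u * indicator {-2 * R..2 * R} \<tau> *
        emeasure lborel {x \<in> A. swap0 ((2 * \<tau>) *\<^sub>R u) x \<in> C} \<partial>lborel) \<partial>lborel)"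
proof -
  let ?\<kappa> = "1 / (4 * (2 * R) ^ (DIM('a) - 1))"
  let ?I = "{-2 * R..2 * R}"
  have [measurable]: "U \<in> sets borel"
    unfolding U_def by measurable
  have inner: "(\<integral>\<^sup>+\<tau>. indicator U u * indicator C (x + (2 * \<tau>) *\<^sub>R u) \<partial>lborel)
     \<le> (\<integral>\<^sup>+\<tau>. indicator U u * indicator ?I \<tau> * indicator C (swap0 ((2 * \<tau>) *\<^sub>R u) x) \<partial>lborel)"
    if x: "x \<in> A" for u x
  proof (cases "u \<in> U")
    case True
    let ?c = "(x \<bullet> u) / (u \<bullet> u)"
    have u: "1 \<le> norm u" "u \<noteq> 0"
      using True by (auto simp: U_def)
    have "\<bar>x \<bullet> u\<bar> \<le> norm x * norm u"
      by (rule Cauchy_Schwarz_ineq2)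
    also have "\<dots> \<le> norm x * (u \<bullet> u)"
      using u by (intro mult_left_mono) (auto simp: power2_norm_eq_inner[symmetric] power2_eq_square)
    finally have "\<bar>?c\<bar> \<le> norm x"
      using u by (simp add: abs_divide divide_simps)
    then have c: "\<bar>?c\<bar> \<le> R"
      using x A by fastforce
    have "(\<integral>\<^sup>+\<tau>. indicator U u * indicator C (x + (2 * \<tau>) *\<^sub>R u) \<partial>lborel)
        = (\<integral>\<^sup>+\<tau>. indicator C (x + (2 * (\<tau> + - ?c)) *\<^sub>R u) \<partial>lborel :: ennreal)"
      using True by (subst nn_integral_lborel_translate) auto
    also have "\<dots> = (\<integral>\<^sup>+\<tau>. indicator U u * indicator ?I \<tau> * indicator C (swap0 ((2 * \<tau>) *\<^sub>R u) x) \<partial>lborel)"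
    proof (rule nn_integral_cong_AE, use AE_lborel_singleton[of 0] in eventually_elim)
      fix \<tau> :: real assume \<tau>: "\<tau> \<noteq> 0"
      \<comment> \<open>Here \<open>x\<close> and its image are at most \<open>2 * R\<close> apart
        and \<open>norm u \<ge> 1\<close>, so the ray parameter is at most \<open>R\<close> in
        absolute value; so is the shift \<open>?c\<close>.\<close>
      have "\<tau> \<in> ?I" if "x + (2 * (\<tau> + - ?c)) *\<^sub>R u \<in> C"
      proof -
        let ?y = "x + (2 * (\<tau> + - ?c)) *\<^sub>R u"
        have diff: "2 * \<bar>t\<bar> * norm u = norm (x + (2 * t) *\<^sub>R u - x)" for t
          by (simp add: abs_mult)
        have "2 * \<bar>\<tau> - ?c\<bar> \<le> 2 * \<bar>\<tau> - ?c\<bar> * norm u"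
          using u by (simp add: mult_le_cancel_left1)
        also have "\<dots> = norm (?y - x)"
          using diff[of "\<tau> - ?c"] by (simp only: diff_conv_add_uminus)
        also have "\<dots> \<le> norm ?y + norm x"
          by (rule norm_triangle_ineq4)
        also have "\<dots> \<le> R + R"
          using that C A x by (intro add_mono) auto
        finally have "\<bar>\<tau> - ?c\<bar> \<le> R" by simp
        then show ?thesis
          using c unfolding atLeastAtMost_iff by linarith
      qed
      then show "indicator C (x + (2 * (\<tau> + - ?c)) *\<^sub>R u)
          = (indicator U u * indicator ?I \<tau> * indicator C (swap0 ((2 * \<tau>) *\<^sub>R u) x) :: ennreal)"
        unfolding swap0_scaled[OF \<tau>] using True by (auto simp: indicator_def)
    qed
    finally show ?thesis by simp
  qed simp
  have "ennreal ?\<kappa> * emeasure lborel C * emeasure lborel A = (\<integral>\<^sup>+x. ennreal ?\<kappa> * emeasure lborel C * indicator A x \<partial>lborel)"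
    by (subst nn_integral_cmult_indicator) auto
  also have "\<dots> \<le> (\<integral>\<^sup>+x. (\<integral>\<^sup>+u. (\<integral>\<^sup>+\<tau>. indicator U u * indicator ?I \<tau> *
      (indicator A x * indicator C (swap0 ((2 * \<tau>) *\<^sub>R u) x)) \<partial>lborel) \<partial>lborel) \<partial>lborel)"
  proof (rule nn_integral_mono)
    fix x :: 'a
    show "ennreal ?\<kappa> * emeasure lborel C * indicator A x \<le> (\<integral>\<^sup>+u. (\<integral>\<^sup>+\<tau>. indicator U u * indicator ?I \<tau> *
      (indicator A x * indicator C (swap0 ((2 * \<tau>) *\<^sub>R u) x)) \<partial>lborel) \<partial>lborel)"
    proof (cases "x \<in> A")
      case True
      have "ennreal ?\<kappa> * emeasure lborel C
        \<le> (\<integral>\<^sup>+u. (\<integral>\<^sup>+\<tau>. indicator U u * indicator C (x + (2 * \<tau>) *\<^sub>R u) \<partial>lborel) \<partial>lborel)"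
        unfolding U_def using True A by (intro emeasure_le_ray_average C R) auto
      also have "\<dots> \<le> (\<integral>\<^sup>+u. (\<integral>\<^sup>+\<tau>. indicator U u * indicator ?I \<tau> * indicator C (swap0 ((2 * \<tau>) *\<^sub>R u) x) \<partial>lborel) \<partial>lborel)"
        by (intro nn_integral_mono inner True)
      finally show ?thesis
        using True by simp
    qed simp
  qed
  also have "\<dots> = (\<integral>\<^sup>+u. (\<integral>\<^sup>+x. (\<integral>\<^sup>+\<tau>. indicator U u * indicator ?I \<tau> *
      (indicator A x * indicator C (swap0 ((2 * \<tau>) *\<^sub>R u) x)) \<partial>lborel) \<partial>lborel) \<partial>lborel)"
    by (rule lborel_pair.Fubini') measurable
  also have "\<dots> = (\<integral>\<^sup>+u. (\<integral>\<^sup>+\<tau>. (\<integral>\<^sup>+x. indicator U u * indicator ?I \<tau> *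
      (indicator A x * indicator C (swap0 ((2 * \<tau>) *\<^sub>R u) x)) \<partial>lborel) \<partial>lborel) \<partial>lborel)"
    by (intro nn_integral_cong lborel_pair.Fubini') measurable
  also have "\<dots> = (\<integral>\<^sup>+u. (\<integral>\<^sup>+\<tau>. indicator U u * indicator ?I \<tau> *
      emeasure lborel {x \<in> A. swap0 ((2 * \<tau>) *\<^sub>R u) x \<in> C} \<partial>lborel) \<partial>lborel)"
  proof (intro nn_integral_cong)
    fix u :: 'a and \<tau> :: real
    let ?S = "{x \<in> A. swap0 ((2 * \<tau>) *\<^sub>R u) x \<in> C}"
    have [measurable]: "?S \<in> sets borel" by measurable
    have "indicator A x * indicator C (swap0 ((2 * \<tau>) *\<^sub>R u) x) = (indicator ?S x :: ennreal)" for x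
      by (auto simp: indicator_def)
    then show "(\<integral>\<^sup>+x. indicator U u * indicator ?I \<tau> *
      (indicator A x * indicator C (swap0 ((2 * \<tau>) *\<^sub>R u) x)) \<partial>lborel)
       = indicator U u * indicator ?I \<tau> * emeasure lborel ?S"
      by (subst nn_integral_cmult) auto
  qed
  finally show ?thesis .
qed

text \<open>If every reflection fell short, the average over the parameters would be at most half of
  its lower bound: \<open>D\<close> bounds the measure of the parameter space, and the factor 2 in
  \<open>\<kappa> / (2 * D)\<close> produces the contradiction.\<close>

lemma exists_reflection:
  assumes R: "R > 0"
  obtains k where "k > 0" and
    "\<And>A C :: 'a::euclidean_space set. \<lbrakk>A \<in> sets borel; C \<in> sets borel; A \<subseteq> cball 0 R; C \<subseteq> cball 0 R\<rbrakk> \<Longrightarrow>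
      \<exists>v. v \<noteq> 0 \<and> ennreal k * emeasure lborel A * emeasure lborel C \<le> emeasure lborel {x \<in> A. swap0 v x \<in> C}"
proof -
  define U where "U = {u::'a. 1 \<le> norm u \<and> norm u \<le> 2}"
  have Um [measurable]: "U \<in> sets borel"
    unfolding U_def by measurable
  define \<kappa> where "\<kappa> = 1 / (4 * (2 * R) ^ (DIM('a) - 1))"
  define D where "D = measure lborel (cball (0::'a) 2) * (4 * R)"
  have \<kappa>: "\<kappa> > 0" and D: "D > 0"
    using R by (auto simp: \<kappa>_def D_def content_cball)
  have UD: "emeasure lborel U * ennreal (4 * R) \<le> ennreal D"
  proof -
    have "emeasure lborel U \<le> emeasure lborel (cball (0::'a) 2)"
      by (rule emeasure_mono) (auto simp: U_def)
    also have "\<dots> = ennreal (measure lborel (cball (0::'a) 2))"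
      by (rule emeasure_eq_ennreal_measure) (simp add: emeasure_cball)
    finally show ?thesis
      using R by (simp add: D_def ennreal_mult' mult_right_mono)
  qed
  show thesis
  proof (rule that[of "\<kappa> / (2 * D)"])
    show "\<kappa> / (2 * D) > 0" using \<kappa> D by simp
    fix A C :: "'a set"
    assume [measurable]: "A \<in> sets borel" "C \<in> sets borel" and AC: "A \<subseteq> cball 0 R" "C \<subseteq> cball 0 R"
    show "\<exists>v. v \<noteq> 0 \<and> ennreal (\<kappa> / (2 * D)) * emeasure lborel A * emeasure lborel C \<le> emeasure lborel {x \<in> A. swap0 v x \<in> C}"
    proof (rule ccontr)
      assume neg: "\<not> ?thesis"
      let ?M = "ennreal (\<kappa> / (2 * D)) * emeasure lborel A * emeasure lborel C"
      have lt: "emeasure lborel {x \<in> A. swap0 v x \<in> C} < ?M" if "v \<noteq> 0" for v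
        using neg that by (auto simp: not_le)
      \<comment> \<open>Falling short strictly for a single \<open>v\<close> already forces both
        sets to have positive measure.\<close>
      obtain w :: 'a where "w \<noteq> 0" using nonzero_Basis SOME_Basis by blast
      then have Mpos: "0 < ?M"
        using le_less_trans[OF zero_le lt[of w]] by blast
      have fin: "emeasure lborel S < \<infinity>" if "S \<subseteq> cball 0 R" for S :: "'a set"
        using le_less_trans[OF emeasure_mono[OF that, of lborel]] by (simp add: emeasure_cball R less_imp_le)
      have "emeasure lborel A = ennreal (measure lborel A)" "emeasure lborel C = ennreal (measure lborel C)"
        using fin[OF AC(1)] fin[OF AC(2)] by (simp_all add: emeasure_eq_ennreal_measure)
      then obtain a c where ac: "emeasure lborel A = ennreal a" "emeasure lborel C = ennreal c" "0 \<le> a" "0 \<le> c"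
        using measure_nonneg by blast
      have pos: "a > 0" "c > 0"
      proof -
        have "a \<noteq> 0" "c \<noteq> 0"
          using Mpos unfolding ac by auto
        then show "a > 0" "c > 0" using ac by simp_all
      qed
      have "ennreal \<kappa> * emeasure lborel C * emeasure lborel A
        \<le> (\<integral>\<^sup>+u. (\<integral>\<^sup>+\<tau>. indicator U u * indicator {-2 * R..2 * R} \<tau> *
        emeasure lborel {x \<in> A. swap0 ((2 * \<tau>) *\<^sub>R u) x \<in> C} \<partial>lborel) \<partial>lborel)"
        unfolding \<kappa>_def U_def by (rule reflection_average) (use AC R in auto)
      also have "\<dots> \<le> (\<integral>\<^sup>+u. (\<integral>\<^sup>+\<tau>. indicator U u * (?M * indicator {-2 * R..2 * R} \<tau>) \<partial>lborel) \<partial>lborel)"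
      proof (rule nn_integral_mono, rule nn_integral_mono_AE, use AE_lborel_singleton[of 0] in eventually_elim)
        fix u :: 'a and \<tau> :: real
        assume "\<tau> \<noteq> 0"
        then have "u \<in> U \<Longrightarrow> (2 * \<tau>) *\<^sub>R u \<noteq> 0"
          by (auto simp: U_def)
        then show "indicator U u * indicator {-2 * R..2 * R} \<tau> * emeasure lborel {x \<in> A. swap0 ((2 * \<tau>) *\<^sub>R u) x \<in> C}
          \<le> indicator U u * (?M * indicator {-2 * R..2 * R} \<tau>)"
          using lt[of "(2 * \<tau>) *\<^sub>R u"] by (auto simp: indicator_def less_imp_le)
      qed
      also have "\<dots> = (\<integral>\<^sup>+u. ?M * ennreal (4 * R) * indicator U u \<partial>lborel)"
        using R by (intro nn_integral_cong, subst nn_integral_cmult, simp, subst nn_integral_cmult_indicator)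
          (auto simp: ac_simps)
      also have "\<dots> = ?M * (emeasure lborel U * ennreal (4 * R))"
        by (subst nn_integral_cmult_indicator) (auto simp: ac_simps)
      also have "\<dots> \<le> ?M * ennreal D"
        by (intro mult_left_mono UD) simp
      finally have "\<kappa> * c * a \<le> \<kappa> / (2 * D) * a * c * D"
        using pos \<kappa> D R by (simp add: ac ennreal_mult'[symmetric] ennreal_le_iff)
      then have "\<kappa> * c * a \<le> \<kappa> * c * a / 2"
        using D by (simp add: field_simps)
      moreover have "\<kappa> * c * a > 0"
        using \<kappa> pos by simp
      ultimately show False by linarith
    qed
  qed
qed

subsection \<open>The rearrangement inequality and its equality case\<close>

lemma energy_scale:
  fixes E :: "'a::euclidean_space set"
  assumes [measurable]: "E \<in> sets borel" and r: "r > 0"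
  shows "energy p E = ennreal (r powr (2 * real DIM('a) + p)) * energy p ((\<lambda>x. r *\<^sub>R x) -` E)"
proof -
  let ?n = "DIM('a)" and ?F = "(\<lambda>x. r *\<^sub>R x) -` E"
  have [measurable]: "?F \<in> sets borel"
    using measurable_sets[of "\<lambda>x. r *\<^sub>R x" borel borel E] by simp
  have ind: "indicator E (r *\<^sub>R x) = (indicator ?F x :: ennreal)" for x
    by (simp add: indicator_def)
  have nm: "ennreal (norm (r *\<^sub>R x - r *\<^sub>R y) powr p) = ennreal (r powr p) * ennreal (norm (x - y) powr p)" for x y :: 'a
    using r by (simp add: scaleR_diff_right[symmetric] powr_mult ennreal_mult' del: scaleR_diff_right)
  have "energy p E = ennreal (r ^ ?n) * (\<integral>\<^sup>+x. (\<integral>\<^sup>+y. indicator E (r *\<^sub>R x) * indicator E y * ennreal (norm (r *\<^sub>R x - y) powr p) \<partial>lborel) \<partial>lborel)"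
    unfolding energy_def by (rule nn_integral_lborel_scale) (use r in measurable)
  also have "\<dots> = ennreal (r ^ ?n) * (\<integral>\<^sup>+x. ennreal (r ^ ?n) * (\<integral>\<^sup>+y. indicator E (r *\<^sub>R x) * indicator E (r *\<^sub>R y) * ennreal (norm (r *\<^sub>R x - r *\<^sub>R y) powr p) \<partial>lborel) \<partial>lborel)"
    by (intro arg_cong2[where f="(*)"] refl nn_integral_cong nn_integral_lborel_scale) (use r in measurable)
  also have "\<dots> = ennreal (r ^ ?n) * (\<integral>\<^sup>+x. ennreal (r ^ ?n) * (ennreal (r powr p) * (\<integral>\<^sup>+y. indicator ?F x * indicator ?F y * ennreal (norm (x - y) powr p) \<partial>lborel)) \<partial>lborel)"
    unfolding ind nm by (subst nn_integral_cmult[symmetric]) (auto simp: ac_simps)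
  also have "\<dots> = ennreal (r ^ ?n) * (ennreal (r ^ ?n) * (ennreal (r powr p) * energy p ?F))"
    unfolding energy_def by (simp add: nn_integral_cmult)
  also have "\<dots> = ennreal (r ^ ?n * r ^ ?n * r powr p) * energy p ?F"
    using r by (simp add: ennreal_mult' mult.assoc)
  also have "r ^ ?n * r ^ ?n * r powr p = r powr (2 * real ?n + p)"
    by (simp only: mult_2 powr_add powr_realpow[OF r])
  finally show ?thesis .
qed

lemma energy_ball_scale:
  assumes r: "r > 0"
  shows "energy p (ball (0::'a::euclidean_space) r) = ennreal (r powr (2 * real DIM('a) + p)) * energy p (ball (0::'a) 1)"
proof -
  have "(\<lambda>x. r *\<^sub>R x) -` ball (0::'a) r = ball 0 1"
    using r by auto
  then show ?thesis
    using energy_scale[of "ball (0::'a) r" r p] r by simp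
qed

lemma vimage_translate_measurable [measurable]:
  fixes E :: "'a::euclidean_space set"
  assumes "E \<in> sets borel"
  shows "(\<lambda>x. x + a) -` E \<in> sets borel"
  using measurable_sets[of "\<lambda>x. x + a" borel borel E] assms by simp

lemma energy_translate:
  fixes E :: "'a::euclidean_space set"
  assumes [measurable]: "E \<in> sets borel"
  shows "energy p ((\<lambda>x. x + a) -` E) = energy p E"
proof -
  have ind: "indicator ((\<lambda>x. x + a) -` E) x = (indicator E (x + a) :: ennreal)" for x
    by (simp add: indicator_def)
  have "energy p ((\<lambda>x. x + a) -` E) = (\<integral>\<^sup>+x. (\<integral>\<^sup>+y. indicator E (x + a) * indicator E (y + a) * ennreal (norm ((x + a) - (y + a)) powr p) \<partial>lborel) \<partial>lborel)"
    unfolding energy_def ind by simp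
  also have "\<dots> = (\<integral>\<^sup>+x. (\<integral>\<^sup>+y. indicator E (x + a) * indicator E y * ennreal (norm ((x + a) - y) powr p) \<partial>lborel) \<partial>lborel)"
    by (intro nn_integral_cong nn_integral_lborel_translate) measurable
  also have "\<dots> = energy p E"
    unfolding energy_def by (rule nn_integral_lborel_translate) measurable
  finally show ?thesis .
qed

lemma emeasure_translate:
  fixes E :: "'a::euclidean_space set"
  assumes [measurable]: "E \<in> sets borel"
  shows "emeasure lborel ((\<lambda>x. x + a) -` E) = emeasure lborel E"
proof -
  have ind: "indicator ((\<lambda>x. x + a) -` E) x = (indicator E (x + a) :: ennreal)" for x
    by (simp add: indicator_def)
  show ?thesis
    using nn_integral_lborel_translate[of "indicator E" a]
    by (simp flip: ind)
qed

text \<open>Two points of the ball are at most \<open>2 * r\<close> apart. The interaction with a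
  small set is thereby bounded linearly in its measure.\<close>

lemma energy_cross_le:
  fixes A D :: "'a::euclidean_space set"
  assumes [measurable]: "A \<in> sets borel" "D \<in> sets borel" and AD: "A \<subseteq> cball 0 r" "D \<subseteq> cball 0 r" and p: "p > 0"
  shows "(\<integral>\<^sup>+x. (\<integral>\<^sup>+y. indicator A x * indicator D y * ennreal (norm (x - y) powr p) \<partial>lborel) \<partial>lborel)
    \<le> ennreal ((2 * r) powr p) * emeasure lborel A * emeasure lborel D"
proof -
  have "(\<integral>\<^sup>+x. (\<integral>\<^sup>+y. indicator A x * indicator D y * ennreal (norm (x - y) powr p) \<partial>lborel) \<partial>lborel)
     \<le> (\<integral>\<^sup>+x. (\<integral>\<^sup>+y. (ennreal ((2 * r) powr p) * indicator A x) * indicator D y \<partial>lborel) \<partial>lborel)"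
  proof (intro nn_integral_mono)
    fix x y :: 'a
    show "indicator A x * indicator D y * ennreal (norm (x - y) powr p) \<le> (ennreal ((2 * r) powr p) * indicator A x) * indicator D y"
    proof (cases "x \<in> A \<and> y \<in> D")
      case True
      have "norm (x - y) \<le> norm x + norm y"
        by (rule norm_triangle_ineq4)
      also have "\<dots> \<le> 2 * r"
        using True AD by fastforce
      finally show ?thesis
        using True p by (simp add: ennreal_leI powr_mono2)
    qed auto
  qed
  also have "\<dots> = (\<integral>\<^sup>+x. (ennreal ((2 * r) powr p) * emeasure lborel D) * indicator A x \<partial>lborel)"
    by (intro nn_integral_cong) (subst nn_integral_cmult_indicator, auto simp: ac_simps)
  also have "\<dots> = ennreal ((2 * r) powr p) * emeasure lborel D * emeasure lborel A"
    by (subst nn_integral_cmult_indicator) auto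
  finally show ?thesis
    by (simp add: ac_simps)
qed

lemma energy_finite:
  assumes "A \<in> sets borel" "A \<subseteq> cball 0 r" "p > 0"
  shows "energy p A < \<infinity>"
proof -
  have "emeasure lborel A < \<infinity>"
    using le_less_trans[OF emeasure_mono[OF assms(2), of lborel]]
    by (metis emeasure_bounded_finite bounded_subset[OF bounded_cball assms(2)])
  then have "ennreal ((2 * r) powr p) * emeasure lborel A * emeasure lborel A < \<infinity>"
    by (simp add: ennreal_mult_less_top)
  then show ?thesis
    unfolding energy_def using energy_cross_le[OF assms(1,1,2,2,3)] by (rule le_less_trans[rotated])
qed

text \<open>A pair of points of \<open>B\<close> lies in \<open>F\<close> or has a member in
  \<open>B - F\<close>, and the latter pairs are covered by two cross terms. The energy of a ball is
  thus controlled by that of any set nearly filling it.\<close>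

lemma energy_le_energy_Int:
  fixes B F :: "'a::euclidean_space set"
  assumes [measurable]: "B \<in> sets borel" "F \<in> sets borel" and B: "B \<subseteq> cball 0 r" and p: "p > 0"
  shows "energy p B \<le> energy p (F \<inter> B) + 2 * (ennreal ((2 * r) powr p) * emeasure lborel B) * emeasure lborel (B - F)"
proof -
  let ?k = "\<lambda>x y :: 'a. ennreal (norm (x - y) powr p)"
  let ?A = "F \<inter> B" and ?D = "B - F"
  have "energy p B \<le> (\<integral>\<^sup>+x. (\<integral>\<^sup>+y. indicator ?A x * indicator ?A y * ?k x y
     + (indicator ?D x * indicator B y * ?k x y + indicator B x * indicator ?D y * ?k x y) \<partial>lborel) \<partial>lborel)"
    unfolding energy_def by (intro nn_integral_mono) (auto simp: indicator_def)
  also have "\<dots> = energy p ?A + ((\<integral>\<^sup>+x. (\<integral>\<^sup>+y. indicator ?D x * indicator B y * ?k x y \<partial>lborel) \<partial>lborel)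
     + (\<integral>\<^sup>+x. (\<integral>\<^sup>+y. indicator B x * indicator ?D y * ?k x y \<partial>lborel) \<partial>lborel))"
    unfolding energy_def by (simp add: nn_integral_add)
  also have "\<dots> \<le> energy p ?A + (ennreal ((2 * r) powr p) * emeasure lborel ?D * emeasure lborel B + ennreal ((2 * r) powr p) * emeasure lborel B * emeasure lborel ?D)"
    by (intro add_mono order_refl energy_cross_le) (use B p in auto)
  also have "ennreal ((2 * r) powr p) * emeasure lborel ?D * emeasure lborel B + ennreal ((2 * r) powr p) * emeasure lborel B * emeasure lborel ?D
      = 2 * (ennreal ((2 * r) powr p) * emeasure lborel B) * emeasure lborel ?D"
    by (simp add: mult_2 distrib_left distrib_right ac_simps)
  finally show ?thesis .
qed

text \<open>Among the sets obtainable from \<open>E\<close> without increasing the energy, the overlap with the ball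
  has supremum the full volume: otherwise \<open>exists_reflection\<close> yields a polarization
  that improves every overlap by a fixed amount.\<close>

lemma energy_ball_le_bounded:
  fixes E :: "'a::euclidean_space set"
  assumes E [measurable]: "E \<in> sets borel" and ER: "E \<subseteq> cball 0 \<rho>" and r: "r > 0"
    and eq: "emeasure lborel E = emeasure lborel (ball (0::'a) r)" and p: "p > 0"
  shows "energy p (ball (0::'a) r) \<le> energy p E"
proof -
  let ?B = "ball (0::'a) r"
  define R where "R = max \<rho> r"
  \<comment> \<open>Not the iterated polarizations themselves, but the properties that every
    polarization preserves.\<close>
  define \<F> where "\<F> = {F :: 'a set. F \<in> sets borel \<and> F \<subseteq> cball 0 R \<and> emeasure lborel F = emeasure lborel ?B \<and> energy p F \<le> energy p E}"
  have R: "R > 0" "r \<le> R" "\<rho> \<le> R" using r by (auto simp: R_def)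
  have E\<F>: "E \<in> \<F>"
    using ER R eq by (auto simp: \<F>_def)
  have Bm [measurable]: "?B \<in> sets borel" by simp
  have BR: "?B \<subseteq> cball 0 R"
    using R by auto
  define b where "b = measure lborel ?B"
  have fm: "S \<in> fmeasurable lborel" if "S \<in> sets borel" "S \<subseteq> cball 0 R" for S :: "'a set"
    using fmeasurableI2[of "cball 0 R" lborel S] that by (simp add: fmeasurable_def emeasure_cball R less_imp_le)
  have Fb: "measure lborel F = b" if "F \<in> \<F>" for F
    using that by (simp add: \<F>_def b_def measure_def)
  have FB: "measure lborel (?B - F) = b - measure lborel (F \<inter> ?B)"
     "measure lborel (F - ?B) = b - measure lborel (F \<inter> ?B)" if "F \<in> \<F>" for F
  proof -
    have F: "F \<in> sets borel" "F \<subseteq> cball 0 R" using that by (auto simp: \<F>_def)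
    show "measure lborel (?B - F) = b - measure lborel (F \<inter> ?B)"
      unfolding b_def using measurable_measure_Diff[of ?B lborel "F \<inter> ?B"] fm[of ?B] F BR by (simp add: Diff_Int)
    show "measure lborel (F - ?B) = b - measure lborel (F \<inter> ?B)"
      unfolding Fb[OF that, symmetric] using measurable_measure_Diff[of F lborel "F \<inter> ?B"] fm[of F] F BR by (simp add: Diff_Int)
  qed
  define s where "s = (SUP F\<in>\<F>. measure lborel (F \<inter> ?B))"
  have le_b: "measure lborel (F \<inter> ?B) \<le> b" for F
    unfolding b_def by (cases "F \<inter> ?B \<in> sets lborel")
      (use fm[OF Bm BR] in \<open>auto intro: measure_mono_fmeasurable simp: measure_notin_sets\<close>)
  have bdd: "bdd_above ((\<lambda>F. measure lborel (F \<inter> ?B)) ` \<F>)"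
    using le_b by (auto intro!: bdd_aboveI[of _ b])
  have le_s: "measure lborel (F \<inter> ?B) \<le> s" if "F \<in> \<F>" for F
    unfolding s_def by (rule cSUP_upper[OF that bdd])
  have "s = b"
  proof (rule ccontr)
    assume "s \<noteq> b"
    moreover have "s \<le> b"
      unfolding s_def by (rule cSUP_least) (use E\<F> le_b in auto)
    ultimately have m: "b - s > 0" by simp
    obtain k where k: "k > 0" and
      refl: "\<And>A C :: 'a set. \<lbrakk>A \<in> sets borel; C \<in> sets borel; A \<subseteq> cball 0 R; C \<subseteq> cball 0 R\<rbrakk> \<Longrightarrow>
      \<exists>v. v \<noteq> 0 \<and> ennreal k * emeasure lborel A * emeasure lborel C \<le> emeasure lborel {x \<in> A. swap0 v x \<in> C}"
      by (rule exists_reflection[OF R(1), where ?'a='a]) (rule that)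
    \<comment> \<open>\<open>?B - F\<close> and \<open>F - ?B\<close> have the same volume, at least
      \<open>b - s\<close>. The polarization supplied by \<open>refl\<close> therefore gains at
      least \<open>k * (b - s)\<^sup>2\<close>, and its overlap is still at most
      \<open>s\<close>.\<close>
    have step: "measure lborel (F \<inter> ?B) \<le> s - k * (b - s)\<^sup>2" if F: "F \<in> \<F>" for F
    proof -
      have F' [measurable]: "F \<in> sets borel" and FR: "F \<subseteq> cball 0 R" and Fe: "energy p F \<le> energy p E"
        "emeasure lborel F = emeasure lborel ?B"
        using F by (auto simp: \<F>_def)
      obtain v where v: "v \<noteq> 0" and T: "ennreal k * emeasure lborel (?B - F) * emeasure lborel (F - ?B)
          \<le> emeasure lborel {x \<in> ?B - F. swap0 v x \<in> F - ?B}"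
        using refl[of "?B - F" "F - ?B"] BR FR by auto
      have "polarize v F \<in> \<F>"
        unfolding \<F>_def using emeasure_polarize[OF F' v] polarize_subset_cball[OF v FR] energy_polarize_le[OF F' v p] Fe
        by auto
      then have "measure lborel (polarize v F \<inter> ?B) \<le> s"
        by (rule le_s)
      have em: "emeasure lborel S = ennreal (measure lborel S)" if "S \<in> sets borel" "S \<subseteq> cball 0 R" for S :: "'a set"
        using fm[OF that] by (rule emeasure_eq_measure2)
      have "ennreal (measure lborel (F \<inter> ?B) + k * measure lborel (?B - F) * measure lborel (F - ?B))
          = emeasure lborel (F \<inter> ?B) + ennreal k * emeasure lborel (?B - F) * emeasure lborel (F - ?B)"
        using k BR FR by (subst (1 2 3) em) (auto simp: ennreal_mult' intro: order_trans)
      also have "\<dots> \<le> emeasure lborel (F \<inter> ?B) + emeasure lborel {x \<in> ?B - F. swap0 v x \<in> F - ?B}"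
        by (intro add_left_mono T)
      also have "\<dots> \<le> emeasure lborel (polarize v F \<inter> ?B)"
        by (rule emeasure_polarize_Int_ball[OF F' v])
      also have "\<dots> = ennreal (measure lborel (polarize v F \<inter> ?B))"
        using BR by (intro em) auto
      also have "\<dots> \<le> ennreal s"
        by (intro ennreal_leI) fact
      finally have "measure lborel (F \<inter> ?B) + k * measure lborel (?B - F) * measure lborel (F - ?B) \<le> s"
        using order_trans[OF measure_nonneg le_s[OF F]] by (simp add: ennreal_le_iff)
      moreover have "(b - s) * (b - s) \<le> measure lborel (?B - F) * measure lborel (F - ?B)"
        unfolding FB[OF F] using le_s[OF F] m by (intro mult_mono) auto
      then have "k * (b - s)\<^sup>2 \<le> k * measure lborel (?B - F) * measure lborel (F - ?B)"
        using k by (simp add: power2_eq_square mult.assoc)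
      ultimately show ?thesis by linarith
    qed
    have "s \<le> s - k * (b - s)\<^sup>2"
      by (subst s_def) (rule cSUP_least, use E\<F> step in auto)
    moreover have "k * (b - s)\<^sup>2 > 0" using k m by simp
    ultimately show False by linarith
  qed
  \<comment> \<open>The factor of the missing volume in \<open>energy_le_energy_Int\<close>, for
    this ball.\<close>
  define K where "K = 2 * ((2 * r) powr p * b)"
  have b: "b > 0"
    using r by (simp add: b_def content_ball)
  have K: "K > 0"
    using r b by (simp add: K_def)
  show ?thesis
  proof (rule ennreal_le_epsilon)
    fix e :: real assume e: "e > 0"
    have "b - e / K < s"
      using e K \<open>s = b\<close> by simp
    then obtain F where F: "F \<in> \<F>" and Fs: "b - e / K < measure lborel (F \<inter> ?B)"
      unfolding s_def using less_cSUP_iff[OF _ bdd] E\<F> by blast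
    have F' [measurable]: "F \<in> sets borel" using F by (simp add: \<F>_def)
    have "energy p ?B \<le> energy p (F \<inter> ?B) + 2 * (ennreal ((2 * r) powr p) * emeasure lborel ?B) * emeasure lborel (?B - F)"
      by (rule energy_le_energy_Int) (use p r in auto)
    also have "2 * (ennreal ((2 * r) powr p) * emeasure lborel ?B) * emeasure lborel (?B - F) = ennreal (K * measure lborel (?B - F))"
    proof -
      have "emeasure lborel ?B = ennreal b" "emeasure lborel (?B - F) = ennreal (measure lborel (?B - F))"
        unfolding b_def using fm[of ?B] fm[of "?B - F"] BR
        by (auto intro!: emeasure_eq_measure2)
      then show ?thesis
        using b by (simp add: K_def ennreal_mult')
    qed
    also have "\<dots> \<le> ennreal e"
    proof (rule ennreal_leI)
      have "measure lborel (?B - F) \<le> e / K"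
        using Fs FB(1)[OF F] by linarith
      then show "K * measure lborel (?B - F) \<le> e"
        using K by (simp add: pos_le_divide_eq mult.commute)
    qed
    also have "energy p (F \<inter> ?B) \<le> energy p F"
      by (rule energy_mono) auto
    also have "energy p F \<le> energy p E"
      using F by (simp add: \<F>_def)
    finally show "energy p ?B \<le> energy p E + ennreal e"
      by (simp add: add_mono)
  qed
qed

text \<open>A possibly unbounded \<open>E\<close> is exhausted by
  \<open>E \<inter> cball 0 k\<close>, whose volume eventually exceeds that of any smaller
  concentric ball. Letting the smaller radius tend to \<open>r\<close> uses the explicit power law
  for the energy of balls.\<close>

lemma energy_ball_le:
  fixes E :: "'a::euclidean_space set"
  assumes E [measurable]: "E \<in> sets borel" and r: "r > 0"
    and eq: "emeasure lborel E = emeasure lborel (ball (0::'a) r)" and p: "p > 0"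
  shows "energy p (ball (0::'a) r) \<le> energy p E"
proof -
  let ?n = "DIM('a)"
  define V where "V = unit_ball_vol (real ?n)"
  have V: "V > 0" by (simp add: V_def)
  have below: "energy p (ball (0::'a) s) \<le> energy p E" if s: "0 < s" "s < r" for s
  proof -
    have inc: "incseq (\<lambda>k::nat. E \<inter> cball 0 (real k))"
      by (auto simp: incseq_def intro: order_trans)
    have "(\<lambda>k::nat. emeasure lborel (E \<inter> cball 0 (real k))) \<longlonglongrightarrow> emeasure lborel (\<Union>k::nat. E \<inter> cball 0 (real k))"
      by (intro Lim_emeasure_incseq inc) auto
    also have "(\<Union>k::nat. E \<inter> cball 0 (real k)) = E"
      by (auto intro: real_arch_simple)
    also have "emeasure lborel E = ennreal (V * r ^ ?n)"
      using r by (simp add: eq emeasure_ball V_def)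
    finally have "(\<lambda>k::nat. emeasure lborel (E \<inter> cball 0 (real k))) \<longlonglongrightarrow> ennreal (V * r ^ ?n)" .
    moreover have "ennreal (V * s ^ ?n) < ennreal (V * r ^ ?n)"
      using V s by (simp add: ennreal_less_iff power_strict_mono)
    ultimately have "\<forall>\<^sub>F k::nat in sequentially. ennreal (V * s ^ ?n) < emeasure lborel (E \<inter> cball 0 (real k))"
      by (rule order_tendstoD)
    then obtain k :: nat where k: "ennreal (V * s ^ ?n) < emeasure lborel (E \<inter> cball 0 (real k))"
      by (auto simp: eventually_sequentially)
    have "emeasure lborel (E \<inter> cball 0 (real k)) \<le> emeasure lborel (cball (0::'a) (real k))"
      by (rule emeasure_mono) auto
    then have "emeasure lborel (E \<inter> cball 0 (real k)) < \<infinity>"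
      by (rule le_less_trans) (simp add: emeasure_cball)
    then have "emeasure lborel (E \<inter> cball 0 (real k)) = ennreal (measure lborel (E \<inter> cball 0 (real k)))"
      by (simp add: emeasure_eq_ennreal_measure)
    then obtain m where m: "emeasure lborel (E \<inter> cball 0 (real k)) = ennreal m" "m \<ge> 0"
      using measure_nonneg by blast
    have ms: "V * s ^ ?n < m"
      using k V s by (simp add: m ennreal_less_iff)
    \<comment> \<open>The radius of a ball with the volume of the truncated set.\<close>
    define t where "t = root ?n (m / V)"
    have t: "t ^ ?n = m / V"
      using m(2) V by (simp add: t_def)
    have "s ^ ?n < t ^ ?n"
      using ms V by (simp add: t field_simps)
    then have st: "s < t"
      using m(2) V by (metis t_def power_less_imp_less_base real_root_ge_zero divide_nonneg_pos)
    have "energy p (ball (0::'a) s) \<le> energy p (ball (0::'a) t)"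
      using st by (intro energy_mono) auto
    also have "\<dots> \<le> energy p (E \<inter> cball 0 (real k))"
      by (rule energy_ball_le_bounded[where \<rho>="real k"])
         (use s st p m t V in \<open>auto simp: emeasure_ball V_def[symmetric]\<close>)
    also have "\<dots> \<le> energy p E"
      by (rule energy_mono) auto
    finally show ?thesis .
  qed
  define q where "q = 2 * real ?n + p"
  have "energy p (ball (0::'a) 1) < \<infinity>"
    by (rule energy_finite[of _ 1]) (use p in auto)
  then obtain e where e: "energy p (ball (0::'a) 1) = ennreal e" "e \<ge> 0"
    by (cases "energy p (ball (0::'a) 1)") auto
  have "((\<lambda>s. ennreal (s powr q * e)) \<longlongrightarrow> ennreal (r powr q * e)) (at_left r)"
    using r by (intro tendsto_intros) auto
  moreover have "\<forall>\<^sub>F s in at_left r. ennreal (s powr q * e) \<le> energy p E"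
    using eventually_at_left_real[OF r]
  proof eventually_elim
    case elim: (elim s)
    then show ?case
      using below[of s] unfolding energy_ball_scale[OF conjunct1[OF elim[simplified]]] e(1) q_def
      using e(2) by (simp add: ennreal_mult'')
  qed
  ultimately have "ennreal (r powr q * e) \<le> energy p E"
    by (rule tendsto_upperbound) simp
  then show ?thesis
    unfolding energy_ball_scale[OF r] e(1) q_def using e(2) by (simp add: ennreal_mult'')
qed

section \<open>Equality case: the best centre and rigidity\<close>

lemma vimage_swap0_measurable [measurable]:
  assumes "A \<in> sets borel"
  shows "swap0 v -` A \<in> sets borel"
  using measurable_sets[OF swap0_measurable assms] by simp

lemma emeasure_vimage_swap0:
  fixes A :: "'a::euclidean_space set"
  assumes [measurable]: "A \<in> sets borel"
  shows "emeasure lborel (swap0 v -` A) = emeasure lborel A"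
proof -
  have ind: "indicator (swap0 v -` A) x = (indicator A (swap0 v x) :: ennreal)" for x
    by (simp add: indicator_def)
  show ?thesis
    using nn_integral_swap0[of "indicator A" v] by (simp flip: ind)
qed

text \<open>The overlap is continuous in the centre, and it is small once the moving ball misses a
  large ball carrying almost all of \<open>E\<close>. The supremum is therefore attained on a
  compact set of centres.\<close>

lemma exists_max_overlap:
  fixes E :: "'a::euclidean_space set"
  assumes E [measurable]: "E \<in> sets borel" and fin: "emeasure lborel E < \<infinity>" and r: "r > 0"
  obtains a where "\<And>z. emeasure lborel (E \<inter> ball z r) \<le> emeasure lborel (E \<inter> ball a r)"
proof -
  define W where "W = (\<lambda>z. measure lborel (E \<inter> ball z r))"
  have fmE: "E \<in> fmeasurable lborel"
    using fin by (simp add: fmeasurable_def)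
  then have fmI: "E \<inter> S \<in> fmeasurable lborel" if "S \<in> sets borel" for S
    using that by (auto intro: fmeasurable_Int_fmeasurable)
  have emW: "emeasure lborel (E \<inter> ball z r) = ennreal (W z)" for z
    unfolding W_def by (rule emeasure_eq_measure2) (auto intro: fmI)
  \<comment> \<open>\<open>ball z r\<close> is contained in \<open>ball z' (r + dist z z')\<close>,
    so moving the centre costs at most the volume of a thin shell.\<close>
  have W_step: "W z \<le> W z' + unit_ball_vol (DIM('a)) * ((r + dist z z') ^ DIM('a) - r ^ DIM('a))" for z z'
  proof -
    let ?D = "ball z' (r + dist z z') - ball z' r"
    have fmB: "ball z' s \<in> fmeasurable lborel" for s :: real
      by (simp add: fmeasurable_def emeasure_bounded_finite[simplified])
    have "E \<inter> ball z r \<subseteq> (E \<inter> ball z' r) \<union> ?D"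
    proof
      fix x assume "x \<in> E \<inter> ball z r"
      then show "x \<in> (E \<inter> ball z' r) \<union> ?D"
        using dist_triangle[of z' x z] by (auto simp: dist_commute)
    qed
    then have "W z \<le> measure lborel ((E \<inter> ball z' r) \<union> ?D)"
      unfolding W_def by (rule measure_mono_fmeasurable) (use fmI[of "ball z' r"] fmB in auto)
    also have "\<dots> \<le> W z' + measure lborel ?D"
      unfolding W_def by (rule measure_Un_le) auto
    also have "measure lborel ?D = measure lborel (ball z' (r + dist z z')) - measure lborel (ball z' r)"
      using fmB by (intro measurable_measure_Diff subset_ball) auto
    finally show ?thesis
      using r by (simp add: content_ball right_diff_distrib)
  qed
  have cont: "continuous_on UNIV W"
  proof (rule continuous_onI)
    fix z :: 'a and e :: real assume e: "e > 0"
    have "((\<lambda>d. unit_ball_vol (DIM('a)) * ((r + d) ^ DIM('a) - r ^ DIM('a))) \<longlongrightarrow>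
      unit_ball_vol (DIM('a)) * ((r + 0) ^ DIM('a) - r ^ DIM('a))) (at_right 0)"
      by (intro tendsto_intros)
    then have "\<forall>\<^sub>F d in at_right 0. unit_ball_vol (DIM('a)) * ((r + d) ^ DIM('a) - r ^ DIM('a)) < e"
      by (rule order_tendstoD) (use e in simp)
    then obtain d0 where d0: "d0 > 0"
       "\<And>d. 0 < d \<Longrightarrow> d < d0 \<Longrightarrow> unit_ball_vol (DIM('a)) * ((r + d) ^ DIM('a) - r ^ DIM('a)) < e"
      unfolding eventually_at_right_field by auto
    show "\<exists>d>0. \<forall>z'\<in>UNIV. dist z' z < d \<longrightarrow> dist (W z') (W z) \<le> e"
    proof (intro exI[of _ d0] conjI ballI impI d0(1))
      fix z' assume "dist z' z < d0"
      then have "z' = z \<or> unit_ball_vol (DIM('a)) * ((r + dist z' z) ^ DIM('a) - r ^ DIM('a)) < e"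
        using d0(2)[of "dist z' z"] by auto
      then show "dist (W z') (W z) \<le> e"
        using W_step[of z z'] W_step[of z' z] e by (auto simp: dist_real_def dist_commute[of z z'])
    qed
  qed
  show thesis
  proof (cases "\<exists>z0. W z0 > 0")
    case False
    then have "W z = 0" for z
      using measure_nonneg[of lborel "E \<inter> ball z r"] by (simp add: W_def not_less order_antisym)
    then show thesis
      by (intro that[of 0]) (simp add: emW)
  next
    case True
    then obtain z0 where z0: "W z0 > 0" by blast
    have "(\<lambda>k::nat. measure lborel (E \<inter> cball 0 (real k))) \<longlonglongrightarrow> measure lborel (\<Union>k::nat. E \<inter> cball 0 (real k))"
    proof (rule Lim_measure_incseq)
      show "incseq (\<lambda>k::nat. E \<inter> cball 0 (real k))"
        by (auto simp: incseq_def intro: order_trans)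
      have "emeasure lborel (\<Union>k::nat. E \<inter> cball 0 (real k)) \<le> emeasure lborel E"
        by (rule emeasure_mono) auto
      then show "emeasure lborel (\<Union>k::nat. E \<inter> cball 0 (real k)) \<noteq> \<infinity>"
        using fin by auto
    qed auto
    also have "(\<Union>k::nat. E \<inter> cball 0 (real k)) = E"
      by (auto intro: real_arch_simple)
    finally have "\<forall>\<^sub>F k::nat in sequentially. measure lborel E - W z0 < measure lborel (E \<inter> cball 0 (real k))"
      by (rule order_tendstoD) (use z0 in simp)
    then obtain k :: nat where k: "measure lborel E - W z0 < measure lborel (E \<inter> cball 0 (real k))"
      by (auto simp: eventually_sequentially)
    \<comment> \<open>Beyond norm \<open>Z\<close> the moving ball misses
      \<open>cball 0 (real k)\<close>, outside of which \<open>E\<close> has volume less than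
      \<open>W z0\<close>; the term \<open>norm z0\<close> makes \<open>z0\<close> itself a
      competitor inside.\<close>
    define Z where "Z = max (real k + r) (norm z0)"
    have out: "W z < W z0" if "norm z > Z" for z
    proof -
      have disj: "(E \<inter> ball z r) \<inter> (E \<inter> cball 0 (real k)) = {}"
      proof -
        have "False" if "dist z x < r" "norm x \<le> real k" for x
          using norm_triangle_ineq2[of z x] that \<open>norm z > Z\<close> by (simp add: Z_def dist_norm)
        then show ?thesis by auto
      qed
      have "W z + measure lborel (E \<inter> cball 0 (real k)) = measure lborel ((E \<inter> ball z r) \<union> (E \<inter> cball 0 (real k)))"
        unfolding W_def by (rule measure_Union[symmetric]) (use fmI[of "ball z r"] fmI[of "cball 0 (real k)"] disj in \<open>auto simp: fmeasurable_def\<close>)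
      also have "\<dots> \<le> measure lborel E"
        by (rule measure_mono_fmeasurable) (use fmE in auto)
      finally show ?thesis using k by linarith
    qed
    have "\<exists>a\<in>cball 0 Z. \<forall>z\<in>cball 0 Z. W z \<le> W a"
      by (rule continuous_attains_sup) (use cont r in \<open>auto simp: Z_def intro: continuous_on_subset\<close>)
    then obtain a where "\<forall>z\<in>cball 0 Z. W z \<le> W a"
      by blast
    then have a: "norm z \<le> Z \<Longrightarrow> W z \<le> W a" for z
      by simp
    have "W z \<le> W a" for z
    proof (cases "norm z \<le> Z")
      case False
      then show ?thesis
        using out[of z] a[of z0] by (force simp: Z_def)
    qed (rule a)
    then show thesis
      by (intro that[of a]) (simp add: emW ennreal_leI)
  qed
qed

text \<open>If \<open>E\<close> were not the ball, some reflection would carry part of \<open>ball 0 r - E\<close> into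
  \<open>E - ball 0 r\<close>. Since polarizing cannot lower the minimal energy, the polarization of \<open>E\<close> is then, up to a
  null set, the mirror image of \<open>E\<close>, and so \<open>E\<close> overlaps \<open>ball v r\<close> more than \<open>ball 0 r\<close>.\<close>

lemma energy_minimizer_centered:
  fixes E :: "'a::euclidean_space set"
  assumes E [measurable]: "E \<in> sets borel" and r: "r > 0" and p: "p > 0"
    and eq: "emeasure lborel E = emeasure lborel (ball (0::'a) r)"
    and min: "energy p E \<le> energy p (ball (0::'a) r)"
    and max: "\<And>v. emeasure lborel (E \<inter> ball v r) \<le> emeasure lborel (E \<inter> ball 0 r)"
  shows "emeasure lborel (E - ball 0 r) = 0" "emeasure lborel (ball 0 r - E) = 0"
proof -
  let ?B = "ball (0::'a) r"
  have Bm [measurable]: "?B \<in> sets borel" by simp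
  have Bfin: "emeasure lborel ?B < \<infinity>"
    using r by (simp add: emeasure_ball)
  have fmB: "?B \<in> fmeasurable lborel" and fmE: "E \<in> fmeasurable lborel"
    using Bfin eq by (auto simp: fmeasurable_def)
  have meq: "measure lborel E = measure lborel ?B"
    using eq by (simp add: measure_def)
  have "measure lborel (E - ?B) = measure lborel E - measure lborel (E \<inter> ?B)"
    using measurable_measure_Diff[OF fmE, of "E \<inter> ?B"] by (simp add: Diff_Int)
  moreover have "measure lborel (?B - E) = measure lborel ?B - measure lborel (E \<inter> ?B)"
    using measurable_measure_Diff[OF fmB, of "E \<inter> ?B"] by (simp add: Diff_Int)
  ultimately have "measure lborel (E - ?B) = measure lborel (?B - E)"
    using meq by simp
  moreover have "E - ?B \<in> fmeasurable lborel" "?B - E \<in> fmeasurable lborel"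
    using fmB fmE by (auto intro: fmeasurable_Diff)
  ultimately have EB: "emeasure lborel (E - ?B) = emeasure lborel (?B - E)"
    by (simp add: emeasure_eq_measure2)
  show "emeasure lborel (E - ?B) = 0"
  proof (rule ccontr)
    assume nz: "emeasure lborel (E - ?B) \<noteq> 0"
    \<comment> \<open>\<open>exists_reflection\<close> applies to bounded sets, so a bounded piece
      of \<open>E - ?B\<close> of positive measure is selected.\<close>
    have "\<exists>k::nat. emeasure lborel ((E \<inter> cball 0 (real k)) - ?B) \<noteq> 0"
    proof (rule ccontr)
      assume "\<nexists>k::nat. emeasure lborel ((E \<inter> cball 0 (real k)) - ?B) \<noteq> 0"
      then have "(\<Union>k::nat. (E \<inter> cball 0 (real k)) - ?B) \<in> null_sets lborel"
        by (intro null_sets_UN) (auto simp: null_sets_def)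
      moreover have "(\<Union>k::nat. (E \<inter> cball 0 (real k)) - ?B) = E - ?B"
        by (auto intro: real_arch_simple)
      ultimately show False
        using nz by (auto simp: null_sets_def)
    qed
    then obtain k0 :: nat where k0: "emeasure lborel ((E \<inter> cball 0 (real k0)) - ?B) \<noteq> 0"
      by blast
    define R where "R = max (real k0) r"
    have R: "R > 0" using r by (simp add: R_def)
    let ?C = "(E \<inter> cball 0 (real k0)) - ?B"
    obtain k where k: "k > 0" and
      refl: "\<And>A C :: 'a set. \<lbrakk>A \<in> sets borel; C \<in> sets borel; A \<subseteq> cball 0 R; C \<subseteq> cball 0 R\<rbrakk> \<Longrightarrow>
      \<exists>v. v \<noteq> 0 \<and> ennreal k * emeasure lborel A * emeasure lborel C \<le> emeasure lborel {x \<in> A. swap0 v x \<in> C}"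
      by (rule exists_reflection[OF R, where ?'a='a]) (rule that)
    obtain v where v: "v \<noteq> 0" and T: "ennreal k * emeasure lborel (?B - E) * emeasure lborel ?C
        \<le> emeasure lborel {x \<in> ?B - E. swap0 v x \<in> ?C}"
    proof -
      have "?B - E \<subseteq> cball 0 R" "?C \<subseteq> cball 0 R"
        by (force simp: R_def)+
      then show thesis
        using refl[of "?B - E" ?C] that by auto
    qed
    let ?T = "{x \<in> ?B - E. swap0 v x \<in> E - ?B}"
    have [measurable]: "?T \<in> sets borel" by measurable
    have "0 < ennreal k * emeasure lborel (?B - E) * emeasure lborel ?C"
      using k k0 nz EB by (simp add: ennreal_zero_less_mult_iff zero_less_iff_neq_zero)
    also note T
    also have "emeasure lborel {x \<in> ?B - E. swap0 v x \<in> ?C} \<le> emeasure lborel ?T"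
      by (rule emeasure_mono) auto
    finally have Tpos: "0 < emeasure lborel ?T" .
    let ?S = "{x\<in>near0 v. x \<in> E \<and> swap0 v x \<notin> E}"
    have Sm [measurable]: "?S \<in> sets borel" by measurable
    \<comment> \<open>Otherwise mirror pairs of both kinds occur, and polarization strictly lowers
      the energy below the minimum attained by the ball.\<close>
    have S0: "emeasure lborel ?S = 0"
    proof (rule ccontr)
      assume S: "emeasure lborel ?S \<noteq> 0"
      have "?T \<subseteq> {x\<in>near0 v. x \<notin> E \<and> swap0 v x \<in> E}"
        using norm_less_norm_swap0[OF v] by (auto simp: not_less intro: less_le_trans)
      then have "emeasure lborel ?T \<le> emeasure lborel {x\<in>near0 v. x \<notin> E \<and> swap0 v x \<in> E}"
        by (rule emeasure_mono) simp
      then have T': "emeasure lborel {x\<in>near0 v. x \<notin> E \<and> swap0 v x \<in> E} \<noteq> 0"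
        using Tpos by auto
      have "energy p E < \<infinity>"
        using min energy_finite[of ?B r p] p by (auto intro: le_less_trans)
      then have "energy p (polarize v E) < energy p E"
        by (rule energy_polarize_less[OF E v p _ S T'])
      moreover have "energy p ?B \<le> energy p (polarize v E)"
        by (rule energy_ball_le[OF _ r _ p]) (use emeasure_polarize[OF E v] eq in auto)
      ultimately show False
        using min by auto
    qed
    have S0': "emeasure lborel (swap0 v -` ?S) = 0"
      by (simp only: emeasure_vimage_swap0[OF Sm] S0)
    have Nm: "?S \<union> swap0 v -` ?S \<in> null_sets lborel"
      using S0 S0' measurable_sets[OF swap0_measurable Sm, of v] by (intro null_sets.Un) (auto simp: null_sets_def)
    \<comment> \<open>Off the null set \<open>?S\<close>, a point of the polarized set has its
      mirror image in \<open>E\<close>.\<close>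
    have "polarize v E \<inter> ?B \<subseteq> (swap0 v -` E \<inter> ?B) \<union> (?S \<union> swap0 v -` ?S)"
    proof
      fix x assume x: "x \<in> polarize v E \<inter> ?B"
      show "x \<in> (swap0 v -` E \<inter> ?B) \<union> (?S \<union> swap0 v -` ?S)"
        using x by (auto simp: polarize_def split: if_splits)
    qed
    then have "emeasure lborel (polarize v E \<inter> ?B) \<le> emeasure lborel ((swap0 v -` E \<inter> ?B) \<union> (?S \<union> swap0 v -` ?S))"
      by (rule emeasure_mono) (use Nm measurable_sets[OF swap0_measurable E, of v] in auto)
    also have "\<dots> = emeasure lborel (swap0 v -` E \<inter> ?B)"
      by (rule emeasure_Un_null_set) (use Nm measurable_sets[OF swap0_measurable E, of v] in auto)
    \<comment> \<open>The isometry \<open>swap0 v\<close> exchanges \<open>0\<close> and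
      \<open>v\<close>, hence the balls around them; the overlap of the mirror image becomes an
      overlap of \<open>E\<close> with a translate.\<close>
    also have "swap0 v -` E \<inter> ?B = swap0 v -` (E \<inter> ball v r)"
    proof -
      have "norm x = dist v (swap0 v x)" for x
      proof -
        have "swap0 v 0 = v" by (simp add: swap0_def mirror_def)
        then show ?thesis
          using norm_swap0_diff[of v 0 x] by (simp add: dist_norm)
      qed
      then show ?thesis by auto
    qed
    also have "emeasure lborel (swap0 v -` (E \<inter> ball v r)) = emeasure lborel (E \<inter> ball v r)"
      by (rule emeasure_vimage_swap0) simp
    also have "\<dots> \<le> emeasure lborel (E \<inter> ?B)"
      by (rule max)
    finally have "emeasure lborel (E \<inter> ?B) + emeasure lborel ?T \<le> emeasure lborel (E \<inter> ?B) + 0"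
      using emeasure_polarize_Int_ball[OF E v, of r] by (simp only: add_0_right)
    moreover have "emeasure lborel (E \<inter> ?B) < \<infinity>"
      using Bfin emeasure_mono[of "E \<inter> ?B" ?B lborel] by (auto intro: le_less_trans)
    ultimately show False
      using Tpos by (subst (asm) ennreal_add_left_cancel_le) auto
  qed
  then show "emeasure lborel (ball 0 r - E) = 0"
    using EB by simp
qed

lemma energy_minimizer_ball:
  fixes E :: "'a::euclidean_space set"
  assumes E [measurable]: "E \<in> sets borel" and r: "r > 0" and p: "p > 0"
    and eq: "emeasure lborel E = emeasure lborel (ball (0::'a) r)"
    and min: "energy p E \<le> energy p (ball (0::'a) r)"
  obtains a where "AE x in lborel. x \<in> E \<longleftrightarrow> x \<in> ball a r"
proof -
  have "emeasure lborel E < \<infinity>"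
    using r by (simp add: eq emeasure_ball)
  then obtain a where a: "\<And>z. emeasure lborel (E \<inter> ball z r) \<le> emeasure lborel (E \<inter> ball a r)"
    using exists_max_overlap[OF E _ r] by metis
  let ?F = "(\<lambda>x. x + a) -` E"
  have F: "?F \<in> sets borel"
    by measurable
  have ov: "emeasure lborel (?F \<inter> ball v r) = emeasure lborel (E \<inter> ball (v + a) r)" for v
  proof -
    have "?F \<inter> ball v r = (\<lambda>x. x + a) -` (E \<inter> ball (v + a) r)"
      by (auto simp: dist_norm)
    then show ?thesis
      by (simp only:) (rule emeasure_translate, simp)
  qed
  have "emeasure lborel (?F - ball 0 r) = 0" "emeasure lborel (ball 0 r - ?F) = 0"
    by (rule energy_minimizer_centered[OF F r p];
        use eq min a in \<open>simp add: energy_translate emeasure_translate ov\<close>)+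
  moreover have "?F - ball 0 r = (\<lambda>x. x + a) -` (E - ball a r)" "ball 0 r - ?F = (\<lambda>x. x + a) -` (ball a r - E)"
    by (auto simp: dist_norm norm_minus_commute)
  ultimately have "emeasure lborel (E - ball a r) = 0" "emeasure lborel (ball a r - E) = 0"
    by (simp_all add: emeasure_translate)
  then have "E - ball a r \<in> null_sets lborel" "ball a r - E \<in> null_sets lborel"
    by (auto simp: null_sets_def)
  then have "AE x in lborel. x \<notin> E - ball a r" "AE x in lborel. x \<notin> ball a r - E"
    by (simp_all only: AE_not_in)
  then have "AE x in lborel. x \<in> E \<longleftrightarrow> x \<in> ball a r"
    by eventually_elim auto
  then show thesis by (rule that)
qed

subsection \<open>The energy of a ball\<close>

text \<open>In this form the exponential of a maximum becomes a mixture of indicators of product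
  sets, since a maximum is below \<tau> exactly if both entries are.\<close>

lemma exp_layer:
  "ennreal (exp (- m)) = (\<integral>\<^sup>+\<tau>. ennreal (exp (- \<tau>)) * indicator {m<..} \<tau> \<partial>lborel)" for m :: real
proof -
  have "((\<lambda>\<tau>::real. - exp (- \<tau>)) \<longlongrightarrow> - 0) at_top"
    by (intro tendsto_minus filterlim_compose[OF exp_at_bot] filterlim_uminus_at_bot_at_top)
  then have "(\<integral>\<^sup>+\<tau>. ennreal (exp (- \<tau>)) * indicator {m..} \<tau> \<partial>lborel) = ennreal (- 0 - - exp (- m))"
    by (intro nn_integral_FTC_atLeast[where F="\<lambda>\<tau>. - exp (- \<tau>)"]) (auto intro!: derivative_eq_intros)
  moreover have "(\<integral>\<^sup>+\<tau>. ennreal (exp (- \<tau>)) * indicator {m..} \<tau> \<partial>lborel)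
      = (\<integral>\<^sup>+\<tau>. ennreal (exp (- \<tau>)) * indicator {m<..} \<tau> \<partial>lborel)"
    by (rule nn_integral_cong_AE, use AE_lborel_singleton[of m] in eventually_elim) (auto simp: indicator_def)
  ultimately show ?thesis by simp
qed

lemma nn_integral_Gamma:
  assumes "s > (-1::real)"
  shows "(\<integral>\<^sup>+\<tau>. ennreal (exp (- \<tau>)) * indicator {0<..} \<tau> * ennreal (\<tau> powr s) \<partial>lborel) = ennreal (Gamma (s + 1))"
proof -
  have "ennreal (Gamma (s + 1)) = (\<integral>\<^sup>+t. ennreal (indicator {0..} t * t powr s / exp t) \<partial>lborel)"
    using Gamma_conv_nn_integral_real[of "s + 1"] assms by simp
  also have "\<dots> = (\<integral>\<^sup>+\<tau>. ennreal (exp (- \<tau>)) * indicator {0<..} \<tau> * ennreal (\<tau> powr s) \<partial>lborel)"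
    by (intro nn_integral_cong)
      (auto simp: indicator_def exp_minus divide_inverse mult.commute simp flip: ennreal_mult')
  finally show ?thesis ..
qed

lemma nn_integral_powr_Icc:
  assumes "a > (-1::real)" "c \<ge> 0"
  shows "(\<integral>\<^sup>+s. ennreal (s powr a) * indicator {0..c} s \<partial>lborel) = ennreal (c powr (a + 1) / (a + 1))"
  using nn_integral_has_integral_lebesgue'[OF _ has_integral_powr_from_0[OF assms]] by simp

text \<open>\<open>norm z powr p\<close> is the integral of \<open>p * s powr (p - 1)\<close> over
  \<open>0 \<le> s \<le> norm z\<close>; exchanging the integrals leaves volumes of shells, in place
  of polar coordinates.\<close>

lemma nn_integral_norm_powr_ball:
  fixes p \<rho> :: real
  assumes p: "p \<ge> 0" and \<rho>: "\<rho> > 0"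
  shows "(\<integral>\<^sup>+z. ennreal (norm z powr p) * indicator (ball (0::'a::euclidean_space) \<rho>) z \<partial>lborel)
    = ennreal (unit_ball_vol DIM('a) * (DIM('a) / (DIM('a) + p)) * \<rho> powr (DIM('a) + p))"
proof (cases "p = 0")
  case True
  \<comment> \<open>The representation through the derivative degenerates here. The integrand is 1
    off the origin, and \<open>0 powr 0 = 0\<close> at it.\<close>
  have "(\<integral>\<^sup>+z. ennreal (norm z powr p) * indicator (ball (0::'a) \<rho>) z \<partial>lborel) = (\<integral>\<^sup>+z. indicator (ball (0::'a) \<rho>) z \<partial>lborel)"
    by (rule nn_integral_cong_AE, use AE_lborel_singleton[of 0] in eventually_elim) (simp add: True)
  then show ?thesis
    using \<rho> True by (simp add: emeasure_ball powr_realpow)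
next
  case False
  then have p: "p > 0" using p by simp
  let ?n = "DIM('a)"
  define V where "V = unit_ball_vol (real ?n)"
  have V: "V > 0" by (simp add: V_def)
  have "(\<integral>\<^sup>+z. ennreal (norm z powr p) * indicator (ball (0::'a) \<rho>) z \<partial>lborel)
     = (\<integral>\<^sup>+z. (\<integral>\<^sup>+s. ennreal (p * s powr (p - 1)) * indicator {0..norm z} s * indicator (ball (0::'a) \<rho>) z \<partial>lborel) \<partial>lborel)"
  proof (rule nn_integral_cong)
    fix z :: 'a
    have "(\<integral>\<^sup>+s. ennreal (p * s powr (p - 1)) * indicator {0..norm z} s * indicator (ball (0::'a) \<rho>) z \<partial>lborel)
       = ennreal p * (\<integral>\<^sup>+s. ennreal (s powr (p - 1)) * indicator {0..norm z} s \<partial>lborel) * indicator (ball (0::'a) \<rho>) z"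
      using p by (subst nn_integral_multc) (auto simp: ennreal_mult' mult.assoc nn_integral_cmult)
    also have "\<dots> = ennreal (norm z powr p) * indicator (ball (0::'a) \<rho>) z"
      using p by (subst nn_integral_powr_Icc) (auto simp flip: ennreal_mult')
    finally show "ennreal (norm z powr p) * indicator (ball (0::'a) \<rho>) z = (\<integral>\<^sup>+s. ennreal (p * s powr (p - 1)) * indicator {0..norm z} s * indicator (ball (0::'a) \<rho>) z \<partial>lborel)" ..
  qed
  also have "\<dots> = (\<integral>\<^sup>+s. (\<integral>\<^sup>+z. ennreal (p * s powr (p - 1)) * indicator {0..norm z} s * indicator (ball (0::'a) \<rho>) z \<partial>lborel) \<partial>lborel)"
    unfolding atLeastAtMost_def atLeast_def atMost_def Int_def indicator_def ball_def
    by (rule lborel_pair.Fubini') measurable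
  also have "\<dots> = (\<integral>\<^sup>+s. ennreal (V * (\<rho> ^ ?n * (p * s powr (p - 1)) - p * s powr (?n + p - 1))) * indicator {0..\<rho>} s \<partial>lborel)"
  proof (rule nn_integral_cong)
    fix s :: real
    show "(\<integral>\<^sup>+z. ennreal (p * s powr (p - 1)) * indicator {0..norm z} s * indicator (ball (0::'a) \<rho>) z \<partial>lborel)
       = ennreal (V * (\<rho> ^ ?n * (p * s powr (p - 1)) - p * s powr (?n + p - 1))) * indicator {0..\<rho>} s"
    proof (cases "s \<in> {0..\<rho>}")
      case True
      have "(\<integral>\<^sup>+z. ennreal (p * s powr (p - 1)) * indicator {0..norm z} s * indicator (ball (0::'a) \<rho>) z \<partial>lborel)
         = (\<integral>\<^sup>+z. ennreal (p * s powr (p - 1)) * indicator (ball (0::'a) \<rho> - ball 0 s) z \<partial>lborel)"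
        using True by (intro nn_integral_cong) (auto simp: indicator_def)
      also have "\<dots> = ennreal (p * s powr (p - 1)) * emeasure lborel (ball (0::'a) \<rho> - ball 0 s)"
        by (subst nn_integral_cmult_indicator) auto
      also have "emeasure lborel (ball (0::'a) \<rho> - ball 0 s) = ennreal (V * (\<rho> ^ ?n - s ^ ?n))"
        using True by (subst emeasure_Diff)
          (auto simp: emeasure_ball V_def right_diff_distrib ennreal_minus)
      also have "ennreal (p * s powr (p - 1)) * ennreal (V * (\<rho> ^ ?n - s ^ ?n)) = ennreal (p * s powr (p - 1) * (V * (\<rho> ^ ?n - s ^ ?n)))"
        using p True V by (subst ennreal_mult') auto
      also have "p * s powr (p - 1) * (V * (\<rho> ^ ?n - s ^ ?n)) = V * (\<rho> ^ ?n * (p * s powr (p - 1)) - p * s powr (?n + p - 1))"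
      proof -
        have "s powr (?n + p - 1) = s powr (p - 1) * s ^ ?n"
          using True by (cases "s = 0") (auto simp: powr_realpow[symmetric] powr_add[symmetric] algebra_simps)
        then show ?thesis by (simp add: algebra_simps)
      qed
      finally show ?thesis
        using True by simp
    next
      case False
      then have "(\<integral>\<^sup>+z. ennreal (p * s powr (p - 1)) * indicator {0..norm z} s * indicator (ball (0::'a) \<rho>) z \<partial>lborel)
         = (\<integral>\<^sup>+z. 0 \<partial>(lborel :: 'a measure))"
        by (intro nn_integral_cong) (auto simp: indicator_def)
      then show ?thesis
        using False by simp
    qed
  qed
  also have "\<dots> = ennreal (V * (\<rho> ^ ?n * (p * (\<rho> powr p / p)) - p * (\<rho> powr (?n + p) / (?n + p))))"
  proof (rule nn_integral_has_integral_lebesgue')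
    have "((\<lambda>s. s powr (p - 1)) has_integral \<rho> powr p / p) {0..\<rho>}"
      using has_integral_powr_from_0[of "p - 1" \<rho>] p \<rho> by simp
    moreover have "((\<lambda>s. s powr (?n + p - 1)) has_integral \<rho> powr (?n + p) / (?n + p)) {0..\<rho>}"
      using has_integral_powr_from_0[of "?n + p - 1" \<rho>] p \<rho> by simp
    ultimately show "((\<lambda>s. V * (\<rho> ^ ?n * (p * s powr (p - 1)) - p * s powr (?n + p - 1))) has_integral
      V * (\<rho> ^ ?n * (p * (\<rho> powr p / p)) - p * (\<rho> powr (?n + p) / (?n + p)))) {0..\<rho>}"
      by (intro has_integral_mult_right has_integral_diff)
    fix s assume s: "s \<in> {0..\<rho>}"
    have "s powr (?n + p - 1) = s powr (p - 1) * s ^ ?n"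
      using s by (cases "s = 0") (auto simp: powr_realpow[symmetric] powr_add[symmetric] algebra_simps)
    moreover have "s ^ ?n \<le> \<rho> ^ ?n"
      using s by (intro power_mono) auto
    ultimately have "p * s powr (?n + p - 1) \<le> \<rho> ^ ?n * (p * s powr (p - 1))"
      using p by (simp add: mult_right_mono mult_left_mono mult.left_commute mult.commute)
    then show "0 \<le> V * (\<rho> ^ ?n * (p * s powr (p - 1)) - p * s powr (?n + p - 1))"
      using V by simp
  qed
  also have "V * (\<rho> ^ ?n * (p * (\<rho> powr p / p)) - p * (\<rho> powr (?n + p) / (?n + p))) = V * (?n / (?n + p)) * \<rho> powr (?n + p)"
  proof -
    have "\<rho> ^ ?n * \<rho> powr p = \<rho> powr (?n + p)"
      using \<rho> by (simp add: powr_add powr_realpow)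
    moreover have "?n + p \<noteq> 0" using p by auto
    ultimately show ?thesis
      using p by (simp add: field_simps)
  qed
  finally show ?thesis by (simp add: V_def)
qed

text \<open>Layering \<open>exp (- s\<^sup>2)\<close> leaves moments of intervals, the
  one-dimensional case of \<open>nn_integral_norm_powr_ball\<close>; the factor
  \<open>2 / (q + 1)\<close> is absorbed by the functional equation of the Gamma function.\<close>

lemma nn_integral_gaussian_powr:
  assumes q: "q \<ge> 0"
  shows "(\<integral>\<^sup>+s. ennreal (\<bar>s\<bar> powr q) * ennreal (exp (- s\<^sup>2)) \<partial>lborel) = ennreal (Gamma ((q + 1) / 2))"
proof -
  have "(\<integral>\<^sup>+s. ennreal (\<bar>s\<bar> powr q) * ennreal (exp (- s\<^sup>2)) \<partial>lborel)
      = (\<integral>\<^sup>+s. (\<integral>\<^sup>+\<tau>. ennreal (\<bar>s\<bar> powr q) * (ennreal (exp (- \<tau>)) * indicator {s\<^sup>2<..} \<tau>) \<partial>lborel) \<partial>lborel)"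
    unfolding exp_layer[of "_\<^sup>2"] by (intro nn_integral_cong nn_integral_cmult[symmetric]) simp
  also have "\<dots> = (\<integral>\<^sup>+\<tau>. (\<integral>\<^sup>+s. ennreal (\<bar>s\<bar> powr q) * (ennreal (exp (- \<tau>)) * indicator {s\<^sup>2<..} \<tau>) \<partial>lborel) \<partial>lborel)"
    unfolding greaterThan_def indicator_def by (rule lborel_pair.Fubini') measurable
  also have "\<dots> = (\<integral>\<^sup>+\<tau>. ennreal (2 / (q + 1)) * (ennreal (exp (- \<tau>)) * indicator {0<..} \<tau> * ennreal (\<tau> powr ((q + 1) / 2))) \<partial>lborel)"
  proof (rule nn_integral_cong)
    fix \<tau> :: real
    show "(\<integral>\<^sup>+s. ennreal (\<bar>s\<bar> powr q) * (ennreal (exp (- \<tau>)) * indicator {s\<^sup>2<..} \<tau>) \<partial>lborel)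
      = ennreal (2 / (q + 1)) * (ennreal (exp (- \<tau>)) * indicator {0<..} \<tau> * ennreal (\<tau> powr ((q + 1) / 2)))"
    proof (cases "\<tau> > 0")
      case True
      have "(s\<^sup>2 < \<tau>) = (s \<in> ball 0 (sqrt \<tau>))" for s :: real
        using real_sqrt_less_iff[of "s\<^sup>2" \<tau>] by (simp del: real_sqrt_less_iff)
      then have "(\<integral>\<^sup>+s. ennreal (\<bar>s\<bar> powr q) * (ennreal (exp (- \<tau>)) * indicator {s\<^sup>2<..} \<tau>) \<partial>lborel)
        = (\<integral>\<^sup>+s. ennreal (exp (- \<tau>)) * (ennreal (norm s powr q) * indicator (ball (0::real) (sqrt \<tau>)) s) \<partial>lborel)"
        by (intro nn_integral_cong) (auto simp: indicator_def mult.commute)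
      also have "\<dots> = ennreal (exp (- \<tau>)) * ennreal (2 / (1 + q) * sqrt \<tau> powr (1 + q))"
      proof (subst nn_integral_cmult)
        have [measurable]: "ball (0::real) (sqrt \<tau>) \<in> sets borel" by simp
        show "(\<lambda>s. ennreal (norm s powr q) * indicator (ball 0 (sqrt \<tau>)) s) \<in> borel_measurable (lborel :: real measure)"
          by measurable
      next
        show "ennreal (exp (- \<tau>)) * (\<integral>\<^sup>+s. ennreal (norm s powr q) * indicator (ball (0::real) (sqrt \<tau>)) s \<partial>lborel)
            = ennreal (exp (- \<tau>)) * ennreal (2 / (1 + q) * sqrt \<tau> powr (1 + q))"
          using nn_integral_norm_powr_ball[OF q, of "sqrt \<tau>", where 'a=real] True by simp
      qed
      also have "sqrt \<tau> powr (1 + q) = \<tau> powr ((q + 1) / 2)"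
        using True by (simp add: powr_half_sqrt[symmetric] powr_powr add.commute)
      finally show ?thesis
        using True q by (simp add: ac_simps flip: ennreal_mult')
    next
      case False
      have "\<not> s\<^sup>2 < \<tau>" for s
        using False zero_le_power2[of s] by linarith
      then have "indicator {s\<^sup>2<..} \<tau> = (0::ennreal)" for s
        by simp
      then show ?thesis using False by simp
    qed
  qed
  also have "\<dots> = ennreal (2 / (q + 1)) * ennreal (Gamma ((q + 1) / 2 + 1))"
    using q by (subst nn_integral_cmult) (auto simp: nn_integral_Gamma)
  also have "\<dots> = ennreal (Gamma ((q + 1) / 2))"
  proof -
    have "Gamma ((q + 1) / 2 + 1) = (q + 1) / 2 * Gamma ((q + 1) / 2)"
      using q by (intro Gamma_plus1) (auto elim!: nonpos_Ints_cases)
    moreover have "2 / (q + 1) * ((q + 1) / 2 * G) = G" for G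
      using q by (simp add: field_split_simps)
    ultimately have "2 / (q + 1) * Gamma ((q + 1) / 2 + 1) = Gamma ((q + 1) / 2)"
      by (simp only:)
    then show ?thesis
      using q by (subst ennreal_mult'[symmetric]) auto
  qed
  finally show ?thesis .
qed

lemma nn_integral_gaussian: "(\<integral>\<^sup>+s. ennreal (exp (- s\<^sup>2)) \<partial>lborel) = ennreal (sqrt pi)"
proof -
  have "(\<integral>\<^sup>+s. ennreal (exp (- s\<^sup>2)) \<partial>(lborel :: real measure)) = (\<integral>\<^sup>+s. ennreal (\<bar>s\<bar> powr 0) * ennreal (exp (- s\<^sup>2)) \<partial>lborel)"
    by (rule nn_integral_cong_AE, use AE_lborel_singleton[of 0] in eventually_elim) simp
  then show ?thesis
    using nn_integral_gaussian_powr[of 0] by (simp add: Gamma_one_half_real)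
qed

text \<open>The two half-lines are pushed outwards by \<open>a\<close>, which opens a gap around
  0.\<close>

lemma nn_integral_gaussian_shift:
  assumes a: "a \<ge> 0"
  shows "(\<integral>\<^sup>+s. ennreal (exp (- (\<bar>s\<bar> + a)\<^sup>2)) \<partial>lborel)
    = (\<integral>\<^sup>+s. ennreal (exp (- s\<^sup>2)) * indicator {s. a < \<bar>s\<bar>} s \<partial>lborel)"
proof -
  have "(\<integral>\<^sup>+s. ennreal (exp (- (\<bar>s\<bar> + a)\<^sup>2)) \<partial>lborel)
     = (\<integral>\<^sup>+s. ennreal (exp (- (s + a)\<^sup>2)) * indicator {a<..} (s + a) + ennreal (exp (- (s + - a)\<^sup>2)) * indicator {..<-a} (s + - a) \<partial>lborel)"
  proof (rule nn_integral_cong_AE, use AE_lborel_singleton[of 0] in eventually_elim)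
    fix s :: real assume "s \<noteq> 0"
    then show "ennreal (exp (- (\<bar>s\<bar> + a)\<^sup>2)) = ennreal (exp (- (s + a)\<^sup>2)) * indicator {a<..} (s + a) + ennreal (exp (- (s + - a)\<^sup>2)) * indicator {..<-a} (s + - a)"
      using power2_commute[of a s] by (auto simp: indicator_def abs_if)
  qed
  also have "\<dots> = (\<integral>\<^sup>+s. ennreal (exp (- (s + a)\<^sup>2)) * indicator {a<..} (s + a) \<partial>lborel)
     + (\<integral>\<^sup>+s. ennreal (exp (- (s + - a)\<^sup>2)) * indicator {..<-a} (s + - a) \<partial>lborel)"
    by (rule nn_integral_add) auto
  also have "(\<integral>\<^sup>+s. ennreal (exp (- (s + a)\<^sup>2)) * indicator {a<..} (s + a) \<partial>lborel)
     = (\<integral>\<^sup>+s. ennreal (exp (- s\<^sup>2)) * indicator {a<..} s \<partial>lborel)"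
    by (rule nn_integral_lborel_translate) auto
  also have "(\<integral>\<^sup>+s. ennreal (exp (- (s + - a)\<^sup>2)) * indicator {..<-a} (s + - a) \<partial>lborel)
     = (\<integral>\<^sup>+s. ennreal (exp (- s\<^sup>2)) * indicator {..<-a} s \<partial>lborel)"
    by (rule nn_integral_lborel_translate) auto
  also have "(\<integral>\<^sup>+s. ennreal (exp (- s\<^sup>2)) * indicator {a<..} s \<partial>lborel) + (\<integral>\<^sup>+s. ennreal (exp (- s\<^sup>2)) * indicator {..<-a} s \<partial>lborel)
     = (\<integral>\<^sup>+s. ennreal (exp (- s\<^sup>2)) * indicator {a<..} s + ennreal (exp (- s\<^sup>2)) * indicator {..<-a} s \<partial>lborel)"
    by (rule nn_integral_add[symmetric]) auto
  also have "\<dots> = (\<integral>\<^sup>+s. ennreal (exp (- s\<^sup>2)) * indicator {s. a < \<bar>s\<bar>} s \<partial>lborel)"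
    using a by (intro nn_integral_cong) (auto simp: indicator_def abs_if)
  finally show ?thesis .
qed

text \<open>The energy of the unit ball is found by computing one Gaussian double integral twice:
  in layers, it is the energy times a value of the Gamma function; in
  midpoint coordinates, it splits into one-dimensional integrals.\<close>

lemma gaussian_energy_layers:
  fixes p :: real
  assumes p: "p > 0"
  shows "(\<integral>\<^sup>+x. (\<integral>\<^sup>+y. ennreal (exp (- max ((norm x)\<^sup>2) ((norm y)\<^sup>2))) * ennreal (norm (x - y) powr p) \<partial>lborel) \<partial>(lborel :: 'a measure))
    = energy p (ball (0::'a::euclidean_space) 1) * ennreal (Gamma (DIM('a) + p / 2 + 1))"
proof -
  let ?m = "\<lambda>x y :: 'a. max ((norm x)\<^sup>2) ((norm y)\<^sup>2)"
  define g where "g = (\<lambda>\<tau> (x::'a) y. ennreal (exp (- \<tau>)) * indicator {\<tau>. max ((norm x)\<^sup>2) ((norm y)\<^sup>2) < \<tau>} \<tau> * ennreal (norm (x - y) powr p))"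
  have "(\<integral>\<^sup>+x. (\<integral>\<^sup>+y. ennreal (exp (- ?m x y)) * ennreal (norm (x - y) powr p) \<partial>lborel) \<partial>lborel)
     = (\<integral>\<^sup>+x. (\<integral>\<^sup>+y. (\<integral>\<^sup>+\<tau>. g \<tau> x y \<partial>lborel) \<partial>lborel) \<partial>lborel)"
  proof (intro nn_integral_cong)
    fix x y :: 'a
    have "(\<integral>\<^sup>+\<tau>. g \<tau> x y \<partial>lborel) = (\<integral>\<^sup>+\<tau>. ennreal (exp (- \<tau>)) * indicator {?m x y<..} \<tau> \<partial>lborel) * ennreal (norm (x - y) powr p)"
      unfolding g_def greaterThan_def by (rule nn_integral_multc) measurable
    then show "ennreal (exp (- ?m x y)) * ennreal (norm (x - y) powr p) = (\<integral>\<^sup>+\<tau>. g \<tau> x y \<partial>lborel)"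
      by (simp add: exp_layer[of "?m x y"])
  qed
  also have "\<dots> = (\<integral>\<^sup>+x. (\<integral>\<^sup>+\<tau>. (\<integral>\<^sup>+y. g \<tau> x y \<partial>lborel) \<partial>lborel) \<partial>lborel)"
    unfolding g_def indicator_def by (intro nn_integral_cong lborel_pair.Fubini') measurable
  also have "\<dots> = (\<integral>\<^sup>+\<tau>. (\<integral>\<^sup>+x. (\<integral>\<^sup>+y. g \<tau> x y \<partial>lborel) \<partial>lborel) \<partial>lborel)"
    unfolding g_def indicator_def by (rule lborel_pair.Fubini') measurable
  also have "\<dots> = (\<integral>\<^sup>+\<tau>. energy p (ball (0::'a) 1) * (ennreal (exp (- \<tau>)) * indicator {0<..} \<tau> * ennreal (\<tau> powr (DIM('a) + p / 2))) \<partial>lborel)"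
  proof (rule nn_integral_cong)
    fix \<tau> :: real
    show "(\<integral>\<^sup>+x. (\<integral>\<^sup>+y. g \<tau> x y \<partial>lborel) \<partial>lborel)
      = energy p (ball (0::'a) 1) * (ennreal (exp (- \<tau>)) * indicator {0<..} \<tau> * ennreal (\<tau> powr (DIM('a) + p / 2)))"
    proof (cases "\<tau> > 0")
      case True
      have lt: "(norm x)\<^sup>2 < \<tau> \<longleftrightarrow> norm x < sqrt \<tau>" for x :: 'a
        using real_sqrt_less_iff[of "(norm x)\<^sup>2" \<tau>] by (simp del: real_sqrt_less_iff)
      have [measurable]: "ball (0::'a) (sqrt \<tau>) \<in> sets borel" by simp
      \<comment> \<open>Each layer is a product of two balls of radius \<open>sqrt \<tau>\<close>.
        Its energy grows like the power \<open>DIM('a) + p / 2\<close> of \<tau>, which produces the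
        Gamma value.\<close>
      have "g \<tau> x y = ennreal (exp (- \<tau>)) * (indicator (ball 0 (sqrt \<tau>)) x * indicator (ball 0 (sqrt \<tau>)) y * ennreal (norm (x - y) powr p))" for x y
        unfolding g_def by (auto simp: indicator_def lt)
      then have "(\<integral>\<^sup>+x. (\<integral>\<^sup>+y. g \<tau> x y \<partial>lborel) \<partial>lborel) = ennreal (exp (- \<tau>)) * energy p (ball (0::'a) (sqrt \<tau>))"
        by (simp add: nn_integral_cmult energy_def)
      also have "energy p (ball (0::'a) (sqrt \<tau>)) = ennreal (sqrt \<tau> powr (2 * real DIM('a) + p)) * energy p (ball (0::'a) 1)"
        using True by (intro energy_ball_scale) simp
      also have "sqrt \<tau> powr (2 * real DIM('a) + p) = \<tau> powr (DIM('a) + p / 2)"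
        using True by (simp add: powr_half_sqrt[symmetric] powr_powr add_divide_distrib)
      finally show ?thesis
        using True by (simp add: ac_simps)
    next
      case False
      have "\<not> (norm x)\<^sup>2 < \<tau>" for x :: 'a
        using False zero_le_power2[of "norm x"] by linarith
      then have "g \<tau> x y = 0" for x y
        by (auto simp: g_def indicator_def)
      then show ?thesis using False by simp
    qed
  qed
  also have "\<dots> = energy p (ball (0::'a) 1) * ennreal (Gamma (DIM('a) + p / 2 + 1))"
    using p by (subst nn_integral_cmult) (auto simp: nn_integral_Gamma)
  finally show ?thesis .
qed

text \<open>The two squared norms differ only in the sign of \<open>t \<bullet> z\<close>, and the
  maximum picks the non-negative one.\<close>

lemma max_norm_midpoint:
  fixes t z :: "'a::real_inner"
  shows "max ((norm (t + (1/2) *\<^sub>R z))\<^sup>2) ((norm (t - (1/2) *\<^sub>R z))\<^sup>2) = (norm t)\<^sup>2 + (norm z)\<^sup>2 / 4 + \<bar>t \<bullet> z\<bar>"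
proof -
  have *: "(norm (t + c *\<^sub>R z))\<^sup>2 = (norm t)\<^sup>2 + c\<^sup>2 * (norm z)\<^sup>2 + 2 * c * (t \<bullet> z)" for c
    unfolding power2_norm_eq_inner
    by (simp add: inner_add_left inner_add_right inner_commute[of z t] power2_eq_square algebra_simps)
  have "(norm (t + (1/2) *\<^sub>R z))\<^sup>2 = ((norm t)\<^sup>2 + (norm z)\<^sup>2 / 4) + t \<bullet> z"
    using *[of "1/2"] by (simp add: power_divide)
  moreover have "(norm (t - (1/2) *\<^sub>R z))\<^sup>2 = ((norm t)\<^sup>2 + (norm z)\<^sup>2 / 4) - t \<bullet> z"
    using *[of "- (1/2)"] by (simp add: power_divide)
  moreover have "max (A + B) (A - B) = A + \<bar>B\<bar>" for A B :: real
    by (simp add: max_def abs_if)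
  ultimately show ?thesis
    by (simp only:)
qed

text \<open>A reflection turns \<open>z\<close> into a multiple of a basis vector \<open>e\<close>.
  The term \<open>\<bar>t \<bullet> z\<bar>\<close> then involves one coordinate only and completes
  the square \<open>(\<bar>t \<bullet> e\<bar> + norm z / 2)\<^sup>2\<close>, so the integrand
  factors; every other coordinate contributes \<open>sqrt pi\<close>.\<close>

lemma gaussian_ridge_integral:
  fixes z :: "'a::euclidean_space"
  shows "(\<integral>\<^sup>+t. ennreal (exp (- ((norm t)\<^sup>2 + (norm z)\<^sup>2 / 4 + \<bar>t \<bullet> z\<bar>))) \<partial>lborel)
    = ennreal (sqrt pi ^ (DIM('a) - 1)) * (\<integral>\<^sup>+s. ennreal (exp (- s\<^sup>2)) * indicator {s. norm z / 2 < \<bar>s\<bar>} s \<partial>lborel)"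
proof -
  obtain e :: 'a where e: "e \<in> Basis" using nonempty_Basis by blast
  define v where "v = z - norm z *\<^sub>R e"
  have "norm z = norm (norm z *\<^sub>R e)"
    using e by simp
  then have mz: "mirror v z = norm z *\<^sub>R e"
    unfolding v_def by (rule mirror_maps_diff)
  define f where "f = (\<lambda>b s. exp (- (if b = e then (\<bar>s\<bar> + norm z / 2)\<^sup>2 else s\<^sup>2)))"
  have "(\<integral>\<^sup>+t. ennreal (exp (- ((norm t)\<^sup>2 + (norm z)\<^sup>2 / 4 + \<bar>t \<bullet> z\<bar>))) \<partial>lborel)
     = (\<integral>\<^sup>+t. ennreal (exp (- ((norm (mirror v t))\<^sup>2 + (norm z)\<^sup>2 / 4 + \<bar>mirror v t \<bullet> z\<bar>))) \<partial>lborel)"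
    by (rule nn_integral_mirror[symmetric]) measurable
  also have "\<dots> = (\<integral>\<^sup>+t. (\<Prod>b\<in>Basis. ennreal (f b (t \<bullet> b))) \<partial>lborel)"
  proof (rule nn_integral_cong)
    fix t :: 'a
    have "mirror v t \<bullet> z = mirror v t \<bullet> mirror v (norm z *\<^sub>R e)"
      by (simp flip: mz)
    then have "\<bar>mirror v t \<bullet> z\<bar> = norm z * \<bar>t \<bullet> e\<bar>"
      by (simp add: abs_mult)
    moreover have "(norm t)\<^sup>2 = (t \<bullet> e)\<^sup>2 + (\<Sum>b\<in>Basis - {e}. (t \<bullet> b)\<^sup>2)"
      unfolding power2_norm_eq_inner euclidean_inner[of t t]
      using e by (subst sum.remove[of _ e]) (auto simp: power2_eq_square)
    ultimately have "(norm (mirror v t))\<^sup>2 + (norm z)\<^sup>2 / 4 + \<bar>mirror v t \<bullet> z\<bar>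
       = (\<bar>t \<bullet> e\<bar> + norm z / 2)\<^sup>2 + (\<Sum>b\<in>Basis - {e}. (t \<bullet> b)\<^sup>2)"
      by (simp add: power2_sum power_divide)
    also have "\<dots> = (\<Sum>b\<in>Basis. if b = e then (\<bar>t \<bullet> b\<bar> + norm z / 2)\<^sup>2 else (t \<bullet> b)\<^sup>2)"
      using e by (subst sum.remove[of _ e]) auto
    finally have "exp (- ((norm (mirror v t))\<^sup>2 + (norm z)\<^sup>2 / 4 + \<bar>mirror v t \<bullet> z\<bar>)) = (\<Prod>b\<in>Basis. f b (t \<bullet> b))"
      by (simp add: f_def exp_sum sum_negf[symmetric] del: sum_negf)
    then show "ennreal (exp (- ((norm (mirror v t))\<^sup>2 + (norm z)\<^sup>2 / 4 + \<bar>mirror v t \<bullet> z\<bar>))) = (\<Prod>b\<in>Basis. ennreal (f b (t \<bullet> b)))"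
      by (simp add: prod_ennreal f_def)
  qed
  also have "\<dots> = (\<Prod>b\<in>Basis. (\<integral>\<^sup>+s. ennreal (f b s) \<partial>lborel))"
    unfolding f_def by (rule nn_integral_lborel_prod) auto
  also have "\<dots> = (\<integral>\<^sup>+s. ennreal (f e s) \<partial>lborel) * (\<Prod>b\<in>Basis - {e}. (\<integral>\<^sup>+s. ennreal (f b s) \<partial>lborel))"
    using e by (subst prod.remove[of _ e]) auto
  also have "(\<Prod>b\<in>Basis - {e}. (\<integral>\<^sup>+s. ennreal (f b s) \<partial>lborel)) = (\<Prod>b\<in>Basis - {e}. ennreal (sqrt pi))"
    by (rule prod.cong) (auto simp: f_def nn_integral_gaussian)
  also have "\<dots> = ennreal (sqrt pi ^ (DIM('a) - 1))"
    using e by (simp add: ennreal_power)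
  also have "(\<integral>\<^sup>+s. ennreal (f e s) \<partial>lborel) = (\<integral>\<^sup>+s. ennreal (exp (- s\<^sup>2)) * indicator {s. norm z / 2 < \<bar>s\<bar>} s \<partial>lborel)"
    unfolding f_def by (simp add: nn_integral_gaussian_shift)
  finally show ?thesis
    by (simp add: mult.commute)
qed

text \<open>With \<open>z = y - x\<close> and \<open>t\<close> the midpoint, the inner integral is
  \<open>gaussian_ridge_integral\<close>. Exchanging the other two leaves, for each
  \<open>s\<close>, the integral of \<open>norm z powr p\<close> over a ball of radius
  \<open>2 * \<bar>s\<bar>\<close>, and finally a Gaussian moment of order
  \<open>DIM('a) + p\<close>.\<close>

lemma gaussian_energy_value:
  fixes p :: real
  assumes p: "p > 0"
  shows "(\<integral>\<^sup>+x. (\<integral>\<^sup>+y. ennreal (exp (- max ((norm x)\<^sup>2) ((norm y)\<^sup>2))) * ennreal (norm (x - y) powr p)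
        \<partial>lborel) \<partial>(lborel :: 'a::euclidean_space measure))
    = ennreal (sqrt pi ^ (DIM('a) - 1) * (unit_ball_vol DIM('a) * (DIM('a) / (DIM('a) + p)) * 2 powr (DIM('a) + p))
        * Gamma ((DIM('a) + p + 1) / 2))"
proof -
  let ?n = "DIM('a)"
  let ?k = "\<lambda>z::'a. ennreal (norm z powr p)"
  let ?c = "unit_ball_vol ?n * (?n / (?n + p))"
  have c: "?c \<ge> 0" using p by simp
  have "(\<integral>\<^sup>+x. (\<integral>\<^sup>+y. ennreal (exp (- max ((norm x)\<^sup>2) ((norm y)\<^sup>2))) * ?k (x - y) \<partial>lborel) \<partial>(lborel :: 'a measure))
     = (\<integral>\<^sup>+x. (\<integral>\<^sup>+z. ennreal (exp (- max ((norm x)\<^sup>2) ((norm (z + x))\<^sup>2))) * ?k z \<partial>lborel) \<partial>lborel)"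
  proof (rule nn_integral_cong)
    fix x :: 'a
    show "(\<integral>\<^sup>+y. ennreal (exp (- max ((norm x)\<^sup>2) ((norm y)\<^sup>2))) * ?k (x - y) \<partial>lborel)
      = (\<integral>\<^sup>+z. ennreal (exp (- max ((norm x)\<^sup>2) ((norm (z + x))\<^sup>2))) * ?k z \<partial>lborel)"
      using nn_integral_lborel_translate[of "\<lambda>y. ennreal (exp (- max ((norm x)\<^sup>2) ((norm y)\<^sup>2))) * ?k (x - y)" x]
      by simp
  qed
  also have "\<dots> = (\<integral>\<^sup>+z. (\<integral>\<^sup>+x. ennreal (exp (- max ((norm x)\<^sup>2) ((norm (z + x))\<^sup>2))) * ?k z \<partial>lborel) \<partial>lborel)"
    by (rule lborel_pair.Fubini') measurable
  also have "\<dots> = (\<integral>\<^sup>+z. (\<integral>\<^sup>+t. ennreal (exp (- ((norm t)\<^sup>2 + (norm z)\<^sup>2 / 4 + \<bar>t \<bullet> z\<bar>))) \<partial>lborel) * ?k z \<partial>lborel)"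
  proof (rule nn_integral_cong)
    fix z :: 'a
    have z: "z + (t + - ((1/2) *\<^sub>R z)) = t + (1/2) *\<^sub>R z" for t
    proof -
      have "w + (t + - h) = t + h" if "h + h = w" for h w :: 'a
        using that by (rule subst) simp
      moreover have "(1/2) *\<^sub>R z + (1/2) *\<^sub>R z = z"
        by (simp flip: scaleR_add_left)
      ultimately show ?thesis by blast
    qed
    have "(\<integral>\<^sup>+x. ennreal (exp (- max ((norm x)\<^sup>2) ((norm (z + x))\<^sup>2))) * ?k z \<partial>lborel)
       = (\<integral>\<^sup>+t. ennreal (exp (- max ((norm (t + - ((1/2) *\<^sub>R z)))\<^sup>2) ((norm (z + (t + - ((1/2) *\<^sub>R z))))\<^sup>2))) * ?k z \<partial>lborel)"
      by (rule nn_integral_lborel_translate[symmetric]) measurable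
    also have "\<dots> = (\<integral>\<^sup>+t. ennreal (exp (- ((norm t)\<^sup>2 + (norm z)\<^sup>2 / 4 + \<bar>t \<bullet> z\<bar>))) * ?k z \<partial>lborel)"
    proof -
      have "max ((norm (t - (1/2) *\<^sub>R z))\<^sup>2) ((norm (t + (1/2) *\<^sub>R z))\<^sup>2) = (norm t)\<^sup>2 + (norm z)\<^sup>2 / 4 + \<bar>t \<bullet> z\<bar>" for t
        by (subst max.commute) (rule max_norm_midpoint)
      then show ?thesis
        unfolding z by (simp only: add_uminus_conv_diff)
    qed
    also have "\<dots> = (\<integral>\<^sup>+t. ennreal (exp (- ((norm t)\<^sup>2 + (norm z)\<^sup>2 / 4 + \<bar>t \<bullet> z\<bar>))) \<partial>lborel) * ?k z"
      by (rule nn_integral_multc) measurable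
    finally show "(\<integral>\<^sup>+x. ennreal (exp (- max ((norm x)\<^sup>2) ((norm (z + x))\<^sup>2))) * ?k z \<partial>lborel)
      = (\<integral>\<^sup>+t. ennreal (exp (- ((norm t)\<^sup>2 + (norm z)\<^sup>2 / 4 + \<bar>t \<bullet> z\<bar>))) \<partial>lborel) * ?k z" .
  qed
  also have "\<dots> = (\<integral>\<^sup>+z. ennreal (sqrt pi ^ (?n - 1)) * (\<integral>\<^sup>+s. ennreal (exp (- s\<^sup>2)) * indicator {s. norm z / 2 < \<bar>s\<bar>} s * ?k z \<partial>lborel) \<partial>lborel)"
    unfolding gaussian_ridge_integral mult.assoc by (intro nn_integral_cong arg_cong2[where f="(*)"] refl, subst nn_integral_multc[symmetric]) (auto simp: mult.assoc)
  also have "\<dots> = ennreal (sqrt pi ^ (?n - 1)) * (\<integral>\<^sup>+z. (\<integral>\<^sup>+s. ennreal (exp (- s\<^sup>2)) * indicator {s. norm z / 2 < \<bar>s\<bar>} s * ?k z \<partial>lborel) \<partial>lborel)"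
    unfolding indicator_def by (rule nn_integral_cmult) measurable
  also have "(\<integral>\<^sup>+z. (\<integral>\<^sup>+s. ennreal (exp (- s\<^sup>2)) * indicator {s. norm z / 2 < \<bar>s\<bar>} s * ?k z \<partial>lborel) \<partial>lborel)
     = (\<integral>\<^sup>+s. (\<integral>\<^sup>+z. ennreal (exp (- s\<^sup>2)) * indicator {s. norm z / 2 < \<bar>s\<bar>} s * ?k z \<partial>lborel) \<partial>lborel)"
    unfolding indicator_def by (rule lborel_pair.Fubini') measurable
  also have "\<dots> = (\<integral>\<^sup>+s. ennreal (?c * 2 powr (?n + p)) * (ennreal (\<bar>s\<bar> powr (?n + p)) * ennreal (exp (- s\<^sup>2))) \<partial>lborel)"
  proof (rule nn_integral_cong_AE, use AE_lborel_singleton[of 0] in eventually_elim)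
    fix s :: real assume s: "s \<noteq> 0"
    have bm: "ball (0::'a) (2 * \<bar>s\<bar>) \<in> sets borel" by simp
    have "indicator {s. norm z / 2 < \<bar>s\<bar>} s = (indicator (ball 0 (2 * \<bar>s\<bar>)) z :: ennreal)" for z :: 'a
      by (auto simp: indicator_def)
    then have "(\<integral>\<^sup>+z. ennreal (exp (- s\<^sup>2)) * indicator {s. norm z / 2 < \<bar>s\<bar>} s * ?k z \<partial>lborel)
       = (\<integral>\<^sup>+z. ennreal (exp (- s\<^sup>2)) * (?k z * indicator (ball 0 (2 * \<bar>s\<bar>)) z) \<partial>lborel)"
      by (simp add: ac_simps)
    also have "\<dots> = ennreal (exp (- s\<^sup>2)) * (\<integral>\<^sup>+z. ?k z * indicator (ball 0 (2 * \<bar>s\<bar>)) z \<partial>lborel)"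
      using bm by (intro nn_integral_cmult borel_measurable_times_ennreal borel_measurable_indicator) auto
    also have "(\<integral>\<^sup>+z. ?k z * indicator (ball 0 (2 * \<bar>s\<bar>)) z \<partial>lborel) = ennreal (?c * (2 * \<bar>s\<bar>) powr (?n + p))"
      using s p by (intro nn_integral_norm_powr_ball) auto
    also have "?c * (2 * \<bar>s\<bar>) powr (?n + p) = ?c * 2 powr (?n + p) * \<bar>s\<bar> powr (?n + p)"
      by (simp add: powr_mult)
    also have "ennreal (exp (- s\<^sup>2)) * ennreal (?c * 2 powr (?n + p) * \<bar>s\<bar> powr (?n + p))
       = ennreal (?c * 2 powr (?n + p)) * (ennreal (\<bar>s\<bar> powr (?n + p)) * ennreal (exp (- s\<^sup>2)))"
    proof -
      have c2: "?c * 2 powr (?n + p) \<ge> 0"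
        by (rule mult_nonneg_nonneg[OF c powr_ge_zero])
      show ?thesis
        unfolding ennreal_mult[OF c2 powr_ge_zero, of "\<bar>s\<bar>" "?n + p"] by (simp only: mult_ac)
    qed
    finally show "(\<integral>\<^sup>+z. ennreal (exp (- s\<^sup>2)) * indicator {s. norm z / 2 < \<bar>s\<bar>} s * ?k z \<partial>lborel)
       = ennreal (?c * 2 powr (?n + p)) * (ennreal (\<bar>s\<bar> powr (?n + p)) * ennreal (exp (- s\<^sup>2)))" .
  qed
  also have "\<dots> = ennreal (?c * 2 powr (?n + p)) * ennreal (Gamma ((?n + p + 1) / 2))"
    using p by (subst nn_integral_cmult) (auto simp: nn_integral_gaussian_powr)
  also have "ennreal (sqrt pi ^ (?n - 1)) * (ennreal (?c * 2 powr (?n + p)) * ennreal (Gamma ((?n + p + 1) / 2)))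
     = ennreal (sqrt pi ^ (?n - 1) * (?c * 2 powr (?n + p)) * Gamma ((?n + p + 1) / 2))"
  proof -
    have "Gamma ((?n + p + 1) / 2) \<ge> 0"
      using p by (intro less_imp_le Gamma_real_pos) auto
    moreover have "?c * 2 powr (?n + p) \<ge> 0"
      by (rule mult_nonneg_nonneg[OF c powr_ge_zero])
    moreover have "sqrt pi ^ (?n - 1) \<ge> 0"
      by simp
    moreover have "ennreal A * (ennreal C * ennreal G) = ennreal (A * C * G)"
      if "G \<ge> 0" "C \<ge> 0" "A \<ge> 0" for A C G :: real
      using that by (simp add: ennreal_mult mult.assoc)
    ultimately show ?thesis
      by blast
  qed
  finally show ?thesis .
qed

lemma sigma_const_pos:
  assumes "n > 0" "\<alpha> > 0"
  shows "sigma_const n \<alpha> > 0"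
proof -
  have "Gamma ((\<alpha> + 1) / 2) > 0" "Gamma (real n / 2 + 1) > 0" "Gamma ((real n + \<alpha>) / 2 + 1) > 0"
    using assms by (auto intro!: Gamma_real_pos add_nonneg_pos)
  moreover from this(2) have "Gamma (real n / 2 + 1) powr (\<alpha> / real n) > 0"
    by (metis powr_gt_zero less_irrefl)
  ultimately show ?thesis
    unfolding sigma_const_def using assms
    by (intro divide_pos_pos mult_pos_pos) simp_all
qed

text \<open>Equating the two evaluations determines the energy. The factor
  \<open>Gamma (n / 2 + 1) powr ((n + p) / n)\<close> of the constant cancels the same power in the
  denominator of the power of the unit ball volume.\<close>

lemma energy_unit_ball:
  fixes p :: real
  assumes p: "p > 0"
  defines "n \<equiv> DIM('a::euclidean_space)"
  shows "energy p (ball (0::'a) 1) = ennreal (sigma_const n (n + p) * unit_ball_vol n powr ((2 * n + p) / n))"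
proof -
  have n: "n > 0" by (simp add: n_def)
  define V where "V = unit_ball_vol (real n)"
  have V: "V > 0" by (simp add: V_def)
  define G1 where "G1 = Gamma (n + p / 2 + 1)"
  define G2 where "G2 = Gamma ((n + p + 1) / 2)"
  define G3 where "G3 = Gamma (real n / 2 + 1)"
  have G: "G1 > 0" "G2 > 0" "G3 > 0"
    unfolding G1_def G2_def G3_def using p by (auto intro!: Gamma_real_pos)
  have "energy p (ball (0::'a) 1) < \<infinity>"
    by (rule energy_finite[of _ 1]) (use p in auto)
  then obtain e where e: "energy p (ball (0::'a) 1) = ennreal e" "e \<ge> 0"
    by (cases "energy p (ball (0::'a) 1)") auto
  have "ennreal (e * G1) = energy p (ball (0::'a) 1) * ennreal G1"
    using e by (simp add: ennreal_mult')
  also have "\<dots> = ennreal (sqrt pi ^ (n - 1) * (V * (n / (n + p)) * 2 powr (n + p)) * G2)"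
    unfolding n_def V_def G1_def G2_def
    by (rule trans[OF sym[OF gaussian_energy_layers[OF p]] gaussian_energy_value[OF p]])
  finally have "ennreal (e * G1) = ennreal (sqrt pi ^ (n - 1) * (V * (n / (n + p)) * 2 powr (n + p)) * G2)" .
  then have eG: "e * G1 = sqrt pi ^ (n - 1) * (V * (n / (n + p)) * 2 powr (n + p)) * G2"
    using e G V p by (subst (asm) ennreal_inj) (auto intro!: mult_nonneg_nonneg)
  then have e_eq: "e = sqrt pi ^ (n - 1) * (V * (n / (n + p)) * 2 powr (n + p)) * G2 / G1"
  proof -
    have "e = e * G1 / G1" using G by simp
    then show ?thesis unfolding eG .
  qed
  have Vp: "V powr ((2 * n + p) / n) = V * (pi powr ((n + p) / 2) / G3 powr ((n + p) / n))"
  proof -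
    have "(2 * real n + p) / n = 1 + (n + p) / n"
      using n by (simp add: field_simps)
    moreover have "V = pi powr (n / 2) / G3"
      by (simp add: V_def unit_ball_vol_def G3_def)
    then have "V powr ((n + p) / n) = pi powr ((n + p) / 2) / G3 powr ((n + p) / n)"
      using n G by (simp add: powr_divide powr_powr)
    ultimately show ?thesis
      using V by (simp add: powr_add)
  qed
  have pi1: "sqrt pi ^ (n - 1) = pi powr ((real n - 1) / 2)"
    using n by (simp add: powr_half_sqrt[symmetric] powr_power of_nat_diff field_simps)
  have pi2: "pi powr ((real n - (n + p) - 1) / 2) * pi powr ((n + p) / 2) = pi powr ((real n - 1) / 2)"
  proof -
    have "(real n - (n + p) - 1) / 2 + (n + p) / 2 = (real n - 1) / 2"
      by (simp flip: add_divide_distrib)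
    then show ?thesis by (simp only: powr_add[symmetric])
  qed
  have "sigma_const n (n + p) * V powr ((2 * n + p) / n)
     = (pi powr ((real n - (n + p) - 1) / 2) * pi powr ((n + p) / 2)) * n * 2 powr (n + p) * G2 * V / ((n + p) * G1)"
  proof -
    have "Gamma ((real n + (n + p)) / 2 + 1) = G1"
      by (simp add: G1_def add_divide_distrib)
    then have "sigma_const n (n + p) = real n * 2 powr (n + p) * pi powr ((real n - (n + p) - 1) / 2) * G2 * G3 powr ((n + p) / n) / ((n + p) * G1)"
      using p by (simp add: sigma_const_def G2_def G3_def)
    then show ?thesis
      unfolding Vp using G by (simp add: field_simps)
  qed
  also have "\<dots> = e"
    unfolding e_eq pi2 pi1 by (simp add: field_simps)
  finally show ?thesis
    unfolding e(1) V_def by simp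
qed

lemma energy_ball:
  fixes p r :: real
  assumes p: "p > 0" and r: "r > 0"
  defines "n \<equiv> DIM('a::euclidean_space)"
  shows "energy p (ball (0::'a) r) = ennreal (sigma_const n (n + p) * measure lborel (ball (0::'a) r) powr ((2 * n + p) / n))"
proof -
  have n: "n > 0" by (simp add: n_def)
  have "measure lborel (ball (0::'a) r) powr ((2 * n + p) / n) = unit_ball_vol n powr ((2 * n + p) / n) * r powr (2 * n + p)"
    using r n by (simp add: content_ball n_def[symmetric] powr_mult powr_realpow[symmetric] powr_powr)
  then show ?thesis
    unfolding energy_ball_scale[OF r] energy_unit_ball[OF p] n_def[symmetric]
    using sigma_const_pos[of n "n + p"] n p by (simp add: ennreal_mult'' mult_ac)
qed

subsection \<open>Integration over the superlevel sets\<close>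

lemma ennreal_add_right_cancel_le: "a + ennreal c \<le> b + ennreal c \<longleftrightarrow> a \<le> b"
  using ennreal_add_left_cancel_le[of "ennreal c" a b] by (simp add: add.commute)

lemma ball_of_measure:
  assumes "m > 0"
  obtains r where "r > 0" "measure lborel (ball (0::'a::euclidean_space) r) = m"
proof
  let ?V = "unit_ball_vol DIM('a)"
  have V: "?V > 0" by simp
  then show r: "root DIM('a) (m / ?V) > 0"
    using assms by simp
  show "measure lborel (ball (0::'a) (root DIM('a) (m / ?V))) = m"
    using assms V r by (simp add: content_ball less_imp_le del: unit_ball_vol_pos)
qed

text \<open>A ball of the same volume is inserted between the two sides. For a null set there is no
  such ball, but then the left-hand side is 0.\<close>

lemma energy_ge:
  fixes E :: "'a::euclidean_space set"
  assumes E: "E \<in> sets borel" and fin: "emeasure lborel E < \<infinity>" and p: "p > 0"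
  defines "n \<equiv> DIM('a)"
  shows "ennreal (sigma_const n (n + p) * measure lborel E powr ((2 * n + p) / n)) \<le> energy p E"
proof (cases "measure lborel E = 0")
  case False
  then have "measure lborel E > 0"
    using measure_nonneg[of lborel E] by linarith
  then obtain r where r: "r > 0" "measure lborel (ball (0::'a) r) = measure lborel E"
    by (rule ball_of_measure)
  have "emeasure lborel E = emeasure lborel (ball (0::'a) r)"
    using fin r(2) emeasure_eq_ennreal_measure[of lborel E] emeasure_eq_ennreal_measure[of lborel "ball (0::'a) r"] emeasure_bounded_finite[of "ball (0::'a) r"]
    by simp
  then show ?thesis
    using energy_ball_le[OF E r(1) _ p] energy_ball[OF p r(1), where 'a='a] r(2) by (simp add: n_def)
qed simp

lemma energy_eq_imp_ball:
  fixes E :: "'a::euclidean_space set"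
  assumes E: "E \<in> sets borel" and fin: "emeasure lborel E < \<infinity>" and p: "p > 0" and pos: "measure lborel E > 0"
  defines "n \<equiv> DIM('a)"
  assumes le: "energy p E \<le> ennreal (sigma_const n (n + p) * measure lborel E powr ((2 * n + p) / n))"
  obtains a r where "r > 0" "AE x in lborel. x \<in> E \<longleftrightarrow> x \<in> ball a r"
proof -
  obtain r where r: "r > 0" "measure lborel (ball (0::'a) r) = measure lborel E"
    using pos by (rule ball_of_measure)
  have eq: "emeasure lborel E = emeasure lborel (ball (0::'a) r)"
    using fin r(2) emeasure_eq_ennreal_measure[of lborel E] emeasure_eq_ennreal_measure[of lborel "ball (0::'a) r"] emeasure_bounded_finite[of "ball (0::'a) r"]
    by simp
  have "energy p E \<le> energy p (ball (0::'a) r)"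
    using le energy_ball[OF p r(1), where 'a='a] r(2) by (simp add: n_def)
  then show thesis
    using energy_minimizer_ball[OF E r(1) p eq] that[OF r(1)] by blast
qed

text \<open>The mean value theorem for \<open>w powr q - q * w\<close> on either side of 1, where
  the derivative changes sign. The endpoint 0 is checked directly, as the derivative is used for
  positive arguments only.\<close>

lemma powr_gt_tangent_at_1:
  fixes q w :: real
  assumes q: "q > 1" and w: "w \<ge> 0" "w \<noteq> 1"
  shows "w powr q > 1 + q * (w - 1)"
proof (cases "w = 0")
  case False
  then have w: "w > 0" "w \<noteq> 1" using w by auto
  let ?h = "\<lambda>w. w powr q - q * w" and ?h' = "\<lambda>w. q * w powr (q - 1) - q"
  have der: "DERIV ?h x :> ?h' x" if "x > 0" for x
    using that by (auto intro!: derivative_eq_intros)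
  have "?h w - ?h 1 > 0"
  proof (cases "w > 1")
    case True
    obtain z where z: "1 < z" "?h w - ?h 1 = (w - 1) * ?h' z"
      using MVT2[OF True, of ?h ?h'] der by force
    have "z powr (q - 1) > 1"
      using z q by (simp add: gr_one_powr)
    then show ?thesis
      unfolding z(2) using True q by (intro mult_pos_pos) auto
  next
    case False
    then have lt: "w < 1" using w by simp
    obtain z where z: "w < z" "z < 1" "?h 1 - ?h w = (1 - w) * ?h' z"
      using MVT2[OF lt, of ?h ?h'] der w by force
    have "z powr (q - 1) < 1 powr (q - 1)"
      using z q w by (intro powr_less_mono2) auto
    then have "(1 - w) * ?h' z < 0"
      using lt q by (intro mult_pos_neg) auto
    then show ?thesis using z(3) by linarith
  qed
  then show ?thesis by (simp add: algebra_simps)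
qed (use q in simp)

text \<open>The tangent inequality at 1, rescaled by \<open>w = u / a\<close>. All terms are kept
  additive and non-negative so that it can be integrated in \<open>ennreal\<close>.\<close>

lemma powr_tangent:
  fixes q a u :: real
  assumes q: "q > 1" and a: "a > 0" and u: "u \<ge> 0"
  shows "q * a powr (q - 1) * u \<le> u powr q + (q - 1) * a powr q"
    and "u powr q + (q - 1) * a powr q \<le> q * a powr (q - 1) * u \<Longrightarrow> u = a"
proof -
  have aq: "a powr q = a * a powr (q - 1)"
    using a by (simp add: powr_diff)
  have uq: "u powr q = a powr q * (u / a) powr q"
    using a u by (simp add: powr_divide)
  have A: "a powr q > 0" using a by simp
  have lin: "q * a powr (q - 1) * u = a powr q * (1 + q * (u / a - 1)) + (q - 1) * a powr q"
    unfolding aq using a by (simp add: field_simps)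
  have strict: "q * a powr (q - 1) * u < u powr q + (q - 1) * a powr q" if "u \<noteq> a"
  proof -
    have "1 + q * (u / a - 1) < (u / a) powr q"
      by (rule powr_gt_tangent_at_1) (use q a u that in auto)
    then show ?thesis
      unfolding lin uq using A by simp
  qed
  then show "u = a" if "u powr q + (q - 1) * a powr q \<le> q * a powr (q - 1) * u"
    using that by force
  show "q * a powr (q - 1) * u \<le> u powr q + (q - 1) * a powr q"
  proof (cases "u = a")
    case True
    then show ?thesis by (simp add: aq algebra_simps)
  qed (use strict in force)
qed

lemma nn_integral_layer_cake:
  fixes g :: "'a::euclidean_space \<Rightarrow> real"
  assumes [measurable]: "g \<in> borel_measurable borel" and nn: "\<And>x. g x \<ge> 0"
  shows "(\<integral>\<^sup>+x. ennreal (g x) \<partial>lborel) = (\<integral>\<^sup>+t. indicator {0<..} t * emeasure lborel {x. g x > t} \<partial>lborel)"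
proof -
  have "(\<integral>\<^sup>+x. ennreal (g x) \<partial>lborel) = (\<integral>\<^sup>+x. (\<integral>\<^sup>+t. indicator {0<..} t * indicator {x. g x > t} x \<partial>lborel) \<partial>lborel)"
  proof (rule nn_integral_cong)
    fix x
    have "(\<integral>\<^sup>+t. indicator {0<..} t * indicator {x. g x > t} x \<partial>lborel) = (\<integral>\<^sup>+t. indicator {0<..<g x} t \<partial>lborel)"
      by (intro nn_integral_cong) (auto simp: indicator_def)
    then show "ennreal (g x) = (\<integral>\<^sup>+t. indicator {0<..} t * indicator {x. g x > t} x \<partial>lborel)"
      using nn by simp
  qed
  also have "\<dots> = (\<integral>\<^sup>+t. (\<integral>\<^sup>+x. indicator {0<..} t * indicator {x. g x > t} x \<partial>lborel) \<partial>lborel)"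
    unfolding indicator_def by (rule lborel_pair.Fubini') measurable
  also have "\<dots> = (\<integral>\<^sup>+t. indicator {0<..} t * emeasure lborel {x. g x > t} \<partial>lborel)"
    by (intro nn_integral_cong, subst nn_integral_cmult) auto
  finally show ?thesis .
qed

text \<open>A level lies below the minimum exactly if both points are in the superlevel set, so each
  level contributes the interaction of that set with itself.\<close>

lemma min_energy_layer_cake:
  fixes g :: "'a::euclidean_space \<Rightarrow> real"
  assumes gm [measurable]: "g \<in> borel_measurable borel" and nn: "\<And>x. g x \<ge> 0"
  shows "(\<integral>\<^sup>+y. (\<integral>\<^sup>+x. ennreal (min (g x) (g y)) * ennreal (norm (x - y) powr p) \<partial>lborel) \<partial>lborel)
    = (\<integral>\<^sup>+t. indicator {0<..} t * energy p {x. g x > t} \<partial>lborel)"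
proof -
  let ?k = "\<lambda>x y :: 'a. ennreal (norm (x - y) powr p)"
  let ?E = "\<lambda>t. {x. g x > t}"
  have "(\<integral>\<^sup>+y. (\<integral>\<^sup>+x. ennreal (min (g x) (g y)) * ?k x y \<partial>lborel) \<partial>lborel)
     = (\<integral>\<^sup>+y. (\<integral>\<^sup>+x. (\<integral>\<^sup>+t. indicator {0<..} t * (indicator (?E t) x * indicator (?E t) y * ?k x y) \<partial>lborel) \<partial>lborel) \<partial>lborel)"
  proof (intro nn_integral_cong)
    fix x y
    have "(\<integral>\<^sup>+t. indicator {0<..} t * (indicator (?E t) x * indicator (?E t) y * ?k x y) \<partial>lborel)
       = (\<integral>\<^sup>+t. indicator {0<..<min (g x) (g y)} t * ?k x y \<partial>lborel)"
      by (intro nn_integral_cong) (auto simp: indicator_def)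
    also have "\<dots> = ennreal (min (g x) (g y)) * ?k x y"
      using nn by (subst nn_integral_multc) auto
    finally show "ennreal (min (g x) (g y)) * ?k x y
      = (\<integral>\<^sup>+t. indicator {0<..} t * (indicator (?E t) x * indicator (?E t) y * ?k x y) \<partial>lborel)" ..
  qed
  also have "\<dots> = (\<integral>\<^sup>+y. (\<integral>\<^sup>+t. (\<integral>\<^sup>+x. indicator {0<..} t * (indicator (?E t) x * indicator (?E t) y * ?k x y) \<partial>lborel) \<partial>lborel) \<partial>lborel)"
    unfolding indicator_def by (intro nn_integral_cong lborel_pair.Fubini') measurable
  also have "\<dots> = (\<integral>\<^sup>+t. (\<integral>\<^sup>+y. (\<integral>\<^sup>+x. indicator {0<..} t * (indicator (?E t) x * indicator (?E t) y * ?k x y) \<partial>lborel) \<partial>lborel) \<partial>lborel)"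
    unfolding indicator_def by (rule lborel_pair.Fubini') measurable
  also have "\<dots> = (\<integral>\<^sup>+t. indicator {0<..} t * energy p (?E t) \<partial>lborel)"
  proof (rule nn_integral_cong)
    fix t :: real
    have "(\<integral>\<^sup>+y. (\<integral>\<^sup>+x. indicator {0<..} t * (indicator (?E t) x * indicator (?E t) y * ?k x y) \<partial>lborel) \<partial>lborel)
       = indicator {0<..} t * (\<integral>\<^sup>+y. (\<integral>\<^sup>+x. indicator (?E t) x * indicator (?E t) y * ?k x y \<partial>lborel) \<partial>lborel)"
      by (simp add: nn_integral_cmult)
    also have "(\<integral>\<^sup>+y. (\<integral>\<^sup>+x. indicator (?E t) x * indicator (?E t) y * ?k x y \<partial>lborel) \<partial>lborel) = energy p (?E t)"
      unfolding energy_def by (rule lborel_pair.Fubini') measurable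
    finally show "(\<integral>\<^sup>+y. (\<integral>\<^sup>+x. indicator {0<..} t * (indicator (?E t) x * indicator (?E t) y * ?k x y) \<partial>lborel) \<partial>lborel)
       = indicator {0<..} t * energy p (?E t)" .
  qed
  finally show ?thesis .
qed

lemma energy_level_measurable:
  fixes g :: "'a::euclidean_space \<Rightarrow> real"
  assumes gm [measurable]: "g \<in> borel_measurable borel"
  shows "(\<lambda>t. energy p {x. g x > t}) \<in> borel_measurable borel"
  unfolding energy_def indicator_def by measurable

text \<open>Superlevel sets are compared with balls by \<open>energy_ge\<close>, and the resulting integral over the
  levels is bounded by Jensen's inequality, in the form of the tangent line at
  the mean \<open>a = (LINT x|lborel. g x) / M\<close> of the distribution function.\<close>

lemma min_energy_ge:
  fixes g :: "'a::euclidean_space \<Rightarrow> real" and p M :: real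
  assumes gm [measurable]: "g \<in> borel_measurable borel" and nn: "\<And>x. g x \<ge> 0"
    and int: "integrable lborel g" and Lpos: "(LINT x|lborel. g x) > 0"
    and M: "M > 0" and gM: "AE x in lborel. g x \<le> M" and p: "p > 0"
  defines "n \<equiv> DIM('a)"
  defines "q \<equiv> (2 * n + p) / n"
  defines "bound \<equiv> ennreal (sigma_const n (n + p) * (LINT x|lborel. g x) powr q * M powr (1 - q))"
  defines "J \<equiv> (\<integral>\<^sup>+y. (\<integral>\<^sup>+x. ennreal (min (g x) (g y)) * ennreal (norm (x - y) powr p) \<partial>lborel) \<partial>lborel)"
  shows "bound \<le> J"
    and "J \<le> bound \<Longrightarrow> \<exists>a r. r > 0 \<and> (AE x in lborel. g x = M * indicator (ball a r) x)"
proof -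
  define L where "L = (LINT x|lborel. g x)"
  define \<sigma> where "\<sigma> = sigma_const n (n + p)"
  define a where "a = L / M"
  define I where "I = {0<..<M}"
  define \<mu> where "\<mu> = (\<lambda>t. measure lborel {x. g x > t})"
  have n: "n > 0" by (simp add: n_def)
  have q: "q > 1" using n p by (simp add: q_def field_simps)
  have \<sigma>: "\<sigma> > 0" unfolding \<sigma>_def using n p by (intro sigma_const_pos) auto
  have L: "L > 0" using Lpos by (simp add: L_def)
  have a: "a > 0" using L M by (simp add: a_def)
  have Em [measurable]: "{x. g x > t} \<in> sets borel" for t by measurable
  have Lnn: "(\<integral>\<^sup>+x. ennreal (g x) \<partial>lborel) = ennreal L"
    unfolding L_def by (rule nn_integral_eq_integral[OF int]) (simp add: nn)
  have fin: "emeasure lborel {x. g x > t} < \<infinity>" if t: "t > 0" for t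
  proof -
    have "ennreal t * emeasure lborel {x. g x > t} = (\<integral>\<^sup>+x. ennreal t * indicator {x. g x > t} x \<partial>lborel)"
      by (subst nn_integral_cmult_indicator) auto
    also have "\<dots> \<le> (\<integral>\<^sup>+x. ennreal (g x) \<partial>lborel)"
      using t by (intro nn_integral_mono) (auto simp: indicator_def ennreal_leI)
    finally have "ennreal t * emeasure lborel {x. g x > t} < \<infinity>"
      using Lnn by (auto intro: le_less_trans)
    then show ?thesis
      using t by (auto simp: ennreal_mult_less_top)
  qed
  have em: "emeasure lborel {x. g x > t} = ennreal (\<mu> t)" if "t > 0" for t
    unfolding \<mu>_def using fin[OF that] by (intro emeasure_eq_ennreal_measure) auto
  have \<mu>0: "\<mu> t \<ge> 0" for t by (simp add: \<mu>_def)
  \<comment> \<open>This confines the distribution function to the interval \<open>I\<close> of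
    finite length \<open>M\<close>, over which the mean is taken.\<close>
  have high: "{x. g x > t} \<in> null_sets lborel" if "t \<ge> M" for t
  proof -
    have "AE x in lborel. x \<notin> {x. g x > t}"
      using gM by eventually_elim (use that in auto)
    then show ?thesis by (simp add: AE_iff_null_sets)
  qed
  have low: "indicator {0<..} t * emeasure lborel {x. g x > t} = ennreal (\<mu> t) * indicator I t" for t
    using high[of t] em[of t] by (cases "t < M"; cases "t > 0") (auto simp: I_def null_sets_def)
  have \<mu>L: "(\<integral>\<^sup>+t. ennreal (\<mu> t) * indicator I t \<partial>lborel) = ennreal L"
    unfolding Lnn[symmetric] nn_integral_layer_cake[OF gm nn] low ..
  have mm: "(\<lambda>t. ennreal (\<mu> t) * indicator I t) \<in> borel_measurable borel"
    unfolding low[symmetric] by measurable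
  \<comment> \<open>\<open>l\<close> and \<open>h\<close> are the two sides of the tangent
    inequality at \<open>\<mu> t\<close>, times \<sigma>, with
    \<open>\<sigma> * \<mu> t powr q\<close> replaced by the energy in \<open>h\<close>. The
    constant stays added to the energy because subtraction in \<open>ennreal\<close>
    truncates.\<close>
  define h where "h = (\<lambda>t. (energy p {x. g x > t} + ennreal (\<sigma> * (q - 1) * a powr q)) * indicator I t)"
  define l where "l = (\<lambda>t. ennreal (\<sigma> * q * a powr (q - 1)) * (ennreal (\<mu> t) * indicator I t))"
  have Im [measurable]: "I \<in> sets borel" by (simp add: I_def)
  note [measurable] = energy_level_measurable[OF gm]
  have hm [measurable]: "h \<in> borel_measurable borel"
    unfolding h_def by measurable
  have lm [measurable]: "l \<in> borel_measurable borel"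
    unfolding l_def using mm by measurable
  have iso: "ennreal (\<sigma> * \<mu> t powr q) \<le> energy p {x. g x > t}" if "t > 0" for t
    using energy_ge[OF Em fin[OF that] p] by (simp add: \<sigma>_def \<mu>_def q_def n_def)
  have lh: "l t \<le> h t" for t
  proof (cases "t \<in> I")
    case True
    then have t: "t > 0" by (simp add: I_def)
    have "\<sigma> * (q * a powr (q - 1) * \<mu> t) \<le> \<sigma> * (\<mu> t powr q + (q - 1) * a powr q)"
      using powr_tangent(1)[OF q a \<mu>0] \<sigma> by (intro mult_left_mono) auto
    then have "\<sigma> * q * a powr (q - 1) * \<mu> t \<le> \<sigma> * \<mu> t powr q + \<sigma> * (q - 1) * a powr q"
      by (simp add: algebra_simps)
    moreover have "l t = ennreal (\<sigma> * q * a powr (q - 1) * \<mu> t)"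
      unfolding l_def using True \<sigma> q by (simp add: ennreal_mult')
    ultimately have "l t \<le> ennreal (\<sigma> * \<mu> t powr q + \<sigma> * (q - 1) * a powr q)"
      by (simp add: ennreal_leI)
    also have "\<dots> = ennreal (\<sigma> * \<mu> t powr q) + ennreal (\<sigma> * (q - 1) * a powr q)"
      using \<sigma> q by (intro ennreal_plus) auto
    also have "\<dots> \<le> energy p {x. g x > t} + ennreal (\<sigma> * (q - 1) * a powr q)"
      by (intro add_right_mono iso t)
    finally show ?thesis using True by (simp add: h_def)
  qed (simp add: l_def)
  have il: "(\<integral>\<^sup>+t. l t \<partial>lborel) = ennreal (\<sigma> * q * a powr (q - 1) * L)"
    unfolding l_def using mm \<mu>L \<sigma> q by (subst nn_integral_cmult) (auto simp: ennreal_mult')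
  have ih: "(\<integral>\<^sup>+t. h t \<partial>lborel) = (\<integral>\<^sup>+t. energy p {x. g x > t} * indicator I t \<partial>lborel) + ennreal (\<sigma> * (q - 1) * a powr q * M)"
  proof -
    have "(\<integral>\<^sup>+t. h t \<partial>lborel) = (\<integral>\<^sup>+t. energy p {x. g x > t} * indicator I t \<partial>lborel)
        + (\<integral>\<^sup>+t. ennreal (\<sigma> * (q - 1) * a powr q) * indicator I t \<partial>lborel)"
      unfolding h_def distrib_right by (rule nn_integral_add) measurable
    also have "(\<integral>\<^sup>+t. ennreal (\<sigma> * (q - 1) * a powr q) * indicator I t \<partial>lborel) = ennreal (\<sigma> * (q - 1) * a powr q * M)"
      using M \<sigma> q by (subst nn_integral_cmult_indicator) (auto simp: I_def ennreal_mult')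
    finally show ?thesis .
  qed
  have JI: "(\<integral>\<^sup>+t. energy p {x. g x > t} * indicator I t \<partial>lborel) \<le> J"
    unfolding J_def min_energy_layer_cake[OF gm nn]
    by (intro nn_integral_mono) (auto simp: I_def indicator_def)
  have aL: "a * M = L" using M by (simp add: a_def)
  have aq: "a powr q = a powr (q - 1) * a" using a by (simp add: powr_diff)
  \<comment> \<open>At the mean the tangent line has the value \<open>a powr q\<close>; integrated
    over length \<open>M\<close> it leaves the bound plus the added constant.\<close>
  have split: "\<sigma> * q * a powr (q - 1) * L = \<sigma> * a powr q * M + \<sigma> * (q - 1) * a powr q * M"
    unfolding aL[symmetric] aq by (simp add: algebra_simps)
  have bound: "bound = ennreal (\<sigma> * a powr q * M)"
  proof -
    have "a powr q * M = L powr q * M powr (1 - q)"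
      using L M by (simp add: a_def powr_divide powr_diff)
    then show ?thesis
      by (simp add: bound_def \<sigma>_def L_def mult.assoc)
  qed
  have nonneg: "\<sigma> * a powr q * M \<ge> 0" "\<sigma> * (q - 1) * a powr q * M \<ge> 0"
    using \<sigma> q M by auto
  have "bound + ennreal (\<sigma> * (q - 1) * a powr q * M) = (\<integral>\<^sup>+t. l t \<partial>lborel)"
    unfolding bound il split by (rule ennreal_plus[symmetric, OF nonneg])
  also have "\<dots> \<le> (\<integral>\<^sup>+t. h t \<partial>lborel)"
    by (intro nn_integral_mono lh)
  also have "\<dots> \<le> J + ennreal (\<sigma> * (q - 1) * a powr q * M)"
    unfolding ih by (intro add_right_mono JI)
  finally show "bound \<le> J"
    by (simp add: ennreal_add_right_cancel_le)
  show "\<exists>a r. r > 0 \<and> (AE x in lborel. g x = M * indicator (ball a r) x)" if eq: "J \<le> bound"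
  proof -
    have "(\<integral>\<^sup>+t. h t \<partial>lborel) \<le> bound + ennreal (\<sigma> * (q - 1) * a powr q * M)"
      unfolding ih by (intro add_right_mono order_trans[OF JI eq])
    also have "\<dots> = (\<integral>\<^sup>+t. l t \<partial>lborel)"
      unfolding bound il split by (rule ennreal_plus[symmetric, OF nonneg])
    finally have hl: "\<not> (\<integral>\<^sup>+t. l t \<partial>lborel) < (\<integral>\<^sup>+t. h t \<partial>lborel)"
      by (simp add: not_less)
    have AE_hl: "AE t in lborel. h t \<le> l t"
    proof (rule ccontr)
      assume "\<not> (AE t in lborel. h t \<le> l t)"
      then have "(\<integral>\<^sup>+t. l t \<partial>lborel) < (\<integral>\<^sup>+t. h t \<partial>lborel)"
        by (intro nn_integral_less) (auto simp: il lh)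
      then show False using hl by simp
    qed
    have good: "\<mu> t = a \<and> energy p {x. g x > t} \<le> ennreal (\<sigma> * \<mu> t powr q)" if "h t \<le> l t" "t \<in> I" for t
    proof -
      have t: "t > 0" using that by (simp add: I_def)
      have le: "energy p {x. g x > t} + ennreal (\<sigma> * (q - 1) * a powr q) \<le> ennreal (\<sigma> * q * a powr (q - 1) * \<mu> t)"
        using that \<sigma> q by (simp add: h_def l_def ennreal_mult')
      have "ennreal (\<sigma> * \<mu> t powr q + \<sigma> * (q - 1) * a powr q) = ennreal (\<sigma> * \<mu> t powr q) + ennreal (\<sigma> * (q - 1) * a powr q)"
        using \<sigma> q by (intro ennreal_plus) auto
      also have "\<dots> \<le> energy p {x. g x > t} + ennreal (\<sigma> * (q - 1) * a powr q)"
        by (intro add_right_mono iso t)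
      also note le
      finally have "\<sigma> * \<mu> t powr q + \<sigma> * (q - 1) * a powr q \<le> \<sigma> * q * a powr (q - 1) * \<mu> t"
        using \<sigma> q \<mu>0[of t] by (subst (asm) ennreal_le_iff) auto
      then have "\<sigma> * (\<mu> t powr q + (q - 1) * a powr q) \<le> \<sigma> * (q * a powr (q - 1) * \<mu> t)"
        by (simp add: algebra_simps)
      then have \<mu>a: "\<mu> t = a"
        using \<sigma> powr_tangent(2)[OF q a \<mu>0] by simp
      have "\<sigma> * q * a powr (q - 1) * \<mu> t = \<sigma> * \<mu> t powr q + \<sigma> * (q - 1) * a powr q"
        unfolding \<mu>a aq by (simp add: algebra_simps)
      then have "energy p {x. g x > t} + ennreal (\<sigma> * (q - 1) * a powr q) \<le> ennreal (\<sigma> * \<mu> t powr q) + ennreal (\<sigma> * (q - 1) * a powr q)"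
        using le \<sigma> q by (simp add: ennreal_plus)
      then show ?thesis
        using \<mu>a by (simp add: ennreal_add_right_cancel_le)
    qed
    have ex: "\<exists>t. s < t \<and> t < s' \<and> h t \<le> l t" if "s < s'" for s s' :: real
    proof (rule ccontr)
      assume "\<nexists>t. s < t \<and> t < s' \<and> h t \<le> l t"
      then have "AE t in lborel. t \<notin> {s<..<s'}"
        using AE_hl by (auto elim: eventually_mono)
      then have "{s<..<s'} \<in> null_sets lborel"
        by (simp add: AE_iff_null_sets)
      then show False
        using that by (simp add: null_sets_def)
    qed
    have anti: "\<mu> t \<le> \<mu> s" if "0 < s" "s \<le> t" for s t
      unfolding \<mu>_def by (rule measure_mono_fmeasurable) (use that fin in \<open>auto simp: fmeasurable_def\<close>)
    \<comment> \<open>\<open>\<mu>\<close> equals \<open>a\<close> on a dense set of levels, and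
      monotonicity fills the gaps.\<close>
    have const: "\<mu> t = a" if "t \<in> I" for t
    proof -
      obtain t1 where t1: "0 < t1" "t1 < t" "h t1 \<le> l t1"
        using ex[of 0 t] \<open>t \<in> I\<close> by (auto simp: I_def)
      obtain t2 where t2: "t < t2" "t2 < M" "h t2 \<le> l t2"
        using ex[of t M] \<open>t \<in> I\<close> by (auto simp: I_def)
      have "\<mu> t1 = a" "\<mu> t2 = a"
        using good[of t1] good[of t2] t1 t2 by (auto simp: I_def)
      then show ?thesis
        using anti[of t1 t] anti[of t t2] t1 t2 by auto
    qed
    obtain t0 where t0: "0 < t0" "t0 < M" "h t0 \<le> l t0"
      using ex[OF M] by blast
    have t0I: "t0 \<in> I" using t0 by (simp add: I_def)
    obtain c r where r: "r > 0" and ball0: "AE x in lborel. x \<in> {x. g x > t0} \<longleftrightarrow> x \<in> ball c r"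
    proof (rule energy_eq_imp_ball[OF Em fin[OF t0(1)] p])
      show "measure lborel {x. g x > t0} > 0"
        using const[OF t0I] a by (simp add: \<mu>_def)
      show "energy p {x. g x > t0} \<le> ennreal (sigma_const DIM('a) (real DIM('a) + p) *
          measure lborel {x. g x > t0} powr ((2 * real DIM('a) + p) / real DIM('a)))"
        using conjunct2[OF good[OF t0(3) t0I]] by (simp add: \<sigma>_def n_def q_def \<mu>_def)
    qed (rule that)
    \<comment> \<open>Nested sets of equal finite volume agree up to a null set. The ball found at
      the single level \<open>t0\<close> therefore serves for all levels.\<close>
    have nested: "AE x in lborel. x \<in> {x. g x > t} \<longrightarrow> x \<in> {x. g x > s}" "AE x in lborel. x \<in> {x. g x > s} \<longrightarrow> x \<in> {x. g x > t}"
      if "s \<in> I" "s \<le> t" "t \<in> I" for s t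
    proof -
      show "AE x in lborel. x \<in> {x. g x > t} \<longrightarrow> x \<in> {x. g x > s}"
        using that by auto
      have "emeasure lborel ({x. g x > s} - {x. g x > t}) = emeasure lborel {x. g x > s} - emeasure lborel {x. g x > t}"
        using that fin[of t] by (intro emeasure_Diff) (auto simp: I_def)
      also have "\<dots> = 0"
        using that const[of s] const[of t] em[of s] em[of t] by (simp add: I_def)
      finally have "{x. g x > s} - {x. g x > t} \<in> null_sets lborel"
        by (auto simp: null_sets_def)
      then have "AE x in lborel. x \<notin> {x. g x > s} - {x. g x > t}"
        by (rule AE_not_in)
      then show "AE x in lborel. x \<in> {x. g x > s} \<longrightarrow> x \<in> {x. g x > t}"
        by eventually_elim auto
    qed
    have all: "AE x in lborel. g x > t \<longleftrightarrow> x \<in> ball c r" if "t \<in> I" for t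
    proof (cases "t \<le> t0")
      case True
      show ?thesis
        using ball0 nested[OF \<open>t \<in> I\<close> True t0I] by eventually_elim auto
    next
      case False
      then show ?thesis
        using ball0 nested[OF t0I _ \<open>t \<in> I\<close>] by (auto elim: eventually_elim2)
    qed
    \<comment> \<open>Countably many levels suffice if they approach 0 and \<open>M\<close>. The
      summand 2 keeps both sequences strictly inside \<open>I\<close> already for
      \<open>k = 0\<close>.\<close>
    have inI: "M / (real k + 2) \<in> I" "M - M / (real k + 2) \<in> I" for k :: nat
      using M by (auto simp: I_def field_simps intro!: add_pos_nonneg)
    have "AE x in lborel. \<forall>k::nat. (g x > M / (real k + 2) \<longleftrightarrow> x \<in> ball c r) \<and> (g x > M - M / (real k + 2) \<longleftrightarrow> x \<in> ball c r)"
      unfolding AE_all_countable AE_conj_iff using all inI by blast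
    with gM have "AE x in lborel. g x = M * indicator (ball c r) x"
    proof eventually_elim
      case (elim x)
      have lim: "(\<lambda>k. M / (real k + 2)) \<longlonglongrightarrow> 0"
        using LIMSEQ_ignore_initial_segment[OF lim_const_over_n[of M], of 2] by (simp add: add.commute)
      show ?case
      proof (cases "x \<in> ball c r")
        case True
        then have "M - M / (real k + 2) \<le> g x" for k :: nat
          using elim(2) by (auto intro: less_imp_le)
        moreover have "(\<lambda>k. M - M / (real k + 2)) \<longlonglongrightarrow> M - 0"
          by (intro tendsto_intros lim)
        ultimately have "M - 0 \<le> g x"
          by (intro LIMSEQ_le_const2) auto
        then show ?thesis
          using True elim(1) by simp
      next
        case False
        then have "g x \<le> M / (real k + 2)" for k :: nat
          using elim(2) by (auto simp: not_less)
        then have "g x \<le> 0"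
          by (intro LIMSEQ_le_const[OF lim]) auto
        then show ?thesis
          using False nn[of x] by simp
      qed
    qed
    then show ?thesis using r by blast
  qed
qed

section \<open>Passage from Borel functions to classes of Lebesgue measurable functions\<close>

theorem theoremB:
  fixes f :: "real ^ 'n \<Rightarrow> real" and \<alpha> :: real and n :: nat
    and lhs rhs :: ennreal
  assumes n: "n = CARD('n)"
    and alpha: "\<alpha> > real n"
    and L1: "integrable lebesgue f"
    and Linf: "Linf_norm f < \<infinity>"
    and nonneg: "AE x in lebesgue. f x \<ge> 0"
    and nonzero: "emeasure lebesgue {x. f x \<noteq> 0} > 0"
  defines "lhs \<equiv> ennreal (sigma_const n \<alpha> * L1_norm f powr ((real n + \<alpha>) / real n)
                     * real_of_ereal (Linf_norm f) powr (- (\<alpha> / real n)))"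
    and "rhs \<equiv> (\<integral>\<^sup>+ y. (\<integral>\<^sup>+ x. ennreal (min (f x) (f y) / norm (x - y) powr (real n - \<alpha>))
                      \<partial>lebesgue) \<partial>lebesgue)"
  shows "lhs \<le> rhs \<and>
    (lhs = rhs \<longleftrightarrow>
      (\<exists>c a r. r > 0 \<and> (AE x in lebesgue. f x = c * indicator (ball a r) x)))"
proof -
  define p where "p = \<alpha> - real n"
  have p: "p > 0" using alpha by (simp add: p_def)
  have dim: "n = DIM(real ^ 'n)" "n > 0" using n by simp_all
  have \<alpha>: "real n + p = \<alpha>" by (simp add: p_def)
  define q where "q = (2 * real n + p) / real n"
  have q: "(real n + \<alpha>) / real n = q" "- (\<alpha> / real n) = 1 - q"
    using dim(2) by (simp_all add: q_def p_def field_simps)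
  have fm: "f \<in> borel_measurable lebesgue"
    using L1 by simp
  obtain g0 where g0: "g0 \<in> borel_measurable lborel" "AE x in lborel. f x = g0 x"
    using completion_ex_borel_measurable_real[OF fm] by blast
  \<comment> \<open>A Borel representative that is non-negative everywhere, as the layer formulas
    require.\<close>
  define g where "g = (\<lambda>x. max 0 (g0 x))"
  have gm [measurable]: "g \<in> borel_measurable borel"
    using g0(1) unfolding g_def by measurable
  have nn: "g x \<ge> 0" for x by (simp add: g_def)
  have fg: "AE x in lborel. f x = g x"
    using nonneg[unfolded AE_completion_iff] g0(2) by eventually_elim (simp add: g_def)
  have fg': "AE x in lebesgue. f x = g x"
    using fg by (rule AE_completion)
  have gm': "g \<in> borel_measurable lebesgue"
    using gm by (simp add: measurable_completion)
  have int: "integrable lborel g"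
  proof -
    have "integrable lebesgue g"
      using integrable_cong_AE[OF fm gm' fg'] L1 by blast
    then show ?thesis
      using integrable_completion[of g lborel] gm by simp
  qed
  have L: "L1_norm f = (LINT x|lborel. g x)"
  proof -
    have "L1_norm f = (LINT x|lebesgue. g x)"
      unfolding L1_norm_def
      by (rule integral_cong_AE) (use fm gm' fg' nn in \<open>auto elim: eventually_mono\<close>)
    then show ?thesis
      by (simp add: integral_completion)
  qed
  have not0: "\<not> (AE x in lborel. g x = 0)"
  proof
    assume "AE x in lborel. g x = 0"
    then have "AE x in lebesgue. f x = 0"
      unfolding AE_completion_iff using fg by eventually_elim simp
    then have "AE x in lebesgue. x \<notin> {x. f x \<noteq> 0}"
      by simp
    moreover have "{x. f x \<noteq> 0} \<in> sets lebesgue"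
      using measurable_sets[OF fm, of "- {0}"] by (simp add: vimage_def)
    ultimately have "{x. f x \<noteq> 0} \<in> null_sets lebesgue"
      by (simp add: AE_iff_null_sets)
    then show False using nonzero by (simp add: null_sets_def)
  qed
  have Lpos: "(LINT x|lborel. g x) > 0"
    using not0 nn integral_nonneg_eq_0_iff_AE[OF int] Bochner_Integration.integral_nonneg[of lborel g]
    by (auto simp: less_le)
  have essup: "AE x in lborel. ereal \<bar>f x\<bar> \<le> Linf_norm f"
    using esssup_AE[of "\<lambda>x. ereal \<bar>f x\<bar>" lebesgue] by (simp add: Linf_norm_def AE_completion_iff)
  obtain M where M: "Linf_norm f = ereal M"
  proof (cases "Linf_norm f")
    \<comment> \<open>As a bound for absolute values \<open>-\<infinity>\<close> could hold only
      vacuously, against \<open>not0\<close>.\<close>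
    case MInf
    have "AE x in lborel. g x = 0"
      using essup by eventually_elim (simp add: MInf)
    then show thesis
      using not0 by simp
  qed (use Linf in auto)
  have gM: "AE x in lborel. g x \<le> M"
    using essup fg by eventually_elim (simp add: M)
  have Mpos: "M > 0"
  proof (rule ccontr)
    assume "\<not> M > 0"
    then have "AE x in lborel. g x = 0"
      using gM by (auto elim!: eventually_mono intro: antisym[OF _ nn])
    then show False using not0 by simp
  qed
  define J where "J = (\<integral>\<^sup>+y. (\<integral>\<^sup>+x. ennreal (min (g x) (g y)) * ennreal (norm (x - y) powr p) \<partial>lborel) \<partial>lborel)"
  have rhsJ: "rhs = J"
  proof -
    \<comment> \<open>On the diagonal both sides vanish, since \<open>0 powr s = 0\<close> and
      division by 0 gives 0.\<close>
    have kern: "ennreal (m / norm z powr (real n - \<alpha>)) = ennreal m * ennreal (norm z powr p)" for m and z :: "real ^ 'n"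
    proof -
      have "norm z powr (real n - \<alpha>) = inverse (norm z powr p)"
        by (simp add: p_def flip: powr_minus)
      then show ?thesis
        by (simp add: ennreal_mult'' divide_inverse)
    qed
    have "rhs = (\<integral>\<^sup>+y. (\<integral>\<^sup>+x. ennreal (min (f x) (f y)) * ennreal (norm (x - y) powr p) \<partial>lborel) \<partial>lborel)"
      unfolding rhs_def kern nn_integral_completion ..
    also have "\<dots> = J"
      unfolding J_def
    proof (rule nn_integral_cong_AE, use fg in eventually_elim)
      fix y assume "f y = g y"
      then show "(\<integral>\<^sup>+x. ennreal (min (f x) (f y)) * ennreal (norm (x - y) powr p) \<partial>lborel)
          = (\<integral>\<^sup>+x. ennreal (min (g x) (g y)) * ennreal (norm (x - y) powr p) \<partial>lborel)"
        by (intro nn_integral_cong_AE) (use fg in \<open>eventually_elim; simp\<close>)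
    qed
    finally show ?thesis .
  qed
  have lhs: "lhs = ennreal (sigma_const n (real n + p) * (LINT x|lborel. g x) powr q * M powr (1 - q))"
    unfolding lhs_def L M q \<alpha> by simp
  have le: "lhs \<le> rhs"
    unfolding lhs rhsJ J_def q_def dim(1)
    using min_energy_ge(1)[OF gm nn int Lpos Mpos gM p] by simp
  have "\<exists>c a r. r > 0 \<and> (AE x in lebesgue. f x = c * indicator (ball a r) x)" if "lhs = rhs"
  proof -
    have "J \<le> ennreal (sigma_const n (real n + p) * (LINT x|lborel. g x) powr q * M powr (1 - q))"
      using that lhs rhsJ by simp
    then obtain a r where r: "r > 0" and ae: "AE x in lborel. g x = M * indicator (ball a r) x"
      unfolding J_def q_def dim(1)
      using min_energy_ge(2)[OF gm nn int Lpos Mpos gM p] by auto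
    have "AE x in lebesgue. f x = M * indicator (ball a r) x"
      unfolding AE_completion_iff using fg ae by eventually_elim simp
    then show ?thesis using r by blast
  qed
  moreover have "lhs = rhs" if "r > 0" and ball: "AE x in lebesgue. f x = c * indicator (ball a r) x" for c a r
  proof -
    let ?B = "ball a r"
    have [measurable]: "?B \<in> sets borel" by simp
    have gc: "AE x in lborel. g x = c * indicator ?B x"
      using fg ball[unfolded AE_completion_iff] by eventually_elim simp
    have Bpos: "\<not> (AE x in lborel. x \<notin> ?B)"
    proof -
      have "emeasure lborel ?B \<noteq> 0"
        using \<open>r > 0\<close> unit_ball_vol_pos[of "real CARD('n)"] by (simp add: emeasure_ball less_imp_neq[symmetric])
      then show ?thesis
        using AE_iff_null_sets[of ?B lborel] by (simp add: null_sets_def del: mem_ball)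
    qed
    \<comment> \<open>The ball has positive measure, so \<open>c\<close> is at most the essential
      bound \<open>M\<close>; conversely \<open>c\<close>, once known to be non-negative, is itself
      an essential bound.\<close>
    have c: "c = M"
    proof (rule antisym)
      show "c \<le> M"
      proof (rule ccontr)
        assume "\<not> c \<le> M"
        then have "AE x in lborel. x \<notin> ?B"
          using gc gM by (auto elim: eventually_elim2)
        then show False using Bpos by simp
      qed
      have cnn: "c \<ge> 0"
      proof (rule ccontr)
        assume "\<not> c \<ge> 0"
        have "AE x in lborel. x \<notin> ?B"
          using gc
        proof eventually_elim
          case (elim x)
          then show ?case using nn[of x] \<open>\<not> c \<ge> 0\<close> by (auto simp: indicator_def split: if_splits)
        qed
        then show False using Bpos by simp
      qed
      have "Linf_norm f \<le> ereal c"
        unfolding Linf_norm_def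
      proof (rule esssup_I)
        show "(\<lambda>x. ereal \<bar>f x\<bar>) \<in> borel_measurable lebesgue"
          using fm by measurable
        show "AE x in lebesgue. ereal \<bar>f x\<bar> \<le> ereal c"
          using ball by eventually_elim (use cnn in \<open>auto simp: indicator_def\<close>)
      qed
      then show "M \<le> c" by (simp add: M)
    qed
    have mB: "measure lborel ?B = measure lborel (ball (0 :: real ^ 'n) r)"
      using \<open>r > 0\<close> by (simp add: content_ball)
    have Lint: "(LINT x|lborel. g x) = M * measure lborel ?B"
    proof -
      have "(LINT x|lborel. g x) = (LINT x|lborel. M * indicator ?B x)"
        by (rule integral_cong_AE) (use gc c in auto)
      then show ?thesis by simp
    qed
    have "J = (\<integral>\<^sup>+y. (\<integral>\<^sup>+x. ennreal M * (indicator ?B x * indicator ?B y * ennreal (norm (x - y) powr p)) \<partial>lborel) \<partial>lborel)"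
      unfolding J_def
    proof (rule nn_integral_cong_AE, use gc in eventually_elim)
      fix y assume y: "g y = c * indicator ?B y"
      show "(\<integral>\<^sup>+x. ennreal (min (g x) (g y)) * ennreal (norm (x - y) powr p) \<partial>lborel)
          = (\<integral>\<^sup>+x. ennreal M * (indicator ?B x * indicator ?B y * ennreal (norm (x - y) powr p)) \<partial>lborel)"
      proof (rule nn_integral_cong_AE, use gc in eventually_elim)
        fix x assume x: "g x = c * indicator ?B x"
        show "ennreal (min (g x) (g y)) * ennreal (norm (x - y) powr p)
          = ennreal M * (indicator ?B x * indicator ?B y * ennreal (norm (x - y) powr p))"
          unfolding x y c using Mpos by (simp add: indicator_def)
      qed
    qed
    also have "\<dots> = ennreal M * (\<integral>\<^sup>+y. (\<integral>\<^sup>+x. indicator ?B x * indicator ?B y * ennreal (norm (x - y) powr p) \<partial>lborel) \<partial>lborel)"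
      by (simp add: nn_integral_cmult)
    also have "(\<integral>\<^sup>+y. (\<integral>\<^sup>+x. indicator ?B x * indicator ?B y * ennreal (norm (x - y) powr p) \<partial>lborel) \<partial>lborel) = energy p ?B"
      unfolding energy_def by (rule lborel_pair.Fubini') measurable
    also have "energy p ?B = energy p (ball (0 :: real ^ 'n) r)"
    proof -
      have "(\<lambda>x. x + a) -` ?B = ball 0 r"
        by (auto simp: dist_norm)
      then show ?thesis
        using energy_translate[of ?B p a] by simp
    qed
    also have "\<dots> = ennreal (sigma_const n (real n + p) * measure lborel ?B powr q)"
      using energy_ball[OF p \<open>r > 0\<close>, where 'a="real ^ 'n"] unfolding mB q_def dim(1) by simp
    also have "ennreal M * \<dots> = lhs"
    proof -
      have "measure lborel ?B > 0" using \<open>r > 0\<close> by simp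
      \<comment> \<open>The factor \<open>M powr (1 - q)\<close> reduces the power
        \<open>M powr q\<close> from the \<open>L1\<close> norm to the single factor
        \<open>M\<close> that the minimum contributes.\<close>
      then have eq: "M * (sigma_const n (real n + p) * measure lborel ?B powr q)
          = sigma_const n (real n + p) * (M * measure lborel ?B) powr q * M powr (1 - q)"
        using Mpos by (simp add: powr_mult powr_diff)
      then show ?thesis
        unfolding lhs Lint eq[symmetric] using Mpos by (simp add: ennreal_mult')
    qed
    finally show ?thesis
      by (simp add: rhsJ)
  qed
  ultimately show ?thesis
    using le by blast
qed

end
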